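(* Let $g\in L^2(\mathbb{H})$ and let $A,B>0$. The system $\{L_{(2k,l,m)}g:k,l,m\in\mathbb{Z}\}$ is a frame sequence in $L^2(\mathbb{H})$ with bounds $A,B$ if and only if, for every finite set $\mathcal{F}\subset\mathbb{Z}^2$ and every finite sequence of complex numbers $\{\alpha_{k,l}\}_{(k,l)\in\mathcal{F}}$, \begin{align*} A\sum_{r\in\mathbb{Z}}\bigg\|\sum_{(k',l')\in\mathcal{F}}\alpha_{k',l'}(T^t_{(2k',l')})^{\lambda-r}g^{\lambda-r}\bigg\|_{L^2(\mathbb{R}^2)}^2 &\leq \sum_{k,l\in\mathbb{Z}}\bigg|\sum_{(k',l')\in\mathcal{F},\,r\in\mathbb{Z}}\alpha_{k',l'}e^{2\pi i(\lambda-r)(kl'-lk')}\Big\langle (T^t_{(2(k'-k),l'-l)})^{\lambda-r}g^{\lambda-r},g^{\lambda-r}\Big\rangle_{L^2(\mathbb{R}^2)}\bigg|^2\\ &\leq B\sum_{r\in\mathbb{Z}}\bigg\|\sum_{(k',l')\in\mathcal{F}}\alpha_{k',l'}(T^t_{(2k',l')})^{\lambda-r}g^{\lambda-r}\bigg\|_{L^2(\mathbb{R}^2)}^2 \end{align*} for a.e. $\lambda\in(0,1]$.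
   Context: The Heisenberg group $\mathbb{H}$ is $\mathbb{R}\times\mathbb{R}\times\mathbb{R}$ with group law $(x,y,t)(x',y',t')=(x+x',y+y',t+t'+\tfrac12(x'y-y'x))$; its Haar measure is Lebesgue measure $dx\,dy\,dt$. For $(u,v,s)\in\mathbb{H}$ the left translation operator is $L_{(u,v,s)}f(x,y,t)=f((u,v,s)^{-1}(x,y,t))$, a unitary operator on $L^2(\mathbb{H})$. For $f\in L^2(\mathbb{H})$, $f^\lambda(x,y)=\int_{\mathbb{R}}f(x,y,t)e^{2\pi i\lambda t}\,dt$ is the inverse Fourier transform of $f$ in the variable $t$ (in the $L^2$ sense); $f^\lambda\in L^2(\mathbb{R}^2)$ for a.e. $\lambda$. For $(u,v)\in\mathbb{R}^2$ and $\lambda\in\mathbb{R}\setminus\{0\}$ the $\lambda$-twisted translation operator on $L^2(\mathbb{R}^2)$ is $(T^t_{(u,v)})^\lambda F(x,y)=e^{\pi i\lambda(vx-uy)}F(x-u,y-v)$ (the superscript $t$ is only part of the notation). Inner products are linear in the first variable. A countable family $\{f_j\}$ in a Hilbert space is a frame sequence with bounds $A,B>0$ if $A\|f\|^2\le\sum_j|\langle f,f_j\rangle|^2\le B\|f\|^2$ for all $f\in\overline{\mathrm{span}\{f_j\}}$. *)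

theory Defs
  imports "HOL-Analysis.Analysis"
begin

text \<open>Elements of \<open>L\<^sup>2(M)\<close> are represented by Borel measurable, square integrable functions,
  without passing to almost everywhere classes.\<close>

definition L2 :: "'a measure \<Rightarrow> ('a \<Rightarrow> complex) set" where
  "L2 M = {f \<in> borel_measurable M. integrable M (\<lambda>x. (cmod (f x))\<^sup>2)}"

definition l2_inner :: "'a measure \<Rightarrow> ('a \<Rightarrow> complex) \<Rightarrow> ('a \<Rightarrow> complex) \<Rightarrow> complex" where
  "l2_inner M f g = (\<integral>x. f x * cnj (g x) \<partial>M)"

definition l2_norm :: "'a measure \<Rightarrow> ('a \<Rightarrow> complex) \<Rightarrow> real" where
  "l2_norm M f = sqrt (\<integral>x. (cmod (f x))\<^sup>2 \<partial>M)"

definition lin_span :: "('i \<Rightarrow> 'a \<Rightarrow> complex) \<Rightarrow> ('a \<Rightarrow> complex) set" where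
  "lin_span \<phi> = {(\<lambda>x. \<Sum>j\<in>J. c j * \<phi> j x) | J c. finite J}"

definition l2_closure :: "'a measure \<Rightarrow> ('a \<Rightarrow> complex) set \<Rightarrow> ('a \<Rightarrow> complex) set" where
  "l2_closure M S = {f \<in> L2 M. \<forall>e>0. \<exists>h\<in>S. l2_norm M (\<lambda>x. f x - h x) < e}"

text \<open>The sum of the frame coefficients is taken in \<open>[0, \<infinity>]\<close>, so that its convergence is part of the
  upper bound and not an artefact of the value of a divergent real sum.\<close>

definition frame_sequence ::
    "'a measure \<Rightarrow> ('i::countable \<Rightarrow> 'a \<Rightarrow> complex) \<Rightarrow> real \<Rightarrow> real \<Rightarrow> bool" where
  "frame_sequence M \<phi> A B \<longleftrightarrow>
     0 < A \<and> 0 < B \<and> (\<forall>j. \<phi> j \<in> L2 M) \<and>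
     (\<forall>f \<in> l2_closure M (lin_span \<phi>).
        ennreal (A * (l2_norm M f)\<^sup>2) \<le> (\<Sum>\<^sub>\<infinity>j\<in>UNIV. ennreal ((cmod (l2_inner M f (\<phi> j)))\<^sup>2)) \<and>
        (\<Sum>\<^sub>\<infinity>j\<in>UNIV. ennreal ((cmod (l2_inner M f (\<phi> j)))\<^sup>2)) \<le> ennreal (B * (l2_norm M f)\<^sup>2))"

type_synonym heis = "real \<times> real \<times> real"

fun heis_mult :: "heis \<Rightarrow> heis \<Rightarrow> heis" where
  "heis_mult (x, y, t) (x', y', t') = (x + x', y + y', t + t' + (x' * y - y' * x) / 2)"

fun heis_inv :: "heis \<Rightarrow> heis" where
  "heis_inv (x, y, t) = (- x, - y, - t)"

lemma heis_mult_assoc: "heis_mult (heis_mult p q) r = heis_mult p (heis_mult q r)"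
  by (cases p; cases q; cases r) (simp add: field_simps)

lemma heis_mult_zero: "heis_mult (0, 0, 0) p = p" "heis_mult p (0, 0, 0) = p"
  by (cases p; simp)+

lemma heis_mult_inv: "heis_mult (heis_inv p) p = (0, 0, 0)" "heis_mult p (heis_inv p) = (0, 0, 0)"
  by (cases p; simp)+

definition heis_translate :: "heis \<Rightarrow> (heis \<Rightarrow> complex) \<Rightarrow> heis \<Rightarrow> complex" where
  "heis_translate p f = (\<lambda>q. f (heis_mult (heis_inv p) q))"

text \<open>The inverse Fourier transform in the last variable, in the \<open>L\<^sup>2\<close> sense: the transform of
  \<open>f\<close> is the limit in \<open>L\<^sup>2(\<real>\<^sup>3)\<close>, as \<open>n \<rightarrow> \<infinity>\<close>, of the integrals over \<open>-n \<le> t \<le> n\<close>, which converge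
  absolutely for almost every \<open>(x, y)\<close>. The limit is unique up to a null set of triples \<open>(x, y, w)\<close>,
  hence for almost every \<open>w\<close> the slice at \<open>w\<close> is determined as an element of \<open>L\<^sup>2(\<real>\<^sup>2)\<close>;
  some representative is chosen.\<close>

definition is_inv_fourier_t :: "(heis \<Rightarrow> complex) \<Rightarrow> (real \<Rightarrow> real \<times> real \<Rightarrow> complex) \<Rightarrow> bool" where
  "is_inv_fourier_t f G \<longleftrightarrow>
     (\<lambda>(x, y, w). G w (x, y)) \<in> L2 (lborel :: (real \<times> real \<times> real) measure) \<and>
     (\<lambda>n::nat. \<integral>\<^sup>+ (x, y, w). ennreal ((cmod
          ((LINT t:{- real n..real n}|lborel. f (x, y, t) * cis (2 * pi * w * t)) - G w (x, y)))\<^sup>2)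
        \<partial>(lborel :: (real \<times> real \<times> real) measure)) \<longlonglongrightarrow> 0"

definition inv_fourier_t :: "(heis \<Rightarrow> complex) \<Rightarrow> real \<Rightarrow> real \<times> real \<Rightarrow> complex" where
  "inv_fourier_t f = (SOME G. is_inv_fourier_t f G)"

definition twisted_translate ::
    "real \<Rightarrow> real \<times> real \<Rightarrow> (real \<times> real \<Rightarrow> complex) \<Rightarrow> real \<times> real \<Rightarrow> complex" where
  "twisted_translate w = (\<lambda>(u, v) F (x, y). cis (pi * w * (v * x - u * y)) * F (x - u, y - v))"

text \<open>For \<open>g \<in> L\<^sup>2(\<real>\<^sup>3)\<close> the next two series are meaningful for almost every \<open>w\<close>: the slices of the
  transform at \<open>w - r\<close> are then in \<open>L\<^sup>2(\<real>\<^sup>2)\<close> with square summable norms, so the inner sum in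
  \<open>analysis_sum\<close> converges absolutely; its outer sum is taken in \<open>[0, \<infinity>]\<close>.\<close>

definition synthesis_sum ::
    "(heis \<Rightarrow> complex) \<Rightarrow> (int \<times> int) set \<Rightarrow> (int \<times> int \<Rightarrow> complex) \<Rightarrow> real \<Rightarrow> ennreal" where
  "synthesis_sum g F \<alpha> w =
     (\<Sum>\<^sub>\<infinity>r\<in>(UNIV :: int set). ennreal ((l2_norm lborel (\<lambda>z. \<Sum>(k', l')\<in>F.
        \<alpha> (k', l') * twisted_translate (w - of_int r) (2 * of_int k', of_int l') (inv_fourier_t g (w - of_int r)) z))\<^sup>2))"

definition analysis_sum ::
    "(heis \<Rightarrow> complex) \<Rightarrow> (int \<times> int) set \<Rightarrow> (int \<times> int \<Rightarrow> complex) \<Rightarrow> real \<Rightarrow> ennreal" where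
  "analysis_sum g F \<alpha> w =
     (\<Sum>\<^sub>\<infinity>(k, l)\<in>(UNIV :: (int \<times> int) set). ennreal ((cmod
        (\<Sum>\<^sub>\<infinity>((k', l'), r)\<in>F \<times> (UNIV :: int set).
           \<alpha> (k', l') * cis (2 * pi * (w - of_int r) * of_int (k * l' - l * k')) *
           l2_inner lborel
             (twisted_translate (w - of_int r) (2 * of_int (k' - k), of_int (l' - l))
                (inv_fourier_t g (w - of_int r)))
             (inv_fourier_t g (w - of_int r))))\<^sup>2))"

end

theory Submission
  imports Defs
begin

text \<open>
  Write \<open>p\<close> for a pair \<open>(k, l)\<close>, \<open>g\<^sub>w\<close> for the slice at frequency \<open>w\<close> of the inverse Fourier transform of
  \<open>g\<close> in the last variable, and \<open>T\<^sub>p\<close> for the twisted translation by \<open>(2k, l)\<close> at frequency \<open>w\<close>. The transform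
  turns the translation by \<open>(2k, l, m)\<close> into \<open>T\<^sub>p\<close> followed by multiplication with \<open>cis (2 \<pi> m w)\<close>, and it
  is isometric. The Gram matrix of the system therefore consists of Fourier coefficients: its entry at
  \<open>(p, m)\<close>, \<open>(q, n)\<close> is the integral over \<open>(0, 1]\<close> of \<open>cis (2 \<pi> (m - n) w) W\<^sub>p\<^sub>q(w)\<close>, where
  \<open>W\<^sub>p\<^sub>q\<close> is the periodisation of \<open>w \<mapsto> \<langle>T\<^sub>p g\<^sub>w, T\<^sub>q g\<^sub>w\<rangle>\<close> (\<open>gram_lattice_translates\<close>).

  Norms and frame coefficients of finite combinations depend on the Gram matrix alone. If the combination has
  coefficients \<open>c\<^sub>p\<^sub>m\<close> and \<open>\<alpha>\<^sub>p(w) = \<Sum>\<^sub>m c\<^sub>p\<^sub>m cis (2 \<pi> m w)\<close>, then its squared norm is the integral of the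
  synthesis sum at \<open>\<alpha>(w)\<close>, and by Parseval's identity its frame coefficients have as total energy the integral of the
  analysis sum at \<open>\<alpha>(w)\<close>. Hence inequalities for almost every \<open>w\<close> and all constant \<open>\<alpha>\<close> give the frame inequalities on the
  span, after an approximation of \<open>\<alpha>(w)\<close> by its values at rational frequencies that moves the null set out of
  the way; they pass to the closed span by \<open>frame_inequalities_limit\<close>. Conversely, the frame
  inequalities for \<open>\<alpha>\<close> multiplied by an arbitrary trigonometric polynomial \<open>t\<close> are the fibre inequalities
  integrated against \<open>\<bar>t\<bar>\<^sup>2\<close>, and these weights detect the sign of an integrable function
  (\<open>AE_nonneg_if_trig_poly_integrals_nonneg\<close>).

  Parseval's identity is needed for integrable functions, with both sides in \<open>[0, \<infinity>]\<close>, because the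
  periodised coefficients are not known to be square integrable (\<open>Parseval_unit_interval\<close>). Integrated
  over translates of the frequency it also yields Plancherel's theorem for functions of bounded support
  (\<open>Plancherel_bounded_support\<close>), on which the existence of the transform and its isometry rest.
\<close>

section \<open>Square integrable functions\<close>

lemma L2_iff_nn_integral:
  "f \<in> L2 M \<longleftrightarrow> f \<in> borel_measurable M \<and> (\<integral>\<^sup>+x. ennreal ((cmod (f x))\<^sup>2) \<partial>M) < \<infinity>"
  by (auto simp: L2_def integrable_iff_bounded)

lemma L2_measurable [measurable_dest]: "f \<in> L2 M \<Longrightarrow> f \<in> borel_measurable M"
  by (simp add: L2_def)

lemma L2_integrable_square: "f \<in> L2 M \<Longrightarrow> integrable M (\<lambda>x. (cmod (f x))\<^sup>2)"
  by (simp add: L2_def)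

lemma l2_norm_nonneg [simp]: "0 \<le> l2_norm M f"
  by (simp add: l2_norm_def)

lemma l2_norm_square: "(l2_norm M f)\<^sup>2 = (\<integral>x. (cmod (f x))\<^sup>2 \<partial>M)"
  by (simp add: l2_norm_def)

lemma nn_integral_square_eq_l2_norm:
  "f \<in> L2 M \<Longrightarrow> (\<integral>\<^sup>+x. ennreal ((cmod (f x))\<^sup>2) \<partial>M) = ennreal ((l2_norm M f)\<^sup>2)"
  unfolding l2_norm_square by (rule nn_integral_eq_integral) (auto simp: L2_def)

lemma borel_measurable_cnj [measurable (raw)]:
  "f \<in> borel_measurable M \<Longrightarrow> (\<lambda>x. cnj (f x)) \<in> borel_measurable M"
  by (rule borel_measurable_continuous_on[of cnj]) (intro continuous_intros)

lemma integrable_mult_cnj: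
  assumes "f \<in> L2 M" "g \<in> L2 M"
  shows "integrable M (\<lambda>x. f x * cnj (g x))"
proof (rule Bochner_Integration.integrable_bound)
  show "integrable M (\<lambda>x. (cmod (f x))\<^sup>2 + (cmod (g x))\<^sup>2)"
    using assms by (auto simp: L2_def)
  show "(\<lambda>x. f x * cnj (g x)) \<in> borel_measurable M"
    using assms[THEN L2_measurable] by measurable
  have "cmod (f x) * cmod (g x) \<le> (cmod (f x))\<^sup>2 + (cmod (g x))\<^sup>2" for x
    using sum_squares_bound[of "cmod (f x)" "cmod (g x)"]
      mult_nonneg_nonneg[OF norm_ge_zero[of "f x"] norm_ge_zero[of "g x"]] by linarith
  then show "AE x in M. norm (f x * cnj (g x)) \<le> norm ((cmod (f x))\<^sup>2 + (cmod (g x))\<^sup>2)"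
    by (auto simp: norm_mult)
qed

lemma L2_cmult: "f \<in> L2 M \<Longrightarrow> (\<lambda>x. c * f x) \<in> L2 M"
  by (auto simp: L2_def norm_mult power_mult_distrib)

lemma L2_add:
  assumes "f \<in> L2 M" "g \<in> L2 M"
  shows "(\<lambda>x. f x + g x) \<in> L2 M"
proof -
  have [measurable]: "f \<in> borel_measurable M" "g \<in> borel_measurable M"
    using assms by (auto simp: L2_def)
  have "integrable M (\<lambda>x. 2 * (cmod (f x))\<^sup>2 + 2 * (cmod (g x))\<^sup>2)"
    using assms by (auto simp: L2_def)
  moreover have "(cmod (f x + g x))\<^sup>2 \<le> 2 * (cmod (f x))\<^sup>2 + 2 * (cmod (g x))\<^sup>2" for x
    using norm_triangle_ineq[of "f x" "g x"] power_mono[of "cmod (f x + g x)" "cmod (f x) + cmod (g x)" 2]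
      sum_squares_bound[of "cmod (f x)" "cmod (g x)"] by (simp add: power2_sum)
  ultimately have "integrable M (\<lambda>x. (cmod (f x + g x))\<^sup>2)"
    by (elim Bochner_Integration.integrable_bound) auto
  then show ?thesis
    by (simp add: L2_def)
qed

lemma L2_zero: "(\<lambda>x. 0) \<in> L2 M"
  by (simp add: L2_def)

lemma L2_diff: "f \<in> L2 M \<Longrightarrow> g \<in> L2 M \<Longrightarrow> (\<lambda>x. f x - g x) \<in> L2 M"
  using L2_add[of f M "\<lambda>x. -1 * g x"] L2_cmult[of g M "-1"] by simp

lemma L2_sum: "(\<And>i. i \<in> I \<Longrightarrow> f i \<in> L2 M) \<Longrightarrow> (\<lambda>x. \<Sum>i\<in>I. f i x) \<in> L2 M"
  by (induction I rule: infinite_finite_induct) (auto intro: L2_add L2_zero)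

lemma L2_bounded_mult:
  assumes "f \<in> L2 M" "m \<in> borel_measurable M" "\<And>x. cmod (m x) \<le> 1"
  shows "(\<lambda>x. m x * f x) \<in> L2 M"
proof -
  have [measurable]: "f \<in> borel_measurable M" "m \<in> borel_measurable M"
    using assms by (auto simp: L2_def)
  have "(cmod (m x * f x))\<^sup>2 \<le> (cmod (f x))\<^sup>2" for x
    using assms(3)[of x] by (auto simp: norm_mult intro!: power_mono mult_left_le_one_le)
  then have "integrable M (\<lambda>x. (cmod (m x * f x))\<^sup>2)"
    by (intro Bochner_Integration.integrable_bound[OF L2_integrable_square[OF assms(1)]]) auto
  then show ?thesis
    by (simp add: L2_def)
qed

lemma l2_inner_self: "l2_inner M f f = complex_of_real ((l2_norm M f)\<^sup>2)"
proof -
  have "l2_inner M f f = (\<integral>x. complex_of_real ((cmod (f x))\<^sup>2) \<partial>M)"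
    unfolding l2_inner_def by (rule Bochner_Integration.integral_cong[OF refl]) (rule complex_norm_square[symmetric])
  then show ?thesis
    by (simp add: l2_norm_square del: of_real_power)
qed

lemma cnj_l2_inner: "cnj (l2_inner M f g) = l2_inner M g f"
  unfolding l2_inner_def
  by (subst Bochner_Integration.integral_cnj[symmetric]) (intro Bochner_Integration.integral_cong, auto)

lemma l2_inner_sum_left:
  assumes "\<And>i. i \<in> I \<Longrightarrow> f i \<in> L2 M" "g \<in> L2 M"
  shows "l2_inner M (\<lambda>x. \<Sum>i\<in>I. c i * f i x) g = (\<Sum>i\<in>I. c i * l2_inner M (f i) g)"
proof -
  have "l2_inner M (\<lambda>x. \<Sum>i\<in>I. c i * f i x) g = (\<integral>x. (\<Sum>i\<in>I. c i * (f i x * cnj (g x))) \<partial>M)"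
    by (simp add: l2_inner_def sum_distrib_right mult.assoc)
  also have "\<dots> = (\<Sum>i\<in>I. \<integral>x. c i * (f i x * cnj (g x)) \<partial>M)"
    using assms by (intro Bochner_Integration.integral_sum integrable_mult_right integrable_mult_cnj)
  finally show ?thesis
    by (simp add: l2_inner_def)
qed

lemma l2_inner_sum_right:
  assumes "\<And>i. i \<in> I \<Longrightarrow> f i \<in> L2 M" "g \<in> L2 M"
  shows "l2_inner M g (\<lambda>x. \<Sum>i\<in>I. c i * f i x) = (\<Sum>i\<in>I. cnj (c i) * l2_inner M g (f i))"
  using arg_cong[OF l2_inner_sum_left[where I = I and f = f and c = c, OF assms], of cnj]
  by (simp add: cnj_l2_inner)

lemma l2_inner_diff_left:
  assumes "f \<in> L2 M" "f' \<in> L2 M" "g \<in> L2 M"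
  shows "l2_inner M (\<lambda>x. f x - f' x) g = l2_inner M f g - l2_inner M f' g"
  unfolding l2_inner_def left_diff_distrib
  using assms by (intro Bochner_Integration.integral_diff integrable_mult_cnj)

lemma l2_inner_diff_right:
  assumes "f \<in> L2 M" "f' \<in> L2 M" "g \<in> L2 M"
  shows "l2_inner M g (\<lambda>x. f x - f' x) = l2_inner M g f - l2_inner M g f'"
  using arg_cong[OF l2_inner_diff_left[OF assms], of cnj] by (simp add: cnj_l2_inner)

lemma l2_Cauchy_Schwarz:
  assumes "f \<in> L2 M" "g \<in> L2 M"
  shows "cmod (l2_inner M f g) \<le> l2_norm M f * l2_norm M g"
proof -
  have [measurable]: "f \<in> borel_measurable M" "g \<in> borel_measurable M"
    using assms by (auto simp: L2_def)
  have "cmod (l2_inner M f g) \<le> (\<integral>x. cmod (f x) * cmod (g x) \<partial>M)"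
    unfolding l2_inner_def
    using integral_norm_bound[of M "\<lambda>x. f x * cnj (g x)"] by (simp add: norm_mult)
  moreover have "ennreal ((\<integral>x. cmod (f x) * cmod (g x) \<partial>M)\<^sup>2) \<le> ennreal ((l2_norm M f * l2_norm M g)\<^sup>2)"
  proof -
    have int: "integrable M (\<lambda>x. cmod (f x) * cmod (g x))"
      using integrable_norm[OF integrable_mult_cnj[OF assms]] by (simp add: norm_mult)
    have "(\<integral>\<^sup>+x. ennreal (cmod (f x)) * ennreal (cmod (g x)) \<partial>M)\<^sup>2
      \<le> (\<integral>\<^sup>+x. (ennreal (cmod (f x)))\<^sup>2 \<partial>M) * (\<integral>\<^sup>+x. (ennreal (cmod (g x)))\<^sup>2 \<partial>M)"
      by (rule Cauchy_Schwarz_nn_integral) auto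
    also have "\<dots> = ennreal ((l2_norm M f)\<^sup>2) * ennreal ((l2_norm M g)\<^sup>2)"
      using assms[THEN nn_integral_square_eq_l2_norm] by (simp add: ennreal_power)
    also have "(\<integral>\<^sup>+x. ennreal (cmod (f x)) * ennreal (cmod (g x)) \<partial>M) = ennreal (\<integral>x. cmod (f x) * cmod (g x) \<partial>M)"
      using int by (subst nn_integral_eq_integral[symmetric]) (auto simp: ennreal_mult)
    finally show ?thesis
      by (simp add: ennreal_power ennreal_mult[symmetric] power_mult_distrib)
  qed
  then have "(\<integral>x. cmod (f x) * cmod (g x) \<partial>M)\<^sup>2 \<le> (l2_norm M f * l2_norm M g)\<^sup>2"
    by (subst (asm) ennreal_le_iff) auto
  then have "(\<integral>x. cmod (f x) * cmod (g x) \<partial>M) \<le> l2_norm M f * l2_norm M g"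
    by (rule power2_le_imp_le) simp
  ultimately show ?thesis
    by linarith
qed

lemma l2_norm_triangle:
  assumes "f \<in> L2 M" "g \<in> L2 M"
  shows "l2_norm M (\<lambda>x. f x + g x) \<le> l2_norm M f + l2_norm M g"
proof (rule power2_le_imp_le)
  have eq: "(cmod (a + b))\<^sup>2 = (cmod a)\<^sup>2 + (cmod b)\<^sup>2 + 2 * Re (a * cnj b)" for a b
    by (simp add: cmod_power2 power2_sum algebra_simps)
  have i: "integrable M (\<lambda>x. f x * cnj (g x))"
    using assms by (rule integrable_mult_cnj)
  have "(l2_norm M (\<lambda>x. f x + g x))\<^sup>2 = (l2_norm M f)\<^sup>2 + (l2_norm M g)\<^sup>2 + 2 * Re (l2_inner M f g)"
    unfolding l2_norm_square eq l2_inner_def integral_Re[OF i, symmetric]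
    using assms integrable_Re[OF i]
    by (simp add: L2_integrable_square del: times_complex.sel)
  also have "\<dots> \<le> (l2_norm M f)\<^sup>2 + (l2_norm M g)\<^sup>2 + 2 * (l2_norm M f * l2_norm M g)"
    using l2_Cauchy_Schwarz[OF assms] complex_Re_le_cmod[of "l2_inner M f g"] by linarith
  finally show "(l2_norm M (\<lambda>x. f x + g x))\<^sup>2 \<le> (l2_norm M f + l2_norm M g)\<^sup>2"
    by (simp add: power2_sum)
qed simp

lemma l2_norm_cmult: "l2_norm M (\<lambda>x. c * f x) = cmod c * l2_norm M f"
  by (simp add: l2_norm_def norm_mult power_mult_distrib real_sqrt_mult)

lemma l2_norm_minus_commute: "l2_norm M (\<lambda>x. f x - g x) = l2_norm M (\<lambda>x. g x - f x)"
  by (simp add: l2_norm_def norm_minus_commute)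

lemma l2_norm_triangle_diff:
  assumes "f \<in> L2 M" "g \<in> L2 M"
  shows "\<bar>l2_norm M f - l2_norm M g\<bar> \<le> l2_norm M (\<lambda>x. f x - g x)"
  using l2_norm_triangle[OF L2_diff[OF assms] assms(2)] l2_norm_triangle[OF L2_diff[OF assms(2,1)] assms(1)]
  by (simp add: l2_norm_minus_commute[of M g f])

lemma tendsto_l2_norm:
  assumes "\<And>n. f n \<in> L2 M" "h \<in> L2 M" "(\<lambda>n. l2_norm M (\<lambda>x. f n x - h x)) \<longlonglongrightarrow> 0"
  shows "(\<lambda>n. l2_norm M (f n)) \<longlonglongrightarrow> l2_norm M h"
proof (rule LIM_zero_cancel, rule Lim_null_comparison[OF _ assms(3)])
  show "\<forall>\<^sub>F n in sequentially. norm (l2_norm M (f n) - l2_norm M h) \<le> l2_norm M (\<lambda>x. f n x - h x)"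
    using l2_norm_triangle_diff[OF assms(1,2)] by simp
qed

lemma tendsto_l2_inner:
  assumes f: "\<And>n. f n \<in> L2 M" "h \<in> L2 M" "(\<lambda>n. l2_norm M (\<lambda>x. f n x - h x)) \<longlonglongrightarrow> 0"
    and g: "\<And>n. g n \<in> L2 M" "k \<in> L2 M" "(\<lambda>n. l2_norm M (\<lambda>x. g n x - k x)) \<longlonglongrightarrow> 0"
  shows "(\<lambda>n. l2_inner M (f n) (g n)) \<longlonglongrightarrow> l2_inner M h k"
proof (rule LIM_zero_cancel, rule Lim_null_comparison)
  show "(\<lambda>n. l2_norm M (\<lambda>x. f n x - h x) * l2_norm M (g n) + l2_norm M h * l2_norm M (\<lambda>x. g n x - k x))
      \<longlonglongrightarrow> 0"
    using tendsto_add[OF tendsto_mult[OF f(3) tendsto_l2_norm[OF g]] tendsto_mult_left[OF g(3), of "l2_norm M h"]]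
    by simp
  have "cmod (l2_inner M (f n) (g n) - l2_inner M h k)
      \<le> l2_norm M (\<lambda>x. f n x - h x) * l2_norm M (g n) + l2_norm M h * l2_norm M (\<lambda>x. g n x - k x)" for n
  proof -
    have "l2_inner M (f n) (g n) - l2_inner M h k
        = l2_inner M (\<lambda>x. f n x - h x) (g n) + l2_inner M h (\<lambda>x. g n x - k x)"
      using f g by (simp add: l2_inner_diff_left l2_inner_diff_right)
    then show ?thesis
      using norm_triangle_ineq[of "l2_inner M (\<lambda>x. f n x - h x) (g n)" "l2_inner M h (\<lambda>x. g n x - k x)"]
        l2_Cauchy_Schwarz[OF L2_diff[OF f(1,2)] g(1), of n n] l2_Cauchy_Schwarz[OF f(2) L2_diff[OF g(1,2)], of n]
      by simp
  qed
  then show "\<forall>\<^sub>F n in sequentially. norm (l2_inner M (f n) (g n) - l2_inner M h k)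
      \<le> l2_norm M (\<lambda>x. f n x - h x) * l2_norm M (g n) + l2_norm M h * l2_norm M (\<lambda>x. g n x - k x)"
    by simp
qed

text \<open>Polarisation: inner products are determined by the norms of the combinations
  \<open>f + c g\<close>, so an isometry preserves them.\<close>

lemma l2_inner_eq_if_norm_eq:
  assumes "f \<in> L2 M" "g \<in> L2 M" "f' \<in> L2 N" "g' \<in> L2 N"
    and eq: "\<And>c. l2_norm M (\<lambda>x. f x + c * g x) = l2_norm N (\<lambda>x. f' x + c * g' x)"
  shows "l2_inner M f g = l2_inner N f' g'"
proof -
  have expand: "(l2_norm M (\<lambda>x. f x + c * g x))\<^sup>2
      = (l2_norm M f)\<^sup>2 + (cmod c)\<^sup>2 * (l2_norm M g)\<^sup>2 + 2 * Re (cnj c * l2_inner M f g)"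
    if fg: "f \<in> L2 M" "g \<in> L2 M" for f g c and M :: "'c measure"
  proof -
    have eq: "(cmod (a + c * b))\<^sup>2 = (cmod a)\<^sup>2 + (cmod c)\<^sup>2 * (cmod b)\<^sup>2 + 2 * Re (cnj c * (a * cnj b))" for a b
      by (simp add: cmod_power2) algebra
    have i: "integrable M (\<lambda>x. cnj c * (f x * cnj (g x)))"
      by (intro integrable_mult_right integrable_mult_cnj fg)
    have "Re (cnj c * l2_inner M f g) = (\<integral>x. Re (cnj c * (f x * cnj (g x))) \<partial>M)"
      unfolding l2_inner_def by (subst integral_Re[OF i]) (simp del: times_complex.sel)
    then show ?thesis
      unfolding l2_norm_square eq
      using fg integrable_Re[OF i] by (simp add: L2_integrable_square del: times_complex.sel)
  qed
  have nf: "l2_norm M f = l2_norm N f'"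
    using eq[of 0] by simp
  have *: "(cmod c)\<^sup>2 * (l2_norm M g)\<^sup>2 + 2 * Re (cnj c * l2_inner M f g)
      = (cmod c)\<^sup>2 * (l2_norm N g')\<^sup>2 + 2 * Re (cnj c * l2_inner N f' g')" for c
    using expand[OF assms(1,2), of c] expand[OF assms(3,4), of c] eq[of c] nf by simp
  show ?thesis
    using *[of 1] *[of "-1"] *[of \<i>] *[of "-\<i>"] by (simp add: complex_eq_iff)
qed

section \<open>Trigonometric polynomials\<close>

abbreviation unit_interval :: "real measure" where
  "unit_interval \<equiv> restrict_space lborel {0<..1}"

lemma emeasure_unit_interval: "emeasure unit_interval (space unit_interval) = 1"
  by (simp add: emeasure_restrict_space)

lemma finite_measure_unit_interval: "finite_measure unit_interval"
  using emeasure_unit_interval by (intro finite_measureI) simp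

lemma borel_measurable_unit_interval:
  "f \<in> borel_measurable borel \<Longrightarrow> f \<in> borel_measurable unit_interval"
  by (rule measurable_restrict_space1) simp

lemma borel_measurable_cis [measurable (raw)]:
  "f \<in> borel_measurable M \<Longrightarrow> (\<lambda>x. cis (f x)) \<in> borel_measurable M"
  by (rule borel_measurable_continuous_on[of cis]) (intro continuous_intros)

inductive trig_poly :: "(real \<Rightarrow> complex) \<Rightarrow> bool" where
  monomial: "trig_poly (\<lambda>x. c * cis (2 * pi * of_int m * x))"
| add: "trig_poly p \<Longrightarrow> trig_poly q \<Longrightarrow> trig_poly (\<lambda>x. p x + q x)"

lemma trig_poly_const: "trig_poly (\<lambda>x. c)"
  using trig_poly.monomial[of c 0] by simp

lemma trig_poly_mult:
  assumes "trig_poly p" "trig_poly q"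
  shows "trig_poly (\<lambda>x. p x * q x)"
  using assms
proof (induction p rule: trig_poly.induct)
  case (monomial c m)
  then show ?case
  proof (induction q rule: trig_poly.induct)
    case (monomial d n)
    have "(\<lambda>x. c * cis (2 * pi * of_int m * x) * (d * cis (2 * pi * of_int n * x)))
        = (\<lambda>x. (c * d) * cis (2 * pi * of_int (m + n) * x))"
      by (simp add: algebra_simps cis_mult[symmetric])
    then show ?case
      by (metis trig_poly.monomial)
  qed (simp add: distrib_left trig_poly.add)
qed (simp add: distrib_right trig_poly.add)

lemma trig_polyE:
  assumes "trig_poly p"
  obtains K c where "finite K" "p = (\<lambda>x. \<Sum>m\<in>K. c m * cis (2 * pi * of_int m * x))"
proof -
  have "\<exists>K c. finite K \<and> p = (\<lambda>x. \<Sum>m\<in>K. c m * cis (2 * pi * of_int m * x))"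
    using assms
  proof (induction rule: trig_poly.induct)
    case (monomial c m)
    then show ?case
      by (intro exI[of _ "{m}"] exI[of _ "\<lambda>_. c"]) simp
  next
    case (add p q)
    then obtain K c L d where K: "finite K" "p = (\<lambda>x. \<Sum>m\<in>K. c m * cis (2 * pi * of_int m * x))"
      and L: "finite L" "q = (\<lambda>x. \<Sum>m\<in>L. d m * cis (2 * pi * of_int m * x))"
      by blast
    define c' where "c' m = (if m \<in> K then c m else 0)" for m
    define d' where "d' m = (if m \<in> L then d m else 0)" for m
    have "p = (\<lambda>x. \<Sum>m\<in>K \<union> L. c' m * cis (2 * pi * of_int m * x))"
      unfolding K(2) c'_def using K(1) L(1) by (intro ext sum.mono_neutral_cong_left) auto
    moreover have "q = (\<lambda>x. \<Sum>m\<in>K \<union> L. d' m * cis (2 * pi * of_int m * x))"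
      unfolding L(2) d'_def using K(1) L(1) by (intro ext sum.mono_neutral_cong_left) auto
    ultimately have "(\<lambda>x. p x + q x) = (\<lambda>x. \<Sum>m\<in>K \<union> L. (c' m + d' m) * cis (2 * pi * of_int m * x))"
      by (simp add: distrib_right sum.distrib)
    then show ?case
      using K(1) L(1) by (intro exI[of _ "K \<union> L"] exI[of _ "\<lambda>m. c' m + d' m"]) simp
  qed
  then show thesis
    using that by blast
qed

lemma borel_measurable_trig_poly: "trig_poly p \<Longrightarrow> p \<in> borel_measurable unit_interval"
  by (erule trig_polyE) (auto intro!: borel_measurable_unit_interval)

text \<open>Stone--Weierstrass on the unit circle, to which a function with equal end values descends.
  The real functions on the circle that pull back to trigonometric polynomials form an algebra,
  and the two coordinate functions in it separate points.\<close>

lemma trig_poly_approx_periodic_real: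
  fixes f :: "real \<Rightarrow> real"
  assumes f: "continuous_on {0..1} f" "f 0 = f 1" and e: "e > 0"
  shows "\<exists>p. trig_poly p \<and> (\<forall>x\<in>{0..1}. cmod (of_real (f x) - p x) < e)"
proof -
  define P where "P h \<longleftrightarrow> continuous_on (sphere (0::complex) 1) h \<and>
      trig_poly (\<lambda>x. complex_of_real (h (cis (2 * pi * x))))" for h :: "complex \<Rightarrow> real"
  define F where "F z = f (Arg2pi z / (2 * pi))" for z
  have cont: "continuous_on (sphere 0 1) F"
  proof -
    have "\<exists>F'. continuous_on (sphere (0::complex) 1) F' \<and> (\<forall>z\<in>sphere 0 1. F' z = F z)"
    proof -
      have sub: "(\<lambda>z. Arg2pi z / (2 * pi)) ` S \<subseteq> {0..1}" for S
        using Arg2pi_ge_0 Arg2pi_lt_2pi by (auto simp: less_imp_le)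
      \<comment> \<open>The argument jumps at \<open>1\<close>. Each closed half circle carries a continuous branch, and the two
        values at \<open>1\<close> agree since \<open>f 0 = f 1\<close>.\<close>
      have c1: "continuous_on (sphere 0 1 \<inter> {z. 0 \<le> Im z}) F"
        unfolding F_def
        by (intro continuous_intros continuous_on_compose2 [OF f(1)]
            continuous_on_subset [OF continuous_on_upperhalf_Arg2pi]) (use sub in auto)
      have "continuous_on (sphere 0 1 \<inter> {z. Im z \<le> 0}) (\<lambda>z. f (1 - Arg2pi (cnj z) / (2 * pi)))"
        by (intro continuous_intros continuous_on_compose2 [OF f(1)]
            continuous_on_compose2 [OF continuous_on_upperhalf_Arg2pi])
          (use Arg2pi_ge_0 Arg2pi_lt_2pi in \<open>auto simp: less_imp_le\<close>)
      moreover have "F z = f (1 - Arg2pi (cnj z) / (2 * pi))" if "z \<in> sphere 0 1" for z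
      proof -
        have "Arg2pi z = 2 * pi - Arg2pi (cnj z) \<or> Arg2pi z = 0 \<and> Arg2pi (cnj z) = 0"
          using that Arg2pi_eq_0_pi[of z] Arg2pi_eq_pi[of z] by (auto simp: Arg2pi_cnj field_split_simps)
        then show ?thesis
          using f(2) by (auto simp: F_def diff_divide_distrib)
      qed
      ultimately have c2: "continuous_on (sphere 0 1 \<inter> {z. Im z \<le> 0}) F"
        by (elim continuous_on_eq) auto
      have "continuous_on ((sphere 0 1 \<inter> {z. 0 \<le> Im z}) \<union> (sphere 0 1 \<inter> {z. Im z \<le> 0})) F"
        by (intro continuous_on_closed_Un c1 c2 closed_Int closed_sphere closed_halfspace_Im_ge closed_halfspace_Im_le)
      moreover have "(sphere 0 1 \<inter> {z. 0 \<le> Im z}) \<union> (sphere 0 1 \<inter> {z. Im z \<le> 0}) = sphere (0::complex) 1"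
        by auto
      ultimately show ?thesis by auto
    qed
    then show ?thesis
      by (metis continuous_on_cong)
  qed
  have mono2: "complex_of_real (Re (cis t)) = cis t / 2 + cis (- t) / 2"
    "complex_of_real (Im (cis t)) = cis t / (2 * \<i>) + - cis (- t) / (2 * \<i>)" for t
    by (auto simp: complex_eq_iff Re_divide Im_divide power2_eq_square)
  have PRe: "P Re"
    unfolding P_def mono2
    using trig_poly.add[OF trig_poly.monomial[of "1/2" 1] trig_poly.monomial[of "1/2" "-1"]]
    by (auto intro!: continuous_intros)
  have PIm: "P Im"
    unfolding P_def mono2
    using trig_poly.add[OF trig_poly.monomial[of "1/(2*\<i>)" 1] trig_poly.monomial[of "- (1/(2*\<i>))" "-1"]]
    by (auto intro!: continuous_intros)
  have "\<exists>h. P h \<and> (\<forall>x\<in>sphere 0 1. \<bar>F x - h x\<bar> < e)"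
  proof (rule Stone_Weierstrass_HOL[OF compact_sphere _ _ _ _ _ cont e])
    show "P (\<lambda>x. c)" for c
      by (auto simp: P_def trig_poly_const)
    show "P f \<Longrightarrow> continuous_on (sphere 0 1) f" for f
      by (auto simp: P_def)
    show "P f \<and> P g \<Longrightarrow> P (\<lambda>x. f x + g x)" for f g
      by (auto simp: P_def intro: continuous_intros trig_poly.add)
    show "P f \<and> P g \<Longrightarrow> P (\<lambda>x. f x * g x)" for f g
      by (auto simp: P_def intro: continuous_intros trig_poly_mult)
    show "x \<in> sphere 0 1 \<and> y \<in> sphere 0 1 \<and> x \<noteq> y \<Longrightarrow> \<exists>f. P f \<and> f x \<noteq> f y" for x y
      using PRe PIm by (metis complex_eqI)
  qed
  then obtain h where h: "P h" "\<And>z. cmod z = 1 \<Longrightarrow> \<bar>F z - h z\<bar> < e"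
    by auto
  have "F (cis (2 * pi * x)) = f x" if "x \<in> {0..1}" for x
  proof (cases "x = 1")
    case True
    then show ?thesis
      using f(2) by (simp add: F_def Arg2pi_of_real[of 1, simplified])
  next
    case False
    then have "Arg2pi (cis (2 * pi * x)) = 2 * pi * x"
      using that by (intro Arg2pi_unique[of 1]) (auto simp: cis_conv_exp)
    then show ?thesis
      by (simp add: F_def)
  qed
  then have "cmod (of_real (f x) - of_real (h (cis (2 * pi * x)))) < e" if "x \<in> {0..1}" for x
    using h(2)[of "cis (2 * pi * x)"] that by (simp flip: of_real_diff)
  then show ?thesis
    using h(1) by (intro exI[of _ "\<lambda>x. complex_of_real (h (cis (2 * pi * x)))"]) (auto simp: P_def)
qed

lemma trig_poly_approx_periodic:
  fixes f :: "real \<Rightarrow> complex"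
  assumes f: "continuous_on {0..1} f" "f 0 = f 1" and e: "e > 0"
  shows "\<exists>p. trig_poly p \<and> (\<forall>x\<in>{0..1}. cmod (f x - p x) < e)"
proof -
  obtain p where p: "trig_poly p" "\<forall>x\<in>{0..1}. cmod (of_real (Re (f x)) - p x) < e / 2"
    using trig_poly_approx_periodic_real[of "\<lambda>x. Re (f x)" "e / 2"] f e continuous_on_Re[OF f(1)] by auto
  obtain q where q: "trig_poly q" "\<forall>x\<in>{0..1}. cmod (of_real (Im (f x)) - q x) < e / 2"
    using trig_poly_approx_periodic_real[of "\<lambda>x. Im (f x)" "e / 2"] f e continuous_on_Im[OF f(1)] by auto
  have "cmod (f x - (p x + \<i> * q x)) < e" if x: "x \<in> {0..1}" for x
  proof -
    have "f x - (p x + \<i> * q x) = (of_real (Re (f x)) - p x) + \<i> * (of_real (Im (f x)) - q x)"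
      by (subst (1) complex_eq[of "f x"]) (simp add: algebra_simps)
    then have "cmod (f x - (p x + \<i> * q x)) \<le> cmod (of_real (Re (f x)) - p x) + cmod (of_real (Im (f x)) - q x)"
      by (metis norm_triangle_ineq norm_mult norm_ii mult_1)
    then show ?thesis
      using p(2)[rule_format, OF x] q(2)[rule_format, OF x] by linarith
  qed
  then show ?thesis
    using trig_poly.add[OF p(1) trig_poly_mult[OF trig_poly_const[of \<i>] q(1)]] by blast
qed

text \<open>A measurable function is almost everywhere a limit of continuous functions; truncating these
  and multiplying by a cutoff vanishing at both ends of the interval makes them bounded and
  periodic, hence uniform limits of trigonometric polynomials. Bounded convergence then transfers
  integral identities and inequalities from trigonometric polynomials to bounded measurable functions.\<close>

lemma bounded_measurable_limit_of_trig_polys: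
  fixes h :: "real \<Rightarrow> complex"
  assumes h: "h \<in> borel_measurable unit_interval" and bound: "\<And>x. cmod (h x) \<le> C"
  obtains p where "\<And>n. trig_poly (p n)" "\<And>n x. x \<in> {0<..1} \<Longrightarrow> cmod (p n x) \<le> C + 2"
    "AE x in unit_interval. (\<lambda>n. p n x) \<longlonglongrightarrow> h x"
proof -
  have C: "0 \<le> C"
    using bound norm_ge_zero order_trans by blast
  define h' where "h' x = indicator {0<..1} x *\<^sub>R h x" for x
  have "h' \<in> borel_measurable borel"
    using h unfolding h'_def by (subst (asm) borel_measurable_restrict_space_iff) auto
  then have "h' \<in> borel_measurable lebesgue"
    by (simp add: borel_measurable_if_I measurable_completion)
  then have "h' measurable_on UNIV"
    by (simp add: measurable_on_iff_borel_measurable)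
  then obtain N g where N: "negligible N" and g: "\<And>n. continuous_on UNIV (g n)"
    and lim: "\<And>x. x \<notin> N \<Longrightarrow> (\<lambda>n. g n x) \<longlonglongrightarrow> h' x"
    unfolding measurable_on_def by auto
  \<comment> \<open>The cutoff vanishes at both end points, so \<open>k n\<close> is periodic; the second factor keeps \<open>k n\<close>
    within \<open>C + 1\<close> but equals \<open>1\<close> as soon as \<open>g n x\<close> is close to \<open>h x\<close>.\<close>
  define cut :: "nat \<Rightarrow> real \<Rightarrow> real" where "cut n x = min 1 (real n * max 0 (min x (1 - x)))" for n x
  define k where "k n x = of_real (cut n x * ((C + 1) / max (C + 1) (cmod (g n x)))) * g n x" for n x
  have cut01: "0 \<le> cut n x" "cut n x \<le> 1" for n x
    by (auto simp: cut_def)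
  have kbound: "cmod (k n x) \<le> C + 1" for n x
  proof -
    have "cmod (k n x) = cut n x * ((C + 1) * cmod (g n x) / max (C + 1) (cmod (g n x)))"
      using C cut01 by (simp add: k_def norm_mult norm_divide abs_mult del: of_real_add)
    also have "\<dots> \<le> 1 * ((C + 1) * 1)"
      using C cut01 by (intro mult_mono) (auto simp: divide_simps max_def intro!: mult_left_mono)
    finally show ?thesis by simp
  qed
  have "\<exists>p. trig_poly p \<and> (\<forall>x\<in>{0..1}. cmod (k n x - p x) < 1 / Suc n)" for n
  proof (rule trig_poly_approx_periodic)
    have "max (C + 1) (cmod (g n x)) \<noteq> 0" for x
      using C by (auto simp: max_def)
    then show "continuous_on {0..1} (k n)"
      unfolding k_def cut_def
      by (intro continuous_intros continuous_on_subset[OF g]) auto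
    show "k n 0 = k n 1"
      by (simp add: k_def cut_def)
  qed simp
  then obtain p0 where p0: "\<And>n. trig_poly (p0 n)"
    "\<And>n x. x \<in> {0..1} \<Longrightarrow> cmod (k n x - p0 n x) < 1 / Suc n"
    by metis
  show thesis
  proof (rule that)
    show "trig_poly (p0 n)" for n by (rule p0)
    show "cmod (p0 n x) \<le> C + 2" if "x \<in> {0<..1}" for n x
    proof -
      have "cmod (p0 n x) \<le> cmod (k n x) + cmod (k n x - p0 n x)"
        using norm_triangle_ineq4[of "k n x" "k n x - p0 n x"] by simp
      also have "cmod (k n x - p0 n x) \<le> 1"
        using that by (intro order_trans[OF less_imp_le[OF p0(2)[of x n]]]) auto
      finally show ?thesis using kbound[of n x] by simp
    qed
    have lim_p0: "(\<lambda>n. p0 n x) \<longlonglongrightarrow> h x" if x: "0 < x" "x < 1" "x \<notin> N" for x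
    proof -
      have g_lim: "(\<lambda>n. g n x) \<longlonglongrightarrow> h x"
        using lim[OF x(3)] x by (simp add: h'_def)
      have "\<forall>\<^sub>F n in sequentially. cmod (g n x) < C + 1"
        using order_tendstoD(2)[OF tendsto_norm[OF g_lim], of "C + 1"] bound[of x] by simp
      moreover have "\<forall>\<^sub>F n in sequentially. 1 \<le> real n * min x (1 - x)"
        using filterlim_tendsto_pos_mult_at_top[OF tendsto_const[of "min x (1 - x)"] _ filterlim_real_sequentially] x
        unfolding filterlim_at_top by (auto simp: mult.commute)
      ultimately have "\<forall>\<^sub>F n in sequentially. g n x = k n x"
      proof eventually_elim
        case (elim n)
        then show ?case
          using C x by (simp add: k_def cut_def max_def min_def)
      qed
      then have "(\<lambda>n. k n x) \<longlonglongrightarrow> h x"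
        by (rule Lim_transform_eventually[OF g_lim])
      moreover have "(\<lambda>n. k n x - p0 n x) \<longlonglongrightarrow> 0"
      proof (rule Lim_null_comparison)
        show "\<forall>\<^sub>F n in sequentially. norm (k n x - p0 n x) \<le> 1 / Suc n"
          using p0(2)[of x] x by (simp add: less_imp_le)
        show "(\<lambda>n. 1 / real (Suc n)) \<longlonglongrightarrow> 0"
          by (rule LIMSEQ_Suc[OF lim_1_over_n])
      qed
      ultimately have "(\<lambda>n. k n x - (k n x - p0 n x)) \<longlonglongrightarrow> h x - 0"
        by (rule tendsto_diff)
      then show ?thesis by simp
    qed
    have "AE x in lborel. x \<notin> N"
    proof -
      have "N \<in> null_sets lebesgue"
        using N by (simp add: negligible_iff_null_sets)
      then have "AE x in lebesgue. x \<notin> N"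
        by (rule AE_not_in)
      then show ?thesis
        by (simp add: AE_completion_iff)
    qed
    moreover have "AE x in lborel. x \<noteq> (1::real)"
      by (rule AE_lborel_singleton)
    ultimately have "AE x in lborel. x \<in> {0<..1} \<longrightarrow> (\<lambda>n. p0 n x) \<longlonglongrightarrow> h x"
      by eventually_elim (auto intro!: lim_p0)
    then show "AE x in unit_interval. (\<lambda>n. p0 n x) \<longlonglongrightarrow> h x"
      by (simp add: AE_restrict_space_iff)
  qed
qed

section \<open>Parseval's identity\<close>

lemma finite_sum_le_nn_integral_count_space:
  fixes f :: "'a \<Rightarrow> ennreal"
  assumes "finite K"
  shows "sum f K \<le> (\<integral>\<^sup>+i. f i \<partial>count_space UNIV)"
proof -
  have "sum f K = (\<integral>\<^sup>+i. f i \<partial>count_space K)"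
    using assms by (simp add: nn_integral_count_space_finite)
  also have "\<dots> = (\<integral>\<^sup>+i. f i * indicator K i \<partial>count_space UNIV)"
    by (rule nn_integral_count_space_indicator) simp
  also have "\<dots> \<le> (\<integral>\<^sup>+i. f i \<partial>count_space UNIV)"
    by (intro nn_integral_mono) (auto simp: indicator_def)
  finally show ?thesis .
qed

lemma nn_integral_count_space_eq_SUP:
  fixes f :: "'a::countable \<Rightarrow> ennreal"
  shows "(\<integral>\<^sup>+i. f i \<partial>count_space UNIV) = (SUP K\<in>{K. finite K}. sum f K)"
proof (rule antisym)
  define K where "K n = {i :: 'a. to_nat i < n}" for n
  have finK: "finite (K n)" for n
    unfolding K_def using finite_vimageI[of "{..<n}" "to_nat :: 'a \<Rightarrow> nat"] by (simp add: vimage_def)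
  have "(SUP n. f i * indicator (K n) i) = f i" for i
  proof (rule antisym)
    show "(SUP n. f i * indicator (K n) i) \<le> f i"
      by (auto intro!: SUP_least simp: indicator_def)
    show "f i \<le> (SUP n. f i * indicator (K n) i)"
      by (rule SUP_upper2[of "Suc (to_nat i)"]) (auto simp: K_def)
  qed
  then have "(\<integral>\<^sup>+i. f i \<partial>count_space UNIV) = (\<integral>\<^sup>+i. (SUP n. f i * indicator (K n) i) \<partial>count_space UNIV)"
    by simp
  also have "\<dots> = (SUP n. \<integral>\<^sup>+i. f i * indicator (K n) i \<partial>count_space UNIV)"
    by (rule nn_integral_monotone_convergence_SUP)
      (auto simp: incseq_def le_fun_def K_def indicator_def)
  also have "\<dots> = (SUP n. sum f (K n))"
    by (simp add: nn_integral_count_space_indicator[symmetric] nn_integral_count_space_finite finK)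
  also have "\<dots> \<le> (SUP K\<in>{K. finite K}. sum f K)"
    by (intro SUP_least SUP_upper) (simp add: finK)
  finally show "(\<integral>\<^sup>+i. f i \<partial>count_space UNIV) \<le> (SUP K\<in>{K. finite K}. sum f K)" .
  show "(SUP K\<in>{K. finite K}. sum f K) \<le> (\<integral>\<^sup>+i. f i \<partial>count_space UNIV)"
    by (intro SUP_least finite_sum_le_nn_integral_count_space) simp
qed

lemma infsum_eq_nn_integral_count_space:
  fixes f :: "'a::countable \<Rightarrow> ennreal"
  shows "infsum f UNIV = (\<integral>\<^sup>+i. f i \<partial>count_space UNIV)"
  unfolding nn_integral_count_space_eq_SUP by (subst nonneg_infsum_complete) auto

lemma nn_integral_count_space_le:
  fixes f :: "'a::countable \<Rightarrow> ennreal"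
  assumes "\<And>K. finite K \<Longrightarrow> sum f K \<le> c"
  shows "(\<integral>\<^sup>+i. f i \<partial>count_space UNIV) \<le> c"
  unfolding nn_integral_count_space_eq_SUP using assms by (intro SUP_least) auto

lemma integral_cis_unit_interval:
  "(\<integral>x. cis (2 * pi * of_int m * x) \<partial>unit_interval) = (if m = 0 then 1 else 0)"
proof (cases "m = 0")
  case True
  then show ?thesis
    using emeasure_unit_interval by (simp add: measure_def)
next
  case False
  define F where "F x = exp (2 * pi * \<i> * of_int m * complex_of_real x) / (2 * pi * \<i> * of_int m)" for x
  have "(F has_vector_derivative exp (2 * pi * \<i> * of_int m * complex_of_real x)) (at x within {0..1})" for x
    unfolding F_def
    by (rule has_vector_derivative_real_field) (use False in \<open>auto intro!: derivative_eq_intros\<close>)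
  then have "(\<integral>x. indicator {0..1} x *\<^sub>R exp (2 * pi * \<i> * of_int m * complex_of_real x) \<partial>lborel) = F 1 - F 0"
    by (intro integral_FTC_Icc) (auto intro!: continuous_intros)
  also have "F 1 - F 0 = 0"
  proof -
    have "exp (2 * pi * \<i> * of_int m) = 1"
      by (subst exp_eq_1) (auto intro!: exI[of _ m])
    then show ?thesis by (simp add: F_def)
  qed
  finally have "(\<integral>x. indicator {0..1} x *\<^sub>R cis (2 * pi * of_int m * x) \<partial>lborel) = 0"
    by (simp add: cis_conv_exp mult.assoc mult.left_commute[of \<i>])
  moreover have "(\<integral>x. indicator {0<..1} x *\<^sub>R cis (2 * pi * of_int m * x) \<partial>lborel)
      = (\<integral>x. indicator {0..1} x *\<^sub>R cis (2 * pi * of_int m * x) \<partial>lborel)"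
    by (rule integral_cong_AE; measurable?) (use AE_lborel_singleton[of 0] in \<open>auto simp: indicator_def\<close>)
  ultimately show ?thesis
    using False by (subst integral_restrict_space) auto
qed

lemma cis_L2_unit_interval: "(\<lambda>x. cis (2 * pi * of_int m * x)) \<in> L2 unit_interval"
  using finite_measure.integrable_const[OF finite_measure_unit_interval, of "1::real"]
  by (simp add: L2_def borel_measurable_unit_interval)

lemma l2_inner_cis:
  "l2_inner unit_interval (\<lambda>x. cis (2 * pi * of_int m * x)) (\<lambda>x. cis (2 * pi * of_int n * x)) = (if m = n then 1 else 0)"
proof -
  have "cis (2 * pi * of_int m * x) * cnj (cis (2 * pi * of_int n * x)) = cis (2 * pi * of_int (m - n) * x)" for x
    by (simp add: cis_cnj cis_mult algebra_simps)
  then show ?thesis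
    unfolding l2_inner_def using integral_cis_unit_interval[of "m - n"] by simp
qed

lemma l2_norm_trig_sum:
  assumes "finite K"
  shows "(l2_norm unit_interval (\<lambda>x. \<Sum>m\<in>K. c m * cis (2 * pi * of_int m * x)))\<^sup>2 = (\<Sum>m\<in>K. (cmod (c m))\<^sup>2)"
proof -
  have "complex_of_real ((l2_norm unit_interval (\<lambda>x. \<Sum>m\<in>K. c m * cis (2 * pi * of_int m * x)))\<^sup>2)
      = (\<Sum>m\<in>K. c m * (\<Sum>n\<in>K. cnj (c n) * (if m = n then 1 else 0)))"
    unfolding l2_inner_self[symmetric]
    by (subst l2_inner_sum_left; (intro L2_sum L2_cmult cis_L2_unit_interval)?)
      (simp add: l2_inner_sum_right cis_L2_unit_interval l2_inner_cis)
  also have "\<dots> = (\<Sum>m\<in>K. c m * cnj (c m))"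
    using assms by (intro sum.cong) (simp_all add: if_distrib[of "(*) _"] cong: if_cong)
  also have "\<dots> = complex_of_real (\<Sum>m\<in>K. (cmod (c m))\<^sup>2)"
    by (simp add: complex_norm_square del: of_real_power)
  finally show ?thesis
    by (simp only: of_real_eq_iff)
qed

definition fourier_coeff :: "(real \<Rightarrow> complex) \<Rightarrow> int \<Rightarrow> complex" where
  "fourier_coeff P m = (\<integral>x. P x * cis (- (2 * pi * of_int m * x)) \<partial>unit_interval)"

lemma integrable_mult_bounded:
  fixes P :: "'a \<Rightarrow> complex"
  assumes "integrable M P" "h \<in> borel_measurable M" "\<And>x. x \<in> space M \<Longrightarrow> cmod (h x) \<le> C"
  shows "integrable M (\<lambda>x. P x * h x)"
proof (rule Bochner_Integration.integrable_bound)
  show "integrable M (\<lambda>x. C * norm (P x))"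
    using assms(1) by simp
  show "(\<lambda>x. P x * h x) \<in> borel_measurable M"
    using assms(1,2) by measurable
  have "norm (P x * h x) \<le> norm (C * norm (P x))" if "x \<in> space M" for x
  proof -
    have "norm (P x * h x) \<le> norm (P x) * C"
      unfolding norm_mult by (intro mult_left_mono assms(3) that) simp
    also have "\<dots> \<le> norm (C * norm (P x))"
      by (simp add: mult.commute)
    finally show ?thesis .
  qed
  then show "AE x in M. norm (P x * h x) \<le> norm (C * norm (P x))"
    by simp
qed

lemma integral_times_cnj_trig_sum:
  assumes P: "integrable unit_interval P"
  shows "(\<integral>x. P x * cnj (\<Sum>m\<in>K. c m * cis (2 * pi * of_int m * x)) \<partial>unit_interval)
    = (\<Sum>m\<in>K. cnj (c m) * fourier_coeff P m)"
proof -
  have int: "integrable unit_interval (\<lambda>x. P x * cis (- (2 * pi * of_int m * x)))" for m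
    by (rule integrable_mult_bounded[OF P, of _ 1]) (auto intro!: borel_measurable_unit_interval)
  have "(\<integral>x. P x * cnj (\<Sum>m\<in>K. c m * cis (2 * pi * of_int m * x)) \<partial>unit_interval)
      = (\<integral>x. (\<Sum>m\<in>K. cnj (c m) * (P x * cis (- (2 * pi * of_int m * x)))) \<partial>unit_interval)"
    by (simp add: sum_distrib_left cis_cnj mult_ac)
  also have "\<dots> = (\<Sum>m\<in>K. cnj (c m) * fourier_coeff P m)"
    using int by (simp add: fourier_coeff_def)
  finally show ?thesis .
qed

lemma square_le_mult_cancel: "a * a \<le> b * a \<Longrightarrow> 0 \<le> a \<Longrightarrow> 0 \<le> b \<Longrightarrow> a \<le> b" for a b :: real
  by (cases "a = 0") (auto simp: mult_le_cancel_right)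

text \<open>Bessel's inequality is Cauchy--Schwarz for \<open>P\<close> and its Fourier sums if \<open>P\<close> is square integrable, and void otherwise.\<close>

lemma Bessel_unit_interval:
  assumes P: "integrable unit_interval P"
  shows "(\<integral>\<^sup>+m. ennreal ((cmod (fourier_coeff P m))\<^sup>2) \<partial>count_space UNIV)
    \<le> (\<integral>\<^sup>+x. ennreal ((cmod (P x))\<^sup>2) \<partial>unit_interval)"
proof (cases "(\<integral>\<^sup>+x. ennreal ((cmod (P x))\<^sup>2) \<partial>unit_interval) < \<infinity>")
  case True
  then have L2: "P \<in> L2 unit_interval"
    using P by (simp add: L2_iff_nn_integral)
  show ?thesis
  proof (rule nn_integral_count_space_le)
    fix K :: "int set" assume K: "finite K"
    define p where "p x = (\<Sum>m\<in>K. fourier_coeff P m * cis (2 * pi * of_int m * x))" for x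
    have p: "p \<in> L2 unit_interval"
      unfolding p_def by (intro L2_sum L2_cmult cis_L2_unit_interval)
    have np: "(l2_norm unit_interval p)\<^sup>2 = (\<Sum>m\<in>K. (cmod (fourier_coeff P m))\<^sup>2)"
      unfolding p_def using K by (rule l2_norm_trig_sum)
    have "l2_inner unit_interval P p = (\<Sum>m\<in>K. cnj (fourier_coeff P m) * fourier_coeff P m)"
      unfolding l2_inner_def p_def using P by (rule integral_times_cnj_trig_sum)
    also have "\<dots> = complex_of_real ((l2_norm unit_interval p)\<^sup>2)"
      unfolding np by (simp add: complex_norm_square mult.commute del: of_real_power)
    finally have "(l2_norm unit_interval p)\<^sup>2 \<le> l2_norm unit_interval P * l2_norm unit_interval p"
      using l2_Cauchy_Schwarz[OF L2 p] by (simp del: of_real_power)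
    then have "l2_norm unit_interval p \<le> l2_norm unit_interval P"
      by - (rule square_le_mult_cancel; simp_all add: power2_eq_square)
    then have "(\<Sum>m\<in>K. (cmod (fourier_coeff P m))\<^sup>2) \<le> (l2_norm unit_interval P)\<^sup>2"
      unfolding np[symmetric] by (intro power_mono) auto
    then show "(\<Sum>m\<in>K. ennreal ((cmod (fourier_coeff P m))\<^sup>2)) \<le> (\<integral>\<^sup>+x. ennreal ((cmod (P x))\<^sup>2) \<partial>unit_interval)"
      unfolding nn_integral_square_eq_l2_norm[OF L2] by (simp add: ennreal_leI)
  qed
qed (simp add: not_less top_unique)

lemma integral_times_cnj_trig_poly_le:
  assumes P: "integrable unit_interval P" and p: "trig_poly p"
    and S: "(\<integral>\<^sup>+m. ennreal ((cmod (fourier_coeff P m))\<^sup>2) \<partial>count_space UNIV) = ennreal S" "0 \<le> S"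
  shows "cmod (\<integral>x. P x * cnj (p x) \<partial>unit_interval) \<le> sqrt S * l2_norm unit_interval p"
proof -
  obtain K c where K: "finite K" and peq: "p = (\<lambda>x. \<Sum>m\<in>K. c m * cis (2 * pi * of_int m * x))"
    using p by (rule trig_polyE)
  have "cmod (\<integral>x. P x * cnj (p x) \<partial>unit_interval) \<le> (\<Sum>m\<in>K. cmod (c m) * cmod (fourier_coeff P m))"
    unfolding peq integral_times_cnj_trig_sum[OF P]
    by (rule order_trans[OF norm_sum]) (simp add: norm_mult)
  also have "\<dots> \<le> L2_set (\<lambda>m. cmod (c m)) K * L2_set (\<lambda>m. cmod (fourier_coeff P m)) K"
    using L2_set_mult_ineq[of "\<lambda>m. cmod (c m)" "\<lambda>m. cmod (fourier_coeff P m)" K] by simp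
  also have "L2_set (\<lambda>m. cmod (c m)) K = l2_norm unit_interval p"
    unfolding L2_set_def peq l2_norm_trig_sum[OF K, symmetric] by simp
  also have "L2_set (\<lambda>m. cmod (fourier_coeff P m)) K \<le> sqrt S"
  proof -
    have "ennreal (\<Sum>m\<in>K. (cmod (fourier_coeff P m))\<^sup>2) \<le> ennreal S"
      using finite_sum_le_nn_integral_count_space[OF K, of "\<lambda>m. ennreal ((cmod (fourier_coeff P m))\<^sup>2)"] S(1)
      by simp
    then show ?thesis
      using S(2) by (simp add: L2_set_def)
  qed
  finally show ?thesis
    by (simp add: mult.commute mult_right_mono)
qed

text \<open>If the coefficients are square summable with sum \<open>S\<close>, the functional \<open>p \<mapsto> \<integral> P cnj p\<close> is bounded by
  \<open>\<surd>S\<close> in \<open>L\<^sup>2\<close> norm on trigonometric polynomials. By bounded convergence the estimate extends to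
  bounded measurable functions, and for the truncation of \<open>P\<close> at height \<open>n\<close> it bounds the energy of that
  truncation by \<open>S\<close>. So \<open>P\<close> is square integrable after all.\<close>

lemma Parseval_unit_interval:
  assumes P: "integrable unit_interval P"
  shows "(\<integral>\<^sup>+m. ennreal ((cmod (fourier_coeff P m))\<^sup>2) \<partial>count_space UNIV)
    = (\<integral>\<^sup>+x. ennreal ((cmod (P x))\<^sup>2) \<partial>unit_interval)"
proof (rule antisym[OF Bessel_unit_interval[OF P]])
  let ?I = unit_interval
  interpret finite_measure ?I by (rule finite_measure_unit_interval)
  have [measurable]: "P \<in> borel_measurable ?I"
    using P by simp
  show "(\<integral>\<^sup>+x. ennreal ((cmod (P x))\<^sup>2) \<partial>?I) \<le> (\<integral>\<^sup>+m. ennreal ((cmod (fourier_coeff P m))\<^sup>2) \<partial>count_space UNIV)"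
  proof (cases "(\<integral>\<^sup>+m. ennreal ((cmod (fourier_coeff P m))\<^sup>2) \<partial>count_space UNIV)")
    case (real S)
    define h where "h n x = (if cmod (P x) \<le> real n then P x else 0)" for n :: nat and x
    have h_meas [measurable]: "h n \<in> borel_measurable ?I" for n
      unfolding h_def by measurable
    have h_bound: "cmod (h n x) \<le> real n" for n x
      by (simp add: h_def)
    have L2_bounded: "q \<in> L2 ?I" if [measurable]: "q \<in> borel_measurable ?I" and "\<And>x. x \<in> {0<..1} \<Longrightarrow> cmod (q x) \<le> C" for q C
      unfolding L2_def using that(2)
      by (auto intro!: integrable_const_bound[of _ "C\<^sup>2"] power_mono AE_I2 simp: space_restrict_space)
    have "(l2_norm ?I (h n))\<^sup>2 \<le> S" for n
    proof -
      obtain p where p: "\<And>k. trig_poly (p k)" "\<And>k x. x \<in> {0<..1} \<Longrightarrow> cmod (p k x) \<le> real n + 2"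
        "AE x in ?I. (\<lambda>k. p k x) \<longlonglongrightarrow> h n x"
        using bounded_measurable_limit_of_trig_polys[OF h_meas h_bound] by blast
      have [measurable]: "p k \<in> borel_measurable ?I" for k
        using p(1) by (rule borel_measurable_trig_poly)
      have "(\<lambda>k. \<integral>x. P x * cnj (p k x) \<partial>?I) \<longlonglongrightarrow> (\<integral>x. P x * cnj (h n x) \<partial>?I)"
      proof (rule integral_dominated_convergence)
        show "integrable ?I (\<lambda>x. cmod (P x) * (real n + 2))"
          using P by simp
        show "AE x in ?I. (\<lambda>k. P x * cnj (p k x)) \<longlonglongrightarrow> P x * cnj (h n x)"
          using p(3) by eventually_elim (intro tendsto_intros)
        show "AE x in ?I. norm (P x * cnj (p k x)) \<le> cmod (P x) * (real n + 2)" for k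
          by (rule AE_I2) (auto simp: norm_mult space_restrict_space intro!: mult_left_mono p(2))
      qed measurable
      then have lim1: "(\<lambda>k. cmod (\<integral>x. P x * cnj (p k x) \<partial>?I)) \<longlonglongrightarrow> cmod (\<integral>x. P x * cnj (h n x) \<partial>?I)"
        by (rule tendsto_norm)
      have "(\<lambda>k. \<integral>x. (cmod (p k x))\<^sup>2 \<partial>?I) \<longlonglongrightarrow> (\<integral>x. (cmod (h n x))\<^sup>2 \<partial>?I)"
      proof (rule integral_dominated_convergence)
        show "integrable ?I (\<lambda>x. (real n + 2)\<^sup>2)" by simp
        show "AE x in ?I. (\<lambda>k. (cmod (p k x))\<^sup>2) \<longlonglongrightarrow> (cmod (h n x))\<^sup>2"
          using p(3) by eventually_elim (intro tendsto_intros)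
        show "AE x in ?I. norm ((cmod (p k x))\<^sup>2) \<le> (real n + 2)\<^sup>2" for k
          by (rule AE_I2) (auto simp: space_restrict_space intro!: power_mono p(2))
      qed measurable
      then have lim2: "(\<lambda>k. sqrt S * l2_norm ?I (p k)) \<longlonglongrightarrow> sqrt S * l2_norm ?I (h n)"
        unfolding l2_norm_def by (intro tendsto_intros)
      have "cmod (\<integral>x. P x * cnj (h n x) \<partial>?I) \<le> sqrt S * l2_norm ?I (h n)"
        using integral_times_cnj_trig_poly_le[OF P p(1)] real
        by (intro LIMSEQ_le[OF lim1 lim2]) auto
      also have "(\<integral>x. P x * cnj (h n x) \<partial>?I) = (\<integral>x. h n x * cnj (h n x) \<partial>?I)"
        by (rule Bochner_Integration.integral_cong) (auto simp: h_def)
      also have "\<dots> = complex_of_real ((l2_norm ?I (h n))\<^sup>2)"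
        using l2_inner_self[of ?I "h n"] by (simp add: l2_inner_def)
      finally have "l2_norm ?I (h n) * l2_norm ?I (h n) \<le> sqrt S * l2_norm ?I (h n)"
        by (simp only: norm_of_real power2_eq_square abs_mult_self_eq)
      then have "l2_norm ?I (h n) \<le> sqrt S"
        using real by - (rule square_le_mult_cancel; simp)
      then show ?thesis
        using real power_mono[of "l2_norm ?I (h n)" "sqrt S" 2] by simp
    qed
    then have le: "(\<integral>\<^sup>+x. ennreal ((cmod (h n x))\<^sup>2) \<partial>?I) \<le> ennreal S" for n
      unfolding nn_integral_square_eq_l2_norm[OF L2_bounded[OF h_meas h_bound]] by (rule ennreal_leI)
    have "(SUP n. ennreal ((cmod (h n x))\<^sup>2)) = ennreal ((cmod (P x))\<^sup>2)" for x
    proof (rule antisym)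
      show "(SUP n. ennreal ((cmod (h n x))\<^sup>2)) \<le> ennreal ((cmod (P x))\<^sup>2)"
        by (rule SUP_least) (auto simp: h_def)
      show "ennreal ((cmod (P x))\<^sup>2) \<le> (SUP n. ennreal ((cmod (h n x))\<^sup>2))"
        by (rule SUP_upper2[of "nat \<lceil>cmod (P x)\<rceil>"]) (auto simp: h_def)
    qed
    then have "(\<integral>\<^sup>+x. ennreal ((cmod (P x))\<^sup>2) \<partial>?I) = (\<integral>\<^sup>+x. (SUP n. ennreal ((cmod (h n x))\<^sup>2)) \<partial>?I)"
      by simp
    also have "\<dots> = (SUP n. \<integral>\<^sup>+x. ennreal ((cmod (h n x))\<^sup>2) \<partial>?I)"
      by (rule nn_integral_monotone_convergence_SUP) (auto simp: incseq_def le_fun_def h_def)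
    also have "\<dots> \<le> ennreal S"
      using le by (intro SUP_least)
    finally show ?thesis
      using real by simp
  qed simp
qed

section \<open>Periodisation\<close>

lemma integrable_count_space_iff_summable_on:
  fixes f :: "'a \<Rightarrow> complex"
  shows "integrable (count_space UNIV) f \<longleftrightarrow> f summable_on UNIV"
  by (metis Infinite_Set_Sum.abs_summable_on_def abs_summable_equivalent summable_on_iff_abs_summable_on_complex)

lemma integral_count_space_eq_infsum:
  fixes f :: "'a \<Rightarrow> complex"
  shows "(\<integral>r. f r \<partial>count_space UNIV) = (\<Sum>\<^sub>\<infinity>r. f r)"
proof (cases "f summable_on UNIV")
  case True
  then show ?thesis
    using integrable_count_space_iff_summable_on[of f] infsetsum_infsum[of f UNIV]
    by (simp add: infsetsum_def Infinite_Set_Sum.abs_summable_on_def)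
next
  case False
  then show ?thesis
    using integrable_count_space_iff_summable_on[of f]
    by (simp add: infsum_not_exists not_integrable_integral_eq)
qed

lemma nn_integral_periodisation:
  fixes f :: "real \<Rightarrow> ennreal"
  assumes [measurable]: "f \<in> borel_measurable borel"
  shows "(\<integral>\<^sup>+x. f x \<partial>lborel) = (\<integral>\<^sup>+x. (\<integral>\<^sup>+r. f (x - of_int r) \<partial>count_space UNIV) \<partial>unit_interval)"
proof -
  have one: "(\<integral>\<^sup>+r. indicator {0<..1} (x + of_int r) \<partial>count_space UNIV) = (1::ennreal)" for x :: real
  proof -
    have "x + of_int r \<in> {0<..1} \<longleftrightarrow> r = 1 - \<lceil>x\<rceil>" for r
      by (auto; linarith)
    then have "(\<lambda>r. indicator {0<..1} (x + of_int r) :: ennreal) = indicator {1 - \<lceil>x\<rceil>}"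
      by (auto simp: fun_eq_iff indicator_def simp del: greaterThanAtMost_iff)
    then show ?thesis by simp
  qed
  have shift: "(\<integral>\<^sup>+x. f (x - of_int r) \<partial>unit_interval) = (\<integral>\<^sup>+x. f x * indicator {0<..1} (x + of_int r) \<partial>lborel)"
    for r :: int
  proof -
    have "(\<integral>\<^sup>+x. f (x - of_int r) \<partial>unit_interval) = (\<integral>\<^sup>+x. f (x - of_int r) * indicator {0<..1} x \<partial>lborel)"
      by (simp add: nn_integral_restrict_space)
    also have "\<dots> = (\<integral>\<^sup>+x. f x * indicator {0<..1} (x + of_int r) \<partial>lborel)"
      by (subst nn_integral_real_affine[where c = 1 and t = "of_int r"]) (auto simp: add.commute)
    finally show ?thesis .
  qed
  have "(\<integral>\<^sup>+x. (\<integral>\<^sup>+r. f (x - of_int r) \<partial>count_space UNIV) \<partial>unit_interval)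
      = (\<integral>\<^sup>+r. (\<integral>\<^sup>+x. f (x - of_int r) \<partial>unit_interval) \<partial>count_space UNIV)"
    by (intro nn_integral_count_space_nn_integral borel_measurable_unit_interval) measurable
  also have "\<dots> = (\<integral>\<^sup>+x. (\<integral>\<^sup>+r. f x * indicator {0<..1} (x + of_int r) \<partial>count_space UNIV) \<partial>lborel)"
    unfolding shift by (intro nn_integral_count_space_nn_integral[symmetric]) measurable
  also have "\<dots> = (\<integral>\<^sup>+x. f x \<partial>lborel)"
    by (simp add: nn_integral_cmult one)
  finally show ?thesis ..
qed

lemma borel_measurable_integer_shift:
  "(\<lambda>(x, r). x - real_of_int r) \<in> borel_measurable (unit_interval \<Otimes>\<^sub>M count_space UNIV)"
proof -
  have "(\<lambda>x. x) \<in> borel_measurable unit_interval"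
    by (rule borel_measurable_unit_interval) simp
  then have "(\<lambda>p. fst p) \<in> borel_measurable (unit_interval \<Otimes>\<^sub>M count_space (UNIV :: int set))"
    by (rule measurable_compose[OF measurable_fst])
  moreover have "(\<lambda>p. real_of_int (snd p)) \<in> borel_measurable (unit_interval \<Otimes>\<^sub>M count_space UNIV)"
    by (rule measurable_compose[OF measurable_snd]) simp
  ultimately show ?thesis
    unfolding case_prod_beta' by (rule borel_measurable_diff)
qed

text \<open>Lebesgue measure as the image of a product measure turns statements about periodisations
  of integrable functions into Fubini's theorem.\<close>

lemma lborel_eq_distr_unit_interval:
  "lborel = distr (unit_interval \<Otimes>\<^sub>M count_space (UNIV :: int set)) borel (\<lambda>(x, r). x - of_int r)"
proof (rule measure_eqI)
  interpret C: sigma_finite_measure "count_space (UNIV :: int set)"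
    by (simp add: sigma_finite_measure_count_space_countable)
  note [measurable] = borel_measurable_integer_shift
  show "emeasure lborel X = emeasure (distr (unit_interval \<Otimes>\<^sub>M count_space (UNIV :: int set)) borel (\<lambda>(x, r). x - of_int r)) X"
    if "X \<in> sets lborel" for X
  proof -
    have [measurable]: "X \<in> sets borel" using that by simp
    have "emeasure (distr (unit_interval \<Otimes>\<^sub>M count_space (UNIV :: int set)) borel (\<lambda>(x, r). x - of_int r)) X
        = (\<integral>\<^sup>+p. indicator X (case p of (x, r) \<Rightarrow> x - of_int r) \<partial>(unit_interval \<Otimes>\<^sub>M count_space (UNIV :: int set)))"
      using nn_integral_distr[of "\<lambda>(x, r). x - real_of_int r" "unit_interval \<Otimes>\<^sub>M count_space UNIV" borel "indicator X"]
      by simp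
    also have "\<dots> = (\<integral>\<^sup>+x. (\<integral>\<^sup>+r. indicator X (x - of_int r) \<partial>count_space UNIV) \<partial>unit_interval)"
      by (subst C.nn_integral_fst[symmetric]) (simp_all)
    also have "\<dots> = emeasure lborel X"
      using nn_integral_periodisation[of "indicator X"] by simp
    finally show ?thesis ..
  qed
qed simp

lemma
  fixes f :: "real \<Rightarrow> complex"
  assumes f: "integrable lborel f"
  shows AE_summable_periodisation: "AE x in unit_interval. (\<lambda>r. f (x - of_int r)) summable_on (UNIV :: int set)"
    and integrable_periodisation: "integrable unit_interval (\<lambda>x. \<Sum>\<^sub>\<infinity>r::int. f (x - of_int r))"
    and integral_periodisation: "(\<integral>x. (\<Sum>\<^sub>\<infinity>r::int. f (x - of_int r)) \<partial>unit_interval) = (\<integral>x. f x \<partial>lborel)"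
proof -
  let ?P = "unit_interval \<Otimes>\<^sub>M count_space (UNIV :: int set)"
  interpret C: sigma_finite_measure "count_space (UNIV :: int set)"
    by (simp add: sigma_finite_measure_count_space_countable)
  interpret I: finite_measure unit_interval
    by (rule finite_measure_unit_interval)
  interpret P: pair_sigma_finite unit_interval "count_space (UNIV :: int set)" ..
  note [measurable] = borel_measurable_integer_shift
  have [measurable]: "f \<in> borel_measurable borel"
    using f by simp
  have int: "integrable ?P (\<lambda>(x, r). f (x - of_int r))"
    using f by (subst (asm) lborel_eq_distr_unit_interval, subst (asm) integrable_distr_eq) (auto simp: case_prod_beta')
  show "AE x in unit_interval. (\<lambda>r. f (x - of_int r)) summable_on (UNIV :: int set)"
    using P.AE_integrable_fst[OF int] by (simp add: integrable_count_space_iff_summable_on)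
  show "integrable unit_interval (\<lambda>x. \<Sum>\<^sub>\<infinity>r::int. f (x - of_int r))"
    using P.integrable_fst[OF int] by (simp add: integral_count_space_eq_infsum)
  have "(\<integral>x. f x \<partial>lborel) = (\<integral>p. f (case p of (x, r) \<Rightarrow> x - of_int r) \<partial>?P)"
    by (subst lborel_eq_distr_unit_interval, subst integral_distr) auto
  also have "\<dots> = (\<integral>x. (\<Sum>\<^sub>\<infinity>r::int. f (x - of_int r)) \<partial>unit_interval)"
    using P.integral_fst[OF int] by (simp add: integral_count_space_eq_infsum case_prod_beta')
  finally show "(\<integral>x. (\<Sum>\<^sub>\<infinity>r::int. f (x - of_int r)) \<partial>unit_interval) = (\<integral>x. f x \<partial>lborel)" ..
qed

section \<open>Plancherel's theorem\<close>

definition inv_fourier :: "(real \<Rightarrow> complex) \<Rightarrow> real \<Rightarrow> complex" where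
  "inv_fourier a w = (\<integral>t. a t * cis (2 * pi * w * t) \<partial>lborel)"

lemma borel_measurable_inv_fourier [measurable]:
  assumes [measurable]: "a \<in> borel_measurable borel"
  shows "inv_fourier a \<in> borel_measurable borel"
  unfolding inv_fourier_def[abs_def] by measurable

text \<open>For \<open>a\<close> supported in a unit interval the values of the transform at \<open>w - r\<close> are the
  Fourier coefficients of \<open>a\<close> multiplied by a unimodular function, so their squares add up to
  the energy of \<open>a\<close>, whatever \<open>w\<close> is.\<close>

lemma Plancherel_unit_support:
  assumes [measurable]: "a \<in> borel_measurable borel" and supp: "\<And>t. t \<notin> {0<..1} \<Longrightarrow> a t = 0"
    and fin: "(\<integral>\<^sup>+t. ennreal ((cmod (a t))\<^sup>2) \<partial>lborel) < \<infinity>"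
  shows "(\<integral>\<^sup>+w. ennreal ((cmod (inv_fourier a w))\<^sup>2) \<partial>lborel) = (\<integral>\<^sup>+t. ennreal ((cmod (a t))\<^sup>2) \<partial>lborel)"
proof -
  let ?I = unit_interval
  interpret finite_measure ?I by (rule finite_measure_unit_interval)
  have energy: "(\<integral>\<^sup>+t. ennreal ((cmod (a t))\<^sup>2) \<partial>?I) = (\<integral>\<^sup>+t. ennreal ((cmod (a t))\<^sup>2) \<partial>lborel)"
    using supp by (subst nn_integral_restrict_space) (auto intro!: nn_integral_cong simp: indicator_def)
  have am [measurable]: "a \<in> borel_measurable ?I"
    by (rule borel_measurable_unit_interval) simp
  have "a \<in> L2 ?I"
    using fin by (simp add: L2_iff_nn_integral energy)
  then have int: "integrable ?I a"
    using integrable_mult_cnj[of a ?I "\<lambda>_. 1"] by (simp add: L2_def)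
  have "(\<integral>\<^sup>+r. ennreal ((cmod (inv_fourier a (w - of_int r)))\<^sup>2) \<partial>count_space UNIV)
      = (\<integral>\<^sup>+t. ennreal ((cmod (a t))\<^sup>2) \<partial>lborel)" for w
  proof -
    let ?P = "\<lambda>x. a x * cis (2 * pi * w * x)"
    have "inv_fourier a (w - of_int r) = fourier_coeff ?P r" for r
    proof -
      have "inv_fourier a (w - of_int r)
          = (\<integral>x. indicator {0<..1} x *\<^sub>R (?P x * cis (- (2 * pi * of_int r * x))) \<partial>lborel)"
        unfolding inv_fourier_def using supp
        by (intro Bochner_Integration.integral_cong) (auto simp: indicator_def mult.assoc cis_mult algebra_simps)
      then show ?thesis
        unfolding fourier_coeff_def by (simp add: integral_restrict_space)
    qed
    moreover have "integrable ?I ?P"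
      by (rule integrable_mult_bounded[OF int, of _ 1]) (auto intro!: borel_measurable_unit_interval)
    ultimately show ?thesis
      using Parseval_unit_interval[of ?P] by (simp add: norm_mult energy)
  qed
  then show ?thesis
    using emeasure_unit_interval by (subst nn_integral_periodisation) simp_all
qed

text \<open>The affine map taking \<open>(0, 1]\<close> to \<open>(-2c, 2c]\<close> reduces to the unit interval; the latter interval is
  half open and contains the closed interval \<open>[-c, c]\<close> where \<open>a\<close> lives.\<close>

lemma Plancherel_bounded_support:
  assumes [measurable]: "a \<in> borel_measurable borel" and c: "0 < c" and supp: "\<And>t. c < \<bar>t\<bar> \<Longrightarrow> a t = 0"
    and fin: "(\<integral>\<^sup>+t. ennreal ((cmod (a t))\<^sup>2) \<partial>lborel) < \<infinity>"
  shows "(\<integral>\<^sup>+w. ennreal ((cmod (inv_fourier a w))\<^sup>2) \<partial>lborel) = (\<integral>\<^sup>+t. ennreal ((cmod (a t))\<^sup>2) \<partial>lborel)"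
proof -
  define b where "b x = a (- (2 * c) + 4 * c * x)" for x
  have [measurable]: "b \<in> borel_measurable borel"
    unfolding b_def by measurable
  have scale: "(\<integral>\<^sup>+t. ennreal ((cmod (a t))\<^sup>2) \<partial>lborel) = ennreal (4 * c) * (\<integral>\<^sup>+t. ennreal ((cmod (b t))\<^sup>2) \<partial>lborel)"
    using c by (subst nn_integral_real_affine[of _ "4 * c" "- (2 * c)"]) (auto simp: b_def)
  have bfin: "(\<integral>\<^sup>+t. ennreal ((cmod (b t))\<^sup>2) \<partial>lborel) < \<infinity>"
    using fin c unfolding scale by (auto simp: ennreal_mult_less_top)
  have bsupp: "b x = 0" if "x \<notin> {0<..1}" for x
  proof -
    have "x \<le> 0 \<or> 1 < x" using that by auto
    then have "c < \<bar>- (2 * c) + 4 * c * x\<bar>"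
    proof
      assume "x \<le> 0"
      then have "4 * c * x \<le> 0" using c by (simp add: mult_nonneg_nonpos)
      then show ?thesis using c by linarith
    next
      assume "1 < x"
      then have "4 * c * 1 < 4 * c * x" using c by (intro mult_strict_left_mono) auto
      then show ?thesis using c by linarith
    qed
    then show ?thesis by (simp add: b_def supp)
  qed
  have ft: "cmod (inv_fourier a (w / (4 * c))) = 4 * c * cmod (inv_fourier b w)" for w
  proof -
    have "inv_fourier a (w / (4 * c)) = (4 * c) *\<^sub>R (\<integral>x. b x * cis (2 * pi * (w / (4 * c)) * (- (2 * c) + 4 * c * x)) \<partial>lborel)"
      unfolding inv_fourier_def b_def
      using c by (subst lborel_integral_real_affine[of "4 * c" _ "- (2 * c)"]) auto
    also have "(\<lambda>x. b x * cis (2 * pi * (w / (4 * c)) * (- (2 * c) + 4 * c * x)))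
        = (\<lambda>x. cis (- (pi * w)) * (b x * cis (2 * pi * w * x)))"
    proof
      fix x
      have "2 * pi * (w / (4 * c)) * (- (2 * c) + 4 * c * x) = - (pi * w) + 2 * pi * w * x"
        using c by (simp add: field_simps)
      then show "b x * cis (2 * pi * (w / (4 * c)) * (- (2 * c) + 4 * c * x)) = cis (- (pi * w)) * (b x * cis (2 * pi * w * x))"
        by (simp only: cis_mult[symmetric] mult_ac)
    qed
    finally show ?thesis
      using c by (simp add: inv_fourier_def norm_mult)
  qed
  have "(\<integral>\<^sup>+w. ennreal ((cmod (inv_fourier a w))\<^sup>2) \<partial>lborel)
      = ennreal (1 / (4 * c)) * (\<integral>\<^sup>+w. ennreal ((cmod (inv_fourier a (w / (4 * c))))\<^sup>2) \<partial>lborel)"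
    using c by (subst nn_integral_real_affine[of _ "1 / (4 * c)" 0]) auto
  also have "\<dots> = ennreal (1 / (4 * c)) * (\<integral>\<^sup>+w. ennreal ((4 * c)\<^sup>2) * ennreal ((cmod (inv_fourier b w))\<^sup>2) \<partial>lborel)"
    unfolding ft using c by (simp add: power_mult_distrib ennreal_mult)
  also have "\<dots> = ennreal (1 / (4 * c)) * (ennreal ((4 * c)\<^sup>2) * (\<integral>\<^sup>+w. ennreal ((cmod (b w))\<^sup>2) \<partial>lborel))"
    using Plancherel_unit_support[OF _ bsupp bfin] by (simp add: nn_integral_cmult)
  also have "\<dots> = ennreal (4 * c) * (\<integral>\<^sup>+w. ennreal ((cmod (b w))\<^sup>2) \<partial>lborel)"
    using c by (simp add: mult.assoc[symmetric] ennreal_mult[symmetric] power2_eq_square)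
  finally show ?thesis
    by (simp add: scale)
qed

section \<open>Completeness\<close>

text \<open>Along a subsequence whose squared distances are at most \<open>4\<^sup>-\<^sup>k\<close>, the sum of the squared increments with
  weights \<open>2\<^sup>k\<close> is integrable. The increments therefore decay geometrically almost everywhere and
  the subsequence converges there; Fatou's lemma estimates the distance to the limit.\<close>

lemma L2_complete:
  fixes F :: "nat \<Rightarrow> 'a \<Rightarrow> complex"
  assumes [measurable]: "\<And>n. F n \<in> borel_measurable M"
    and Cauchy: "\<And>e. 0 < e \<Longrightarrow> \<exists>N. \<forall>n\<ge>N. \<forall>m\<ge>N. (\<integral>\<^sup>+x. ennreal ((cmod (F n x - F m x))\<^sup>2) \<partial>M) \<le> ennreal e"
  obtains G where "G \<in> borel_measurable M" "(\<lambda>n. \<integral>\<^sup>+x. ennreal ((cmod (F n x - G x))\<^sup>2) \<partial>M) \<longlonglongrightarrow> 0"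
proof -
  have "\<exists>r. \<forall>k. (\<forall>n\<ge>r k. \<forall>m\<ge>r k. (\<integral>\<^sup>+x. ennreal ((cmod (F n x - F m x))\<^sup>2) \<partial>M) \<le> ennreal ((1 / 4) ^ k)) \<and> r k < r (Suc k)"
  proof (rule dependent_nat_choice)
    show "\<exists>N. \<forall>n\<ge>N. \<forall>m\<ge>N. (\<integral>\<^sup>+x. ennreal ((cmod (F n x - F m x))\<^sup>2) \<partial>M) \<le> ennreal ((1 / 4) ^ 0)"
      using Cauchy[of 1] by simp
    fix N k
    obtain N' where "\<forall>n\<ge>N'. \<forall>m\<ge>N'. (\<integral>\<^sup>+x. ennreal ((cmod (F n x - F m x))\<^sup>2) \<partial>M) \<le> ennreal ((1 / 4) ^ Suc k)"
      using Cauchy[of "(1 / 4) ^ Suc k"] by auto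
    then show "\<exists>N'. (\<forall>n\<ge>N'. \<forall>m\<ge>N'. (\<integral>\<^sup>+x. ennreal ((cmod (F n x - F m x))\<^sup>2) \<partial>M) \<le> ennreal ((1 / 4) ^ Suc k)) \<and> N < N'"
      by (intro exI[of _ "max N' (Suc N)"]) auto
  qed
  then obtain r where r: "\<And>k n m. r k \<le> n \<Longrightarrow> r k \<le> m \<Longrightarrow>
      (\<integral>\<^sup>+x. ennreal ((cmod (F n x - F m x))\<^sup>2) \<partial>M) \<le> ennreal ((1 / 4) ^ k)"
    and r_mono: "\<And>k. r k < r (Suc k)"
    by metis
  have r_strict: "strict_mono r"
    using r_mono by (simp add: strict_mono_Suc_iff)
  define d where "d k x = F (r (Suc k)) x - F (r k) x" for k x
  have [measurable]: "d k \<in> borel_measurable M" for k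
    unfolding d_def by measurable
  have "(\<integral>\<^sup>+x. (\<Sum>k. ennreal (2 ^ k * (cmod (d k x))\<^sup>2)) \<partial>M) = (\<Sum>k. \<integral>\<^sup>+x. ennreal (2 ^ k * (cmod (d k x))\<^sup>2) \<partial>M)"
    by (rule nn_integral_suminf) measurable
  also have "\<dots> \<le> (\<Sum>k. ennreal ((1 / 2) ^ k))"
  proof (intro suminf_le)
    fix k
    have "(\<integral>\<^sup>+x. ennreal (2 ^ k * (cmod (d k x))\<^sup>2) \<partial>M) = ennreal (2 ^ k) * (\<integral>\<^sup>+x. ennreal ((cmod (d k x))\<^sup>2) \<partial>M)"
      by (simp add: ennreal_mult nn_integral_cmult)
    also have "\<dots> \<le> ennreal (2 ^ k) * ennreal ((1 / 4) ^ k)"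
      unfolding d_def using r_mono[of k] by (intro mult_left_mono r) auto
    also have "\<dots> = ennreal ((1 / 2) ^ k)"
      by (simp add: ennreal_mult[symmetric] power_mult_distrib[symmetric])
    finally show "(\<integral>\<^sup>+x. ennreal (2 ^ k * (cmod (d k x))\<^sup>2) \<partial>M) \<le> ennreal ((1 / 2) ^ k)" .
  qed auto
  also have "\<dots> < \<infinity>"
    by (subst suminf_ennreal2) (auto intro: summable_geometric)
  finally have "AE x in M. (\<Sum>k. ennreal (2 ^ k * (cmod (d k x))\<^sup>2)) \<noteq> \<infinity>"
    by (intro nn_integral_PInf_AE) auto
  then have conv: "AE x in M. convergent (\<lambda>k. F (r k) x)"
  proof eventually_elim
    case (elim x)
    then have "summable (\<lambda>k. 2 ^ k * (cmod (d k x))\<^sup>2)"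
      by (intro summable_suminf_not_top) simp_all
    then have "(\<lambda>k. 2 ^ k * (cmod (d k x))\<^sup>2) \<longlonglongrightarrow> 0"
      by (rule summable_LIMSEQ_zero)
    then have "Bseq (\<lambda>k. 2 ^ k * (cmod (d k x))\<^sup>2)"
      by (intro convergent_imp_Bseq convergentI)
    then obtain C where C: "\<And>k. norm (2 ^ k * (cmod (d k x))\<^sup>2) \<le> C"
      by (auto simp: Bseq_def)
    have "summable (\<lambda>k. sqrt C * sqrt (1 / 2) ^ k)"
      by (intro summable_mult summable_geometric) (simp add: real_sqrt_lt_1_iff)
    moreover have "norm (d k x) \<le> sqrt C * sqrt (1 / 2) ^ k" for k
    proof -
      have "(cmod (d k x))\<^sup>2 \<le> C * (1 / 2) ^ k"
        using C[of k] by (simp add: power_divide field_simps)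
      then show ?thesis
        using real_le_rsqrt[of "cmod (d k x)" "C * (1 / 2) ^ k"] by (simp only: real_sqrt_mult real_sqrt_power)
    qed
    ultimately have "summable (\<lambda>k. d k x)"
      by (rule summable_comparison_test'[where N = 0])
    then have "convergent (\<lambda>n. \<Sum>k<n. d k x)"
      by (simp add: summable_iff_convergent)
    then have "convergent (\<lambda>n. F (r n) x - F (r 0) x)"
      unfolding d_def by (subst (asm) sum_lessThan_telescope)
    then have "convergent (\<lambda>n. (F (r n) x - F (r 0) x) + F (r 0) x)"
      by (intro convergent_add convergent_const)
    then show ?case by simp
  qed
  define G where "G x = lim (\<lambda>k. F (r k) x)" for x
  have G [measurable]: "G \<in> borel_measurable M"
    unfolding G_def by measurable
  have lim: "AE x in M. (\<lambda>k. F (r k) x) \<longlonglongrightarrow> G x"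
    using conv by eventually_elim (simp add: G_def convergent_LIMSEQ_iff)
  have bound: "(\<integral>\<^sup>+x. ennreal ((cmod (F n x - G x))\<^sup>2) \<partial>M) \<le> ennreal ((1 / 4) ^ k)" if n: "r k \<le> n" for n k
  proof -
    have "(\<integral>\<^sup>+x. ennreal ((cmod (F n x - G x))\<^sup>2) \<partial>M)
        = (\<integral>\<^sup>+x. liminf (\<lambda>j. ennreal ((cmod (F n x - F (r j) x))\<^sup>2)) \<partial>M)"
    proof (rule nn_integral_cong_AE)
      show "AE x in M. ennreal ((cmod (F n x - G x))\<^sup>2) = liminf (\<lambda>j. ennreal ((cmod (F n x - F (r j) x))\<^sup>2))"
        using lim
      proof eventually_elim
        case (elim x)
        then have "(\<lambda>j. ennreal ((cmod (F n x - F (r j) x))\<^sup>2)) \<longlonglongrightarrow> ennreal ((cmod (F n x - G x))\<^sup>2)"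
          by (intro tendsto_intros)
        then show ?case
          by (rule lim_imp_Liminf[OF sequentially_bot, symmetric])
      qed
    qed
    also have "\<dots> \<le> liminf (\<lambda>j. \<integral>\<^sup>+x. ennreal ((cmod (F n x - F (r j) x))\<^sup>2) \<partial>M)"
      by (rule nn_integral_liminf) measurable
    also have "\<dots> \<le> liminf (\<lambda>j. ennreal ((1 / 4) ^ k))"
    proof (intro Liminf_mono eventually_sequentiallyI)
      fix j assume "k \<le> j"
      then show "(\<integral>\<^sup>+x. ennreal ((cmod (F n x - F (r j) x))\<^sup>2) \<partial>M) \<le> ennreal ((1 / 4) ^ k)"
        using n strict_mono_less_eq[OF r_strict, of k j] by (intro r) auto
    qed
    finally show ?thesis
      by (simp add: Liminf_const)
  qed
  have "(\<lambda>n. \<integral>\<^sup>+x. ennreal ((cmod (F n x - G x))\<^sup>2) \<partial>M) \<longlonglongrightarrow> 0"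
  proof (rule order_tendstoI)
    fix e :: ennreal assume "0 < e"
    moreover have "(\<lambda>k. ennreal ((1 / 4) ^ k)) \<longlonglongrightarrow> ennreal 0"
      by (intro tendsto_ennrealI LIMSEQ_power_zero) simp
    ultimately obtain k where k: "ennreal ((1 / 4) ^ k) < e"
      by (metis (no_types, lifting) ennreal_0 eventually_sequentially order_refl order_tendstoD(2))
    show "\<forall>\<^sub>F n in sequentially. (\<integral>\<^sup>+x. ennreal ((cmod (F n x - G x))\<^sup>2) \<partial>M) < e"
      using bound k by (intro eventually_sequentiallyI[of "r k"]) (auto intro: le_less_trans)
  qed simp
  with G show thesis
    by (rule that)
qed

section \<open>The partial Fourier transform\<close>

lemma heis_nn_integral:
  fixes f :: "heis \<Rightarrow> ennreal"
  assumes [measurable]: "f \<in> borel_measurable borel"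
  shows "(\<integral>\<^sup>+p. f p \<partial>lborel) = (\<integral>\<^sup>+z. (\<integral>\<^sup>+t. f (fst z, snd z, t) \<partial>lborel) \<partial>lborel)"
proof -
  have [measurable]: "f \<in> borel_measurable (borel \<Otimes>\<^sub>M borel \<Otimes>\<^sub>M borel)"
    by (simp add: borel_prod)
  have [measurable]: "f \<in> borel_measurable (borel \<Otimes>\<^sub>M borel)"
    by (simp add: borel_prod)
  have "(\<integral>\<^sup>+p. f p \<partial>lborel) = (\<integral>\<^sup>+p. f p \<partial>(lborel \<Otimes>\<^sub>M lborel))"
    by (simp add: lborel_prod)
  also have "\<dots> = (\<integral>\<^sup>+x. (\<integral>\<^sup>+q. f (x, q) \<partial>lborel) \<partial>lborel)"
    by (rule lborel.nn_integral_fst[symmetric]) simp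
  also have "\<dots> = (\<integral>\<^sup>+x. (\<integral>\<^sup>+q. f (x, q) \<partial>(lborel \<Otimes>\<^sub>M lborel)) \<partial>lborel)"
    by (simp add: lborel_prod)
  also have "\<dots> = (\<integral>\<^sup>+x. (\<integral>\<^sup>+y. (\<integral>\<^sup>+t. f (x, y, t) \<partial>lborel) \<partial>lborel) \<partial>lborel)"
    by (intro nn_integral_cong lborel.nn_integral_fst[symmetric]) simp
  also have "\<dots> = (\<integral>\<^sup>+z. (\<integral>\<^sup>+t. f (fst z, snd z, t) \<partial>lborel) \<partial>(lborel \<Otimes>\<^sub>M lborel))"
    by (subst lborel.nn_integral_fst[symmetric]) simp_all
  finally show ?thesis
    by (simp add: lborel_prod)
qed

lemma nn_integral_lborel_shift:
  fixes f :: "'a::euclidean_space \<Rightarrow> ennreal"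
  assumes [measurable]: "f \<in> borel_measurable borel"
  shows "(\<integral>\<^sup>+x. f (x - a) \<partial>lborel) = (\<integral>\<^sup>+x. f x \<partial>lborel)"
proof -
  have "(\<integral>\<^sup>+x. f x \<partial>lborel) = (\<integral>\<^sup>+x. f x \<partial>distr lborel borel ((+) (- a)))"
    by (simp add: lborel_distr_plus)
  also have "\<dots> = (\<integral>\<^sup>+x. f (x - a) \<partial>lborel)"
    by (subst nn_integral_distr) (auto simp: add.commute)
  finally show ?thesis ..
qed

lemma integral_lborel_shift:
  fixes f :: "'a::euclidean_space \<Rightarrow> complex"
  assumes [measurable]: "f \<in> borel_measurable borel"
  shows "(\<integral>x. f (x - a) \<partial>lborel) = (\<integral>x. f x \<partial>lborel)"
proof -
  have "(\<integral>x. f x \<partial>lborel) = (\<integral>x. f x \<partial>distr lborel borel ((+) (- a)))"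
    by (simp add: lborel_distr_plus)
  also have "\<dots> = (\<integral>x. f (x - a) \<partial>lborel)"
    by (subst integral_distr) (auto simp: add.commute)
  finally show ?thesis ..
qed

lemma integrable_if_bounded_support:
  fixes a :: "real \<Rightarrow> complex"
  assumes [measurable]: "a \<in> borel_measurable borel" and supp: "\<And>t. c < \<bar>t\<bar> \<Longrightarrow> a t = 0"
    and fin: "(\<integral>\<^sup>+t. ennreal ((cmod (a t))\<^sup>2) \<partial>lborel) < \<infinity>"
  shows "integrable lborel a"
proof -
  have "(\<lambda>t. complex_of_real (indicator {-c..c} t)) \<in> L2 lborel"
  proof -
    have "(\<lambda>t::real. (cmod (complex_of_real (indicator {-c..c} t)))\<^sup>2) = indicator {-c..c}"
      by (auto simp: fun_eq_iff indicator_def)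
    moreover have "integrable lborel (indicator {-c..c} :: real \<Rightarrow> real)"
      by (rule integrable_real_indicator) (auto simp: emeasure_lborel_Icc_eq)
    ultimately show ?thesis
      by (simp add: L2_def)
  qed
  moreover have "a \<in> L2 lborel"
    using fin by (simp add: L2_iff_nn_integral)
  ultimately have "integrable lborel (\<lambda>t. a t * cnj (complex_of_real (indicator {-c..c} t)))"
    by (intro integrable_mult_cnj)
  also have "(\<lambda>t. a t * cnj (complex_of_real (indicator {-c..c} t))) = a"
  proof
    show "a t * cnj (complex_of_real (indicator {-c..c} t)) = a t" for t
      using supp[of t] by (cases "c < \<bar>t\<bar>") (auto simp: indicator_def)
  qed
  finally show ?thesis .
qed

lemma Plancherel_bounded_support_combination:
  assumes [measurable]: "a \<in> borel_measurable borel" "b \<in> borel_measurable borel"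
    and supp: "\<And>t. c < \<bar>t\<bar> \<Longrightarrow> a t = 0" "\<And>t. d < \<bar>t\<bar> \<Longrightarrow> b t = 0"
    and fin: "(\<integral>\<^sup>+t. ennreal ((cmod (a t))\<^sup>2) \<partial>lborel) < \<infinity>" "(\<integral>\<^sup>+t. ennreal ((cmod (b t))\<^sup>2) \<partial>lborel) < \<infinity>"
  shows "(\<integral>\<^sup>+w. ennreal ((cmod (inv_fourier a w + k * inv_fourier b w))\<^sup>2) \<partial>lborel)
    = (\<integral>\<^sup>+t. ennreal ((cmod (a t + k * b t))\<^sup>2) \<partial>lborel)"
proof -
  have int: "integrable lborel (\<lambda>t. h t * cis (2 * pi * w * t))" if "integrable lborel h" for h :: "real \<Rightarrow> complex" and w
    using that by (rule integrable_mult_bounded[of _ _ _ 1]) auto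
  have ia: "integrable lborel a" and ib: "integrable lborel b"
    using integrable_if_bounded_support[OF _ supp(1) fin(1)] integrable_if_bounded_support[OF _ supp(2) fin(2)]
    by simp_all
  have "inv_fourier (\<lambda>t. a t + k * b t) w = inv_fourier a w + k * inv_fourier b w" for w
    unfolding inv_fourier_def using int[OF ia, of w] int[OF ib, of w]
    by (simp add: distrib_right mult.assoc)
  moreover have "(\<lambda>t. a t + k * b t) \<in> L2 lborel"
    using fin by (intro L2_add L2_cmult) (auto simp: L2_iff_nn_integral)
  ultimately show ?thesis
    using supp Plancherel_bounded_support[of "\<lambda>t. a t + k * b t" "max 1 (max c d)"]
    by (simp add: L2_iff_nn_integral)
qed

definition partial_fourier :: "(heis \<Rightarrow> complex) \<Rightarrow> heis \<Rightarrow> complex" where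
  "partial_fourier f p = inv_fourier (\<lambda>t. f (fst p, fst (snd p), t)) (snd (snd p))"

text \<open>The bound on the support may depend on the slice: left translation shifts \<open>t\<close> by an amount that is
  unbounded in \<open>(x, y)\<close>, so translates of a function supported in a slab \<open>\<bar>t\<bar> \<le> n\<close> need not be
  supported in a slab.\<close>

definition slicewise_bounded_support :: "(heis \<Rightarrow> complex) \<Rightarrow> bool" where
  "slicewise_bounded_support f \<longleftrightarrow> (\<forall>x y. \<exists>c. \<forall>t. c < \<bar>t\<bar> \<longrightarrow> f (x, y, t) = 0)"

lemma borel_measurable_partial_fourier [measurable]:
  assumes "f \<in> borel_measurable borel"
  shows "partial_fourier f \<in> borel_measurable borel"
proof -
  have [measurable]: "f \<in> borel_measurable (borel \<Otimes>\<^sub>M borel \<Otimes>\<^sub>M borel)"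
    using assms by (simp add: borel_prod)
  have "partial_fourier f \<in> borel_measurable (borel \<Otimes>\<^sub>M borel \<Otimes>\<^sub>M borel)"
    unfolding partial_fourier_def[abs_def] inv_fourier_def by measurable
  then show ?thesis by (simp add: borel_prod)
qed

lemma AE_slice_finite_energy:
  assumes "f \<in> L2 (lborel :: heis measure)"
  shows "AE z in lborel. (\<integral>\<^sup>+t. ennreal ((cmod (f (fst z, snd z, t)))\<^sup>2) \<partial>lborel) < \<infinity>"
proof -
  have [measurable]: "f \<in> borel_measurable (borel \<Otimes>\<^sub>M borel \<Otimes>\<^sub>M borel)"
    using L2_measurable[OF assms] by (simp add: borel_prod)
  have "(\<lambda>z. \<integral>\<^sup>+t. ennreal ((cmod (f (fst z, snd z, t)))\<^sup>2) \<partial>lborel) \<in> borel_measurable (borel \<Otimes>\<^sub>M borel)"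
    by measurable
  moreover have "(\<integral>\<^sup>+z. (\<integral>\<^sup>+t. ennreal ((cmod (f (fst z, snd z, t)))\<^sup>2) \<partial>lborel) \<partial>lborel) \<noteq> \<infinity>"
    using assms by (subst heis_nn_integral[symmetric]) (auto simp: L2_iff_nn_integral)
  ultimately have "AE z in lborel. (\<integral>\<^sup>+t. ennreal ((cmod (f (fst z, snd z, t)))\<^sup>2) \<partial>lborel) \<noteq> \<infinity>"
    by (intro nn_integral_PInf_AE) (auto simp: borel_prod)
  then show ?thesis
    by (simp add: less_top)
qed

text \<open>Stated for \<open>f + k g\<close>, since the transform is additive only on slices that are integrable,
  which almost all are.\<close>

lemma Plancherel_partial_fourier:
  assumes f: "f \<in> L2 lborel" "slicewise_bounded_support f"
    and g: "g \<in> L2 lborel" "slicewise_bounded_support g"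
  shows "(\<integral>\<^sup>+p. ennreal ((cmod (partial_fourier f p + k * partial_fourier g p))\<^sup>2) \<partial>lborel)
    = (\<integral>\<^sup>+p. ennreal ((cmod (f p + k * g p))\<^sup>2) \<partial>lborel)"
proof -
  have [measurable]: "f \<in> borel_measurable borel" "g \<in> borel_measurable borel"
    using f g by (auto simp: L2_def)
  have m: "(\<lambda>t. h (x, y, t)) \<in> borel_measurable borel" if "h \<in> borel_measurable borel" for h :: "heis \<Rightarrow> complex" and x y
  proof -
    have [measurable]: "h \<in> borel_measurable (borel \<Otimes>\<^sub>M borel \<Otimes>\<^sub>M borel)"
      using that by (simp add: borel_prod)
    show ?thesis by measurable
  qed
  show ?thesis
  proof (subst (1 2) heis_nn_integral; measurable?; rule nn_integral_cong_AE)
    show "AE z in lborel.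
       (\<integral>\<^sup>+t. ennreal ((cmod (partial_fourier f (fst z, snd z, t) + k * partial_fourier g (fst z, snd z, t)))\<^sup>2) \<partial>lborel)
       = (\<integral>\<^sup>+t. ennreal ((cmod (f (fst z, snd z, t) + k * g (fst z, snd z, t)))\<^sup>2) \<partial>lborel)"
      using AE_slice_finite_energy[OF f(1)] AE_slice_finite_energy[OF g(1)]
    proof eventually_elim
      case (elim z)
      obtain c d where "\<forall>t. c < \<bar>t\<bar> \<longrightarrow> f (fst z, snd z, t) = 0" "\<forall>t. d < \<bar>t\<bar> \<longrightarrow> g (fst z, snd z, t) = 0"
        using f(2) g(2) unfolding slicewise_bounded_support_def by meson
      then show ?case
        unfolding partial_fourier_def
        using elim by (simp, intro Plancherel_bounded_support_combination m) auto
    qed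
  qed
qed

definition slab_restrict :: "nat \<Rightarrow> (heis \<Rightarrow> complex) \<Rightarrow> heis \<Rightarrow> complex" where
  "slab_restrict n f p = (if \<bar>snd (snd p)\<bar> \<le> real n then f p else 0)"

lemma slab_restrict_measurable [measurable]:
  assumes "f \<in> borel_measurable borel"
  shows "slab_restrict n f \<in> borel_measurable borel"
proof -
  have [measurable]: "f \<in> borel_measurable (borel \<Otimes>\<^sub>M borel \<Otimes>\<^sub>M borel)"
    using assms by (simp add: borel_prod)
  have "slab_restrict n f \<in> borel_measurable (borel \<Otimes>\<^sub>M borel \<Otimes>\<^sub>M borel)"
    unfolding slab_restrict_def[abs_def] by measurable
  then show ?thesis by (simp add: borel_prod)
qed

lemma slab_restrict_L2:
  assumes "f \<in> L2 lborel"
  shows "slab_restrict n f \<in> L2 lborel"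
proof -
  have [measurable]: "f \<in> borel_measurable borel"
    using assms by (simp add: L2_def)
  have "(\<integral>\<^sup>+p. ennreal ((cmod (slab_restrict n f p))\<^sup>2) \<partial>lborel) \<le> (\<integral>\<^sup>+p. ennreal ((cmod (f p))\<^sup>2) \<partial>lborel)"
    by (intro nn_integral_mono) (auto simp: slab_restrict_def)
  then show ?thesis
    using assms by (simp add: L2_iff_nn_integral le_less_trans)
qed

lemma slab_restrict_bounded_support: "slicewise_bounded_support (slab_restrict n f)"
  by (auto simp: slicewise_bounded_support_def slab_restrict_def intro!: exI[of _ "real n"])

lemma slab_restrict_tendsto:
  assumes "f \<in> L2 lborel"
  shows "(\<lambda>n. \<integral>\<^sup>+p. ennreal ((cmod (slab_restrict n f p - f p))\<^sup>2) \<partial>lborel) \<longlonglongrightarrow> 0"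
proof -
  have [measurable]: "f \<in> borel_measurable borel"
    using assms by (simp add: L2_def)
  have "(\<lambda>n. \<integral>\<^sup>+p. ennreal ((cmod (slab_restrict n f p - f p))\<^sup>2) \<partial>lborel) \<longlonglongrightarrow> (\<integral>\<^sup>+p. 0 \<partial>(lborel :: heis measure))"
  proof (rule nn_integral_dominated_convergence[where w = "\<lambda>p. ennreal ((cmod (f p))\<^sup>2)"])
    show "AE p in lborel. ennreal ((cmod (slab_restrict n f p - f p))\<^sup>2) \<le> ennreal ((cmod (f p))\<^sup>2)" for n
      by (auto simp: slab_restrict_def)
    show "(\<integral>\<^sup>+p. ennreal ((cmod (f p))\<^sup>2) \<partial>lborel) < \<infinity>"
      using assms by (simp add: L2_iff_nn_integral)
    show "AE p in lborel. (\<lambda>n. ennreal ((cmod (slab_restrict n f p - f p))\<^sup>2)) \<longlonglongrightarrow> 0"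
    proof (rule AE_I2)
      fix p :: heis
      have "\<forall>\<^sub>F n in sequentially. ennreal ((cmod (slab_restrict n f p - f p))\<^sup>2) = 0"
        using eventually_ge_at_top[of "nat \<lceil>\<bar>snd (snd p)\<bar>\<rceil>"]
        by eventually_elim (auto simp: slab_restrict_def)
      then show "(\<lambda>n. ennreal ((cmod (slab_restrict n f p - f p))\<^sup>2)) \<longlonglongrightarrow> 0"
        by (rule tendsto_eventually)
    qed
  qed measurable
  then show ?thesis by simp
qed

lemma partial_fourier_slab_restrict:
  "partial_fourier (slab_restrict n f) (x, y, w)
    = (LINT t:{- real n..real n}|lborel. f (x, y, t) * cis (2 * pi * w * t))"
  unfolding partial_fourier_def inv_fourier_def set_lebesgue_integral_def slab_restrict_def
  by (intro Bochner_Integration.integral_cong) (auto simp: indicator_def)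

text \<open>By Plancherel's theorem the truncated transforms form a Cauchy sequence, as the
  truncations of \<open>f\<close> do.\<close>

lemma ex_is_inv_fourier_t:
  assumes f: "f \<in> L2 lborel"
  shows "\<exists>G. is_inv_fourier_t f G"
proof -
  let ?F = "\<lambda>n. partial_fourier (slab_restrict n f)"
  have [measurable]: "f \<in> borel_measurable borel"
    using f by (simp add: L2_def)
  have dist: "(\<integral>\<^sup>+p. ennreal ((cmod (?F n p - ?F m p))\<^sup>2) \<partial>lborel)
      = (\<integral>\<^sup>+p. ennreal ((cmod (slab_restrict n f p - slab_restrict m f p))\<^sup>2) \<partial>lborel)" for n m
    using Plancherel_partial_fourier[OF slab_restrict_L2[OF f] slab_restrict_bounded_support
        slab_restrict_L2[OF f] slab_restrict_bounded_support, of n "-1" m] by simp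
  obtain G where G: "G \<in> borel_measurable lborel"
    and lim: "(\<lambda>n. \<integral>\<^sup>+p. ennreal ((cmod (?F n p - G p))\<^sup>2) \<partial>lborel) \<longlonglongrightarrow> 0"
  proof (rule L2_complete[of ?F lborel])
    fix e :: real assume "0 < e"
    then have "\<forall>\<^sub>F n in sequentially. (\<integral>\<^sup>+p. ennreal ((cmod (slab_restrict n f p - f p))\<^sup>2) \<partial>lborel) < ennreal e"
      by (intro order_tendstoD(2)[OF slab_restrict_tendsto[OF f]]) simp
    then obtain N where N: "(\<integral>\<^sup>+p. ennreal ((cmod (slab_restrict N f p - f p))\<^sup>2) \<partial>lborel) < ennreal e"
      by (auto simp: eventually_sequentially)
    have "(\<integral>\<^sup>+p. ennreal ((cmod (?F n p - ?F m p))\<^sup>2) \<partial>lborel) \<le> ennreal e" if "N \<le> n" "N \<le> m" for n m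
    proof -
      have "(\<integral>\<^sup>+p. ennreal ((cmod (?F n p - ?F m p))\<^sup>2) \<partial>lborel)
          \<le> (\<integral>\<^sup>+p. ennreal ((cmod (slab_restrict N f p - f p))\<^sup>2) \<partial>lborel)"
        unfolding dist using that by (intro nn_integral_mono) (auto simp: slab_restrict_def)
      then show ?thesis
        using N by simp
    qed
    then show "\<exists>N. \<forall>n\<ge>N. \<forall>m\<ge>N. (\<integral>\<^sup>+p. ennreal ((cmod (?F n p - ?F m p))\<^sup>2) \<partial>lborel) \<le> ennreal e"
      by blast
  qed (auto)
  have "\<forall>\<^sub>F n in sequentially. (\<integral>\<^sup>+p. ennreal ((cmod (?F n p - G p))\<^sup>2) \<partial>lborel) < 1"
    by (rule order_tendstoD(2)[OF lim]) simp
  then obtain n where n: "(\<integral>\<^sup>+p. ennreal ((cmod (?F n p - G p))\<^sup>2) \<partial>lborel) < 1"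
    by (auto simp: eventually_sequentially)
  have "?F n \<in> L2 lborel"
    using Plancherel_partial_fourier[OF slab_restrict_L2[OF f] slab_restrict_bounded_support
        slab_restrict_L2[OF f] slab_restrict_bounded_support, of n 0] slab_restrict_L2[OF f, of n]
    by (simp add: L2_iff_nn_integral)
  moreover have "(\<lambda>p. ?F n p - G p) \<in> L2 lborel"
    using n G by (auto simp: L2_iff_nn_integral intro: less_trans)
  ultimately have "(\<lambda>p. ?F n p - (?F n p - G p)) \<in> L2 lborel"
    by (rule L2_diff)
  then have "(\<lambda>p. G p) \<in> L2 lborel"
    by simp
  then have "is_inv_fourier_t f (\<lambda>w z. G (fst z, snd z, w))"
    using lim unfolding is_inv_fourier_t_def by (simp add: case_prod_beta' partial_fourier_slab_restrict[symmetric])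
  then show ?thesis
    by (rule exI[of "is_inv_fourier_t f"])
qed

lemma is_inv_fourier_t_inv_fourier_t:
  "f \<in> L2 lborel \<Longrightarrow> is_inv_fourier_t f (inv_fourier_t f)"
  unfolding inv_fourier_t_def by (rule someI_ex[OF ex_is_inv_fourier_t])

section \<open>Inner products of translates\<close>

lemma heis_translate_apply:
  "heis_translate (u, v, s) f (x, y, t) = f (x - u, y - v, t + ((u * y - v * x) / 2 - s))"
  by (simp add: heis_translate_def algebra_simps diff_divide_distrib)

lemma borel_measurable_heis_mult [measurable]: "heis_mult p \<in> borel_measurable borel"
proof -
  obtain u v s where p: "p = (u, v, s)" by (cases p)
  have "heis_mult p = (\<lambda>q. (u + fst q, v + fst (snd q), s + snd (snd q) + (fst q * v - fst (snd q) * u) / 2))"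
    by (auto simp: p)
  also have "\<dots> \<in> (borel \<Otimes>\<^sub>M borel \<Otimes>\<^sub>M borel) \<rightarrow>\<^sub>M (borel \<Otimes>\<^sub>M borel \<Otimes>\<^sub>M borel)"
    by measurable
  finally show ?thesis
    by (simp add: borel_prod)
qed

lemma borel_measurable_heis_translate [measurable]:
  "f \<in> borel_measurable borel \<Longrightarrow> heis_translate p f \<in> borel_measurable borel"
  unfolding heis_translate_def by (rule measurable_compose[OF borel_measurable_heis_mult])

lemma nn_integral_heis_mult:
  assumes [measurable]: "f \<in> borel_measurable borel"
  shows "(\<integral>\<^sup>+q. f (heis_mult p q) \<partial>lborel) = (\<integral>\<^sup>+q. f q \<partial>lborel)"
proof -
  obtain u v s where p: "p = (u, v, s)" by (cases p)
  have [measurable]: "f \<in> borel_measurable (borel \<Otimes>\<^sub>M borel \<Otimes>\<^sub>M borel)"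
    by (simp add: borel_prod)
  have "(\<lambda>z. \<integral>\<^sup>+t. f (fst z, snd z, t) \<partial>lborel) \<in> borel_measurable (borel \<Otimes>\<^sub>M borel)"
    by measurable
  then have [measurable]: "(\<lambda>z. \<integral>\<^sup>+t. f (fst z, snd z, t) \<partial>lborel) \<in> borel_measurable borel"
    by (simp add: borel_prod)
  have "(\<integral>\<^sup>+q. f (heis_mult p q) \<partial>lborel)
      = (\<integral>\<^sup>+z. (\<integral>\<^sup>+t. f (fst z + u, snd z + v, t + (s + (fst z * v - snd z * u) / 2)) \<partial>lborel) \<partial>lborel)"
    by (subst heis_nn_integral) (simp_all add: p add_ac)
  also have "\<dots> = (\<integral>\<^sup>+z. (\<integral>\<^sup>+t. f (fst z + u, snd z + v, t) \<partial>lborel) \<partial>lborel)"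
  proof (rule nn_integral_cong)
    fix z :: "real \<times> real"
    have m: "(\<lambda>t. f (fst z + u, snd z + v, t)) \<in> borel_measurable borel"
      by measurable
    show "(\<integral>\<^sup>+t. f (fst z + u, snd z + v, t + (s + (fst z * v - snd z * u) / 2)) \<partial>lborel)
        = (\<integral>\<^sup>+t. f (fst z + u, snd z + v, t) \<partial>lborel)"
      using nn_integral_lborel_shift[OF m, of "- (s + (fst z * v - snd z * u) / 2)"]
      by (simp only: diff_minus_eq_add)
  qed
  also have "\<dots> = (\<integral>\<^sup>+z. (\<integral>\<^sup>+t. f (fst z, snd z, t) \<partial>lborel) \<partial>lborel)"
    using nn_integral_lborel_shift[of "\<lambda>z. \<integral>\<^sup>+t. f (fst z, snd z, t) \<partial>lborel" "- (u, v)"] by simp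
  also have "\<dots> = (\<integral>\<^sup>+q. f q \<partial>lborel)"
    by (rule heis_nn_integral[symmetric]) simp
  finally show ?thesis .
qed

lemma nn_integral_heis_translate:
  assumes "f \<in> borel_measurable borel"
  shows "(\<integral>\<^sup>+q. ennreal ((cmod (heis_translate p f q))\<^sup>2) \<partial>lborel) = (\<integral>\<^sup>+q. ennreal ((cmod (f q))\<^sup>2) \<partial>lborel)"
  unfolding heis_translate_def using assms by (intro nn_integral_heis_mult) measurable

lemma L2_heis_translate: "f \<in> L2 lborel \<Longrightarrow> heis_translate p f \<in> L2 lborel"
  by (auto simp: L2_iff_nn_integral nn_integral_heis_translate intro!: borel_measurable_heis_translate)

lemma slicewise_bounded_support_heis_translate:
  assumes "slicewise_bounded_support f"
  shows "slicewise_bounded_support (heis_translate p f)"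
  unfolding slicewise_bounded_support_def
proof (intro allI)
  fix x y
  obtain u v s where p: "p = (u, v, s)" by (cases p)
  obtain c where c: "\<And>t. c < \<bar>t\<bar> \<Longrightarrow> f (x - u, y - v, t) = 0"
    using assms unfolding slicewise_bounded_support_def by blast
  have "f (x - u, y - v, t + ((u * y - v * x) / 2 - s)) = 0" if "c + \<bar>(u * y - v * x) / 2 - s\<bar> < \<bar>t\<bar>" for t
    using that by (intro c) linarith
  then show "\<exists>c. \<forall>t. c < \<bar>t\<bar> \<longrightarrow> heis_translate p f (x, y, t) = 0"
    unfolding p heis_translate_apply by blast
qed

text \<open>The operator that left translation becomes under the partial Fourier transform.\<close>

definition fourier_translate :: "heis \<Rightarrow> (heis \<Rightarrow> complex) \<Rightarrow> heis \<Rightarrow> complex" where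
  "fourier_translate = (\<lambda>(u, v, s) G (x, y, w).
     cis (2 * pi * w * s) * twisted_translate w (u, v) (\<lambda>z. G (fst z, snd z, w)) (x, y))"

lemma fourier_translate_apply:
  "fourier_translate (u, v, s) G q
    = cis (2 * pi * snd (snd q) * s + pi * snd (snd q) * (v * fst q - u * fst (snd q))) * G (q - (u, v, 0))"
  by (cases q) (simp add: fourier_translate_def twisted_translate_def cis_mult[symmetric] mult.assoc)

lemma borel_measurable_fourier_translate [measurable]:
  assumes [measurable]: "G \<in> borel_measurable borel"
  shows "fourier_translate p G \<in> borel_measurable borel"
proof -
  obtain u v s where p: "p = (u, v, s)" by (cases p)
  have "(\<lambda>q::heis. cis (2 * pi * snd (snd q) * s + pi * snd (snd q) * (v * fst q - u * fst (snd q))))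
      \<in> borel_measurable (borel \<Otimes>\<^sub>M borel \<Otimes>\<^sub>M borel)"
    by measurable
  then have [measurable]: "(\<lambda>q::heis. cis (2 * pi * snd (snd q) * s + pi * snd (snd q) * (v * fst q - u * fst (snd q))))
      \<in> borel_measurable borel"
    by (simp add: borel_prod)
  show ?thesis
    unfolding p fourier_translate_apply[abs_def] by measurable
qed

lemma nn_integral_fourier_translate:
  assumes [measurable]: "G \<in> borel_measurable borel"
  shows "(\<integral>\<^sup>+q. ennreal ((cmod (fourier_translate p G q))\<^sup>2) \<partial>lborel) = (\<integral>\<^sup>+q. ennreal ((cmod (G q))\<^sup>2) \<partial>lborel)"
proof -
  obtain u v s where p: "p = (u, v, s)" by (cases p)
  show ?thesis
    unfolding p fourier_translate_apply
    using nn_integral_lborel_shift[of "\<lambda>q. ennreal ((cmod (G q))\<^sup>2)" "(u, v, 0)"] by (simp add: norm_mult)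
qed

lemma L2_fourier_translate: "G \<in> L2 lborel \<Longrightarrow> fourier_translate p G \<in> L2 lborel"
  by (auto simp: L2_iff_nn_integral nn_integral_fourier_translate intro!: borel_measurable_fourier_translate)

lemma partial_fourier_heis_translate:
  assumes "f \<in> borel_measurable borel"
  shows "partial_fourier (heis_translate p f) = fourier_translate p (partial_fourier f)"
proof
  fix q :: heis
  obtain u v s where p: "p = (u, v, s)" by (cases p)
  obtain x y w where q: "q = (x, y, w)" by (cases q)
  have "f \<in> borel_measurable (borel \<Otimes>\<^sub>M borel \<Otimes>\<^sub>M borel)"
    using assms by (simp add: borel_prod)
  then have [measurable]: "(\<lambda>t. f (x - u, y - v, t)) \<in> borel_measurable borel"
    by measurable
  define b where "b = (u * y - v * x) / 2 - s"
  have "partial_fourier (heis_translate p f) q = (\<integral>t. f (x - u, y - v, t - (- b)) * cis (2 * pi * w * t) \<partial>lborel)"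
    by (simp only: partial_fourier_def inv_fourier_def p q heis_translate_apply b_def diff_minus_eq_add fst_conv snd_conv)
  also have "\<dots> = (\<integral>t. (cis (2 * pi * w * (- b)) * (f (x - u, y - v, t - (- b)) * cis (2 * pi * w * (t - (- b))))) \<partial>lborel)"
  proof (rule Bochner_Integration.integral_cong[OF refl])
    fix t
    have "cis (2 * pi * w * t) = cis (2 * pi * w * (- b)) * cis (2 * pi * w * (t - (- b)))"
      unfolding cis_mult by (simp add: algebra_simps)
    then show "f (x - u, y - v, t - (- b)) * cis (2 * pi * w * t)
        = cis (2 * pi * w * (- b)) * (f (x - u, y - v, t - (- b)) * cis (2 * pi * w * (t - (- b))))"
      by simp
  qed
  also have "\<dots> = cis (2 * pi * w * (- b)) * (\<integral>t. f (x - u, y - v, t - (- b)) * cis (2 * pi * w * (t - (- b))) \<partial>lborel)"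
    by simp
  also have "(\<integral>t. f (x - u, y - v, t - (- b)) * cis (2 * pi * w * (t - (- b))) \<partial>lborel)
      = (\<integral>t. f (x - u, y - v, t) * cis (2 * pi * w * t) \<partial>lborel)"
    using integral_lborel_shift[of "\<lambda>t. f (x - u, y - v, t) * cis (2 * pi * w * t)" "- b"] by simp
  also have "2 * pi * w * (- b) = 2 * pi * w * s + pi * w * (v * x - u * y)"
    by (simp add: b_def field_simps)
  finally show "partial_fourier (heis_translate p f) q = fourier_translate p (partial_fourier f) q"
    by (simp add: p q fourier_translate_apply partial_fourier_def inv_fourier_def)
qed

lemma heis_translate_diff: "heis_translate p (\<lambda>q. f q - h q) q = heis_translate p f q - heis_translate p h q"
  by (simp add: heis_translate_def)

lemma fourier_translate_diff:
  "fourier_translate p (\<lambda>q. f q - h q) q = fourier_translate p f q - fourier_translate p h q"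
  by (cases p) (simp add: fourier_translate_apply right_diff_distrib)

lemma tendsto_l2_norm_iff_nn_integral:
  assumes "\<And>n. f n \<in> L2 M"
  shows "(\<lambda>n. l2_norm M (f n)) \<longlonglongrightarrow> 0 \<longleftrightarrow> (\<lambda>n. \<integral>\<^sup>+x. ennreal ((cmod (f n x))\<^sup>2) \<partial>M) \<longlonglongrightarrow> 0"
proof -
  have "(\<lambda>n. \<integral>\<^sup>+x. ennreal ((cmod (f n x))\<^sup>2) \<partial>M) \<longlonglongrightarrow> 0 \<longleftrightarrow> (\<lambda>n. (l2_norm M (f n))\<^sup>2) \<longlonglongrightarrow> 0"
    using assms tendsto_ennreal_iff[of "\<lambda>n. (l2_norm M (f n))\<^sup>2" sequentially 0]
    by (simp add: nn_integral_square_eq_l2_norm)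
  also have "\<dots> \<longleftrightarrow> (\<lambda>n. l2_norm M (f n)) \<longlonglongrightarrow> 0"
    using tendsto_real_sqrt[of "\<lambda>n. (l2_norm M (f n))\<^sup>2" 0 sequentially]
      tendsto_power[of "\<lambda>n. l2_norm M (f n)" 0 sequentially 2] by auto
  finally show ?thesis ..
qed

text \<open>For the truncations of \<open>g\<close> the transform is an integral that converges absolutely on almost every
  slice; it intertwines the two actions pointwise and is isometric, so inner products agree by polarisation. Both actions are isometric,
  hence both sides converge as the truncation is removed. The identity holds for every version of
  the transform, as only its \<open>L\<^sup>2\<close> distance to the truncated transforms enters.\<close>

lemma l2_inner_heis_translate:
  assumes g: "g \<in> L2 lborel"
  shows "l2_inner lborel (heis_translate p g) (heis_translate q g)
    = l2_inner lborel (fourier_translate p (\<lambda>(x, y, w). inv_fourier_t g w (x, y)))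
        (fourier_translate q (\<lambda>(x, y, w). inv_fourier_t g w (x, y)))"
proof -
  define G where "G = (\<lambda>(x, y, w). inv_fourier_t g w (x, y))"
  define gn where "gn n = slab_restrict n g" for n
  define Gn where "Gn n = partial_fourier (gn n)" for n
  have gn: "gn n \<in> L2 lborel" "slicewise_bounded_support (gn n)" for n
    unfolding gn_def using g by (simp_all add: slab_restrict_L2 slab_restrict_bounded_support)
  have [measurable]: "g \<in> borel_measurable borel" "gn n \<in> borel_measurable borel" for n
    using g gn by (auto simp: L2_def)
  have fourier_g: "is_inv_fourier_t g (inv_fourier_t g)"
    by (rule is_inv_fourier_t_inv_fourier_t[OF g])
  then have G: "G \<in> L2 lborel"
    by (simp add: is_inv_fourier_t_def G_def)
  have Gn: "Gn n \<in> L2 lborel" for n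
    using Plancherel_partial_fourier[OF gn gn, of n 0 n] gn(1)[of n]
    by (simp add: L2_iff_nn_integral Gn_def)
  have g_lim: "(\<lambda>n. \<integral>\<^sup>+q. ennreal ((cmod (gn n q - g q))\<^sup>2) \<partial>lborel) \<longlonglongrightarrow> 0"
    unfolding gn_def by (rule slab_restrict_tendsto[OF g])
  have G_lim: "(\<lambda>n. \<integral>\<^sup>+q. ennreal ((cmod (Gn n q - G q))\<^sup>2) \<partial>lborel) \<longlonglongrightarrow> 0"
    using fourier_g unfolding is_inv_fourier_t_def
    by (simp add: case_prod_beta' G_def Gn_def gn_def partial_fourier_slab_restrict[symmetric])
  have gm: "(\<lambda>q. gn n q - g q) \<in> borel_measurable borel" "(\<lambda>q. Gn n q - G q) \<in> borel_measurable borel" for n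
    using L2_diff[OF gn(1) g, of n] L2_diff[OF Gn G, of n] by (auto simp: L2_def)
  have lim1: "(\<lambda>n. l2_norm lborel (\<lambda>x. heis_translate p (gn n) x - heis_translate p g x)) \<longlonglongrightarrow> 0" for p
    using g_lim gn(1) g
    by (subst tendsto_l2_norm_iff_nn_integral)
      (simp_all add: L2_diff L2_heis_translate heis_translate_diff[symmetric] nn_integral_heis_translate gm)
  have lim2: "(\<lambda>n. l2_norm lborel (\<lambda>x. fourier_translate p (Gn n) x - fourier_translate p G x)) \<longlonglongrightarrow> 0" for p
    using G_lim Gn G
    by (subst tendsto_l2_norm_iff_nn_integral)
      (simp_all add: L2_diff L2_fourier_translate fourier_translate_diff[symmetric] nn_integral_fourier_translate gm)
  have "l2_inner lborel (heis_translate p (gn n)) (heis_translate q (gn n))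
      = l2_inner lborel (fourier_translate p (Gn n)) (fourier_translate q (Gn n))" for n
  proof (rule l2_inner_eq_if_norm_eq)
    fix c
    have "(\<lambda>x. heis_translate p (gn n) x + c * heis_translate q (gn n) x) \<in> L2 lborel"
      "(\<lambda>x. fourier_translate p (Gn n) x + c * fourier_translate q (Gn n) x) \<in> L2 lborel"
      using gn Gn by (intro L2_add L2_cmult L2_heis_translate L2_fourier_translate; simp)+
    then have "ennreal ((l2_norm lborel (\<lambda>x. heis_translate p (gn n) x + c * heis_translate q (gn n) x))\<^sup>2)
        = ennreal ((l2_norm lborel (\<lambda>x. fourier_translate p (Gn n) x + c * fourier_translate q (Gn n) x))\<^sup>2)"
      using Plancherel_partial_fourier[of "heis_translate p (gn n)" "heis_translate q (gn n)" c] gn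
      by (simp add: nn_integral_square_eq_l2_norm[symmetric] Gn_def partial_fourier_heis_translate[symmetric]
          L2_heis_translate slicewise_bounded_support_heis_translate)
    then show "l2_norm lborel (\<lambda>x. heis_translate p (gn n) x + c * heis_translate q (gn n) x)
        = l2_norm lborel (\<lambda>x. fourier_translate p (Gn n) x + c * fourier_translate q (Gn n) x)"
      by simp
  qed (simp_all add: L2_heis_translate L2_fourier_translate gn Gn)
  moreover have "(\<lambda>n. l2_inner lborel (heis_translate p (gn n)) (heis_translate q (gn n)))
      \<longlonglongrightarrow> l2_inner lborel (heis_translate p g) (heis_translate q g)"
    using g gn by (intro tendsto_l2_inner lim1 L2_heis_translate)
  moreover have "(\<lambda>n. l2_inner lborel (fourier_translate p (Gn n)) (fourier_translate q (Gn n)))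
      \<longlonglongrightarrow> l2_inner lborel (fourier_translate p G) (fourier_translate q G)"
    using G Gn by (intro tendsto_l2_inner lim2 L2_fourier_translate)
  ultimately show ?thesis
    unfolding G_def[symmetric] using LIMSEQ_unique by simp
qed

text \<open>Lebesgue measure on triples as a product of frequency and position, in this order, so that Fubini's theorem
  applies to the slices at a fixed frequency.\<close>

lemma heis_lborel_eq_distr:
  "(lborel :: heis measure) = distr (lborel \<Otimes>\<^sub>M lborel) borel (\<lambda>(w, z). (fst z, snd z, w))"
proof (rule measure_eqI)
  have "(\<lambda>p::real \<times> real \<times> real. (fst (snd p), snd (snd p), fst p)) \<in> (borel \<Otimes>\<^sub>M borel \<Otimes>\<^sub>M borel) \<rightarrow>\<^sub>M (borel \<Otimes>\<^sub>M borel \<Otimes>\<^sub>M borel)"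
    by measurable
  then have m: "(\<lambda>(w::real, z::real \<times> real). (fst z, snd z, w)) \<in> borel_measurable (lborel \<Otimes>\<^sub>M lborel)"
    by (simp add: borel_prod lborel_prod case_prod_beta')
  show "emeasure (lborel :: heis measure) X = emeasure (distr (lborel \<Otimes>\<^sub>M lborel) borel (\<lambda>(w, z). (fst z, snd z, w))) X"
    if "X \<in> sets lborel" for X
  proof -
    have [measurable]: "X \<in> sets borel"
      using that by simp
    have ind: "(\<lambda>(w::real, z::real \<times> real). indicator X (fst z, snd z, w) :: ennreal) \<in> borel_measurable (lborel \<Otimes>\<^sub>M lborel)"
      using measurable_compose[OF m, of "indicator X" borel] by (simp add: case_prod_beta')
    have "emeasure (distr (lborel \<Otimes>\<^sub>M lborel) borel (\<lambda>(w, z). (fst z, snd z, w))) X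
        = (\<integral>\<^sup>+(w, z). indicator X (fst z, snd z, w) \<partial>(lborel \<Otimes>\<^sub>M lborel))"
      using nn_integral_distr[OF m, of "indicator X"] by (simp add: case_prod_beta')
    also have "\<dots> = (\<integral>\<^sup>+z. (\<integral>\<^sup>+w. indicator X (fst z, snd z, w) \<partial>lborel) \<partial>lborel)"
      using lborel_pair.nn_integral_snd[OF ind] by simp
    also have "\<dots> = (\<integral>\<^sup>+q. indicator X q \<partial>lborel)"
      by (rule heis_nn_integral[symmetric]) simp
    finally show ?thesis by simp
  qed
qed simp

lemma
  fixes F :: "heis \<Rightarrow> complex"
  assumes F: "integrable lborel F"
  shows AE_integrable_frequency_slice: "AE w in lborel. integrable lborel (\<lambda>z. F (fst z, snd z, w))"
    and integrable_frequency_slices: "integrable lborel (\<lambda>w. \<integral>z. F (fst z, snd z, w) \<partial>lborel)"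
    and integral_frequency_slices: "(\<integral>w. (\<integral>z. F (fst z, snd z, w) \<partial>lborel) \<partial>lborel) = (\<integral>p. F p \<partial>lborel)"
proof -
  have "(\<lambda>p::real \<times> real \<times> real. (fst (snd p), snd (snd p), fst p)) \<in> (borel \<Otimes>\<^sub>M borel \<Otimes>\<^sub>M borel) \<rightarrow>\<^sub>M (borel \<Otimes>\<^sub>M borel \<Otimes>\<^sub>M borel)"
    by measurable
  then have [measurable]: "(\<lambda>(w::real, z::real \<times> real). (fst z, snd z, w)) \<in> borel_measurable (lborel \<Otimes>\<^sub>M lborel)"
    by (simp add: borel_prod lborel_prod case_prod_beta')
  have [measurable]: "F \<in> borel_measurable borel"
    using F by simp
  have int: "integrable (lborel \<Otimes>\<^sub>M lborel) (\<lambda>(w, z). F (fst z, snd z, w))"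
    using F by (subst (asm) heis_lborel_eq_distr, subst (asm) integrable_distr_eq) (auto simp: case_prod_beta')
  show "AE w in lborel. integrable lborel (\<lambda>z. F (fst z, snd z, w))"
    using lborel_pair.AE_integrable_fst[OF int] by simp
  show "integrable lborel (\<lambda>w. \<integral>z. F (fst z, snd z, w) \<partial>lborel)"
    using lborel_pair.integrable_fst[OF int] by simp
  have "(\<integral>p. F p \<partial>lborel) = (\<integral>q. F (case q of (w, z) \<Rightarrow> (fst z, snd z, w)) \<partial>(lborel \<Otimes>\<^sub>M lborel))"
    by (subst heis_lborel_eq_distr, subst integral_distr) auto
  also have "\<dots> = (\<integral>w. (\<integral>z. F (fst z, snd z, w) \<partial>lborel) \<partial>lborel)"
    using lborel_pair.integral_fst[OF int] by (simp add: case_prod_beta')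
  finally show "(\<integral>w. (\<integral>z. F (fst z, snd z, w) \<partial>lborel) \<partial>lborel) = (\<integral>p. F p \<partial>lborel)" ..
qed

section \<open>Frame inequalities and limits\<close>

lemma nn_integral_count_space_square_le_of_tendsto:
  fixes y :: "nat \<Rightarrow> 'i \<Rightarrow> complex"
  assumes lim: "\<And>j. (\<lambda>n. y n j) \<longlonglongrightarrow> z j"
    and le: "\<And>n. (\<integral>\<^sup>+j. ennreal ((cmod (y n j))\<^sup>2) \<partial>count_space UNIV) \<le> ennreal (c n)" and c: "c \<longlonglongrightarrow> d"
  shows "(\<integral>\<^sup>+j. ennreal ((cmod (z j))\<^sup>2) \<partial>count_space UNIV) \<le> ennreal d"
proof -
  have "liminf (\<lambda>n. ennreal ((cmod (y n j))\<^sup>2)) = ennreal ((cmod (z j))\<^sup>2)" for j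
    using lim by (intro lim_imp_Liminf[OF sequentially_bot] tendsto_intros)
  then have "(\<integral>\<^sup>+j. ennreal ((cmod (z j))\<^sup>2) \<partial>count_space UNIV)
      = (\<integral>\<^sup>+j. liminf (\<lambda>n. ennreal ((cmod (y n j))\<^sup>2)) \<partial>count_space UNIV)"
    by simp
  also have "\<dots> \<le> liminf (\<lambda>n. \<integral>\<^sup>+j. ennreal ((cmod (y n j))\<^sup>2) \<partial>count_space UNIV)"
    by (rule nn_integral_liminf) simp
  also have "\<dots> \<le> liminf (\<lambda>n. ennreal (c n))"
    using le by (intro Liminf_mono) simp
  also have "\<dots> = ennreal d"
    using c by (intro lim_imp_Liminf[OF sequentially_bot] tendsto_ennrealI)
  finally show ?thesis .
qed

text \<open>The upper bound passes to a limit by Fatou's lemma. Applied to differences it makes the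
  coefficient sequences converge in square sum, and then so does the lower bound, by
  \<open>\<bar>a + b\<bar>\<^sup>2 \<le> (1 + \<delta>) \<bar>a\<bar>\<^sup>2 + (1 + 1/\<delta>) \<bar>b\<bar>\<^sup>2\<close>. The same statement serves twice: for the closure of the
  span of a system, and for coefficient vectors that depend continuously on the frequency.\<close>

lemma frame_inequalities_limit:
  fixes y :: "nat \<Rightarrow> 'i \<Rightarrow> complex"
  assumes lim: "\<And>j. (\<lambda>n. y n j) \<longlonglongrightarrow> z j" and Q: "Q \<longlonglongrightarrow> q"
    and R: "((\<lambda>(n, m). R n m) \<longlongrightarrow> 0) (sequentially \<times>\<^sub>F sequentially)"
    and lower: "\<And>n. ennreal (A * Q n) \<le> (\<integral>\<^sup>+j. ennreal ((cmod (y n j))\<^sup>2) \<partial>count_space UNIV)"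
    and upper: "\<And>n. (\<integral>\<^sup>+j. ennreal ((cmod (y n j))\<^sup>2) \<partial>count_space UNIV) \<le> ennreal (B * Q n)"
    and diff: "\<And>n m. (\<integral>\<^sup>+j. ennreal ((cmod (y n j - y m j))\<^sup>2) \<partial>count_space UNIV) \<le> ennreal (B * R n m)"
    and B: "0 < B"
  shows "ennreal (A * q) \<le> (\<integral>\<^sup>+j. ennreal ((cmod (z j))\<^sup>2) \<partial>count_space UNIV)"
    and "(\<integral>\<^sup>+j. ennreal ((cmod (z j))\<^sup>2) \<partial>count_space UNIV) \<le> ennreal (B * q)"
proof -
  show up: "(\<integral>\<^sup>+j. ennreal ((cmod (z j))\<^sup>2) \<partial>count_space UNIV) \<le> ennreal (B * q)"
    using lim upper tendsto_mult_left[OF Q, of B] by (rule nn_integral_count_space_square_le_of_tendsto)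
  then obtain \<zeta> where \<zeta>: "0 \<le> \<zeta>" "(\<integral>\<^sup>+j. ennreal ((cmod (z j))\<^sup>2) \<partial>count_space UNIV) = ennreal \<zeta>"
    by (cases "\<integral>\<^sup>+j. ennreal ((cmod (z j))\<^sup>2) \<partial>count_space UNIV") (auto simp: top_unique)
  have close: "\<exists>N. \<forall>n\<ge>N. (\<integral>\<^sup>+j. ennreal ((cmod (y n j - z j))\<^sup>2) \<partial>count_space UNIV) \<le> ennreal (B * e)" if "0 < e" for e
  proof -
    have "\<forall>\<^sub>F x in sequentially \<times>\<^sub>F sequentially. (case x of (n, m) \<Rightarrow> R n m) < e"
      using R that by (rule order_tendstoD(2))
    then obtain N where N: "\<And>n m. N \<le> n \<Longrightarrow> N \<le> m \<Longrightarrow> R n m < e"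
      by (auto simp: eventually_prod_sequentially)
    have "(\<integral>\<^sup>+j. ennreal ((cmod (y n j - z j))\<^sup>2) \<partial>count_space UNIV) \<le> ennreal (B * e)" if n: "N \<le> n" for n
    proof (rule nn_integral_count_space_square_le_of_tendsto)
      show "(\<lambda>m. y n j - y (m + N) j) \<longlonglongrightarrow> y n j - z j" for j
        by (intro tendsto_intros LIMSEQ_ignore_initial_segment lim)
      show "(\<integral>\<^sup>+j. ennreal ((cmod (y n j - y (m + N) j))\<^sup>2) \<partial>count_space UNIV) \<le> ennreal (B * e)" for m
        using N[OF n, of "m + N"] B by (intro order_trans[OF diff] ennreal_leI mult_left_mono) auto
      show "(\<lambda>m. B * e) \<longlonglongrightarrow> B * e" by simp
    qed
    then show ?thesis by blast
  qed
  have main: "A * q \<le> (1 + \<delta>) * \<zeta> + (1 + 1 / \<delta>) * (B * \<delta>\<^sup>2)" if \<delta>: "0 < \<delta>" for \<delta>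
  proof -
    obtain N where N: "\<And>n. N \<le> n \<Longrightarrow> (\<integral>\<^sup>+j. ennreal ((cmod (y n j - z j))\<^sup>2) \<partial>count_space UNIV) \<le> ennreal (B * \<delta>\<^sup>2)"
      using close[of "\<delta>\<^sup>2"] \<delta> by auto
    have young: "(cmod a)\<^sup>2 \<le> (1 + \<delta>) * (cmod b)\<^sup>2 + (1 + 1 / \<delta>) * (cmod (a - b))\<^sup>2" for a b
    proof -
      have "(cmod a)\<^sup>2 \<le> (cmod b + cmod (a - b))\<^sup>2"
        using norm_triangle_ineq[of b "a - b"] by (intro power_mono) auto
      also have "\<dots> = (1 + \<delta>) * (cmod b)\<^sup>2 + (1 + 1 / \<delta>) * (cmod (a - b))\<^sup>2 - (\<delta> * cmod b - cmod (a - b))\<^sup>2 / \<delta>"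
        using \<delta> by (simp add: power2_eq_square field_simps)
      also have "\<dots> \<le> (1 + \<delta>) * (cmod b)\<^sup>2 + (1 + 1 / \<delta>) * (cmod (a - b))\<^sup>2"
        using \<delta> by simp
      finally show ?thesis .
    qed
    have "A * Q n \<le> (1 + \<delta>) * \<zeta> + (1 + 1 / \<delta>) * (B * \<delta>\<^sup>2)" if n: "N \<le> n" for n
    proof -
      have "ennreal (A * Q n) \<le> (\<integral>\<^sup>+j. ennreal ((cmod (y n j))\<^sup>2) \<partial>count_space UNIV)"
        by (rule lower)
      also have "\<dots> \<le> (\<integral>\<^sup>+j. ennreal (1 + \<delta>) * ennreal ((cmod (z j))\<^sup>2)
          + ennreal (1 + 1 / \<delta>) * ennreal ((cmod (y n j - z j))\<^sup>2) \<partial>count_space UNIV)"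
      proof (rule nn_integral_mono)
        fix j
        have "ennreal ((cmod (y n j))\<^sup>2) \<le> ennreal ((1 + \<delta>) * (cmod (z j))\<^sup>2 + (1 + 1 / \<delta>) * (cmod (y n j - z j))\<^sup>2)"
          by (intro ennreal_leI young)
        also have "\<dots> = ennreal (1 + \<delta>) * ennreal ((cmod (z j))\<^sup>2) + ennreal (1 + 1 / \<delta>) * ennreal ((cmod (y n j - z j))\<^sup>2)"
          using \<delta> by (simp add: ennreal_mult ennreal_plus del: ennreal_plus[symmetric])
        finally show "ennreal ((cmod (y n j))\<^sup>2)
            \<le> ennreal (1 + \<delta>) * ennreal ((cmod (z j))\<^sup>2) + ennreal (1 + 1 / \<delta>) * ennreal ((cmod (y n j - z j))\<^sup>2)" .
      qed
      also have "\<dots> = ennreal (1 + \<delta>) * ennreal \<zeta>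
          + ennreal (1 + 1 / \<delta>) * (\<integral>\<^sup>+j. ennreal ((cmod (y n j - z j))\<^sup>2) \<partial>count_space UNIV)"
        by (simp add: nn_integral_add nn_integral_cmult \<zeta>(2))
      also have "\<dots> \<le> ennreal (1 + \<delta>) * ennreal \<zeta> + ennreal (1 + 1 / \<delta>) * ennreal (B * \<delta>\<^sup>2)"
        by (intro add_left_mono mult_left_mono N n) simp
      also have "\<dots> = ennreal ((1 + \<delta>) * \<zeta> + (1 + 1 / \<delta>) * (B * \<delta>\<^sup>2))"
        using \<delta> \<zeta>(1) B by (simp only: ennreal_mult[symmetric] ennreal_plus[symmetric] add_nonneg_nonneg mult_nonneg_nonneg
            less_imp_le zero_le_one zero_le_divide_1_iff zero_le_power2)
      finally show ?thesis
        using \<delta> \<zeta>(1) B by (subst (asm) ennreal_le_iff) auto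
    qed
    then show ?thesis
      by (intro LIMSEQ_le_const2[OF tendsto_mult_left[OF Q]] exI[of _ N]) auto
  qed
  have "A * q \<le> \<zeta>"
  proof (rule tendsto_le[of "at_right (0::real)", OF _ _ tendsto_const])
    have "((\<lambda>\<delta>. (1 + \<delta>) * \<zeta> + B * (\<delta>\<^sup>2 + \<delta>)) \<longlongrightarrow> \<zeta>) (at_right 0)"
      by (auto intro!: tendsto_eq_intros)
    then show "((\<lambda>\<delta>. (1 + \<delta>) * \<zeta> + B * (\<delta>\<^sup>2 + \<delta>)) \<longlongrightarrow> \<zeta>) (at_right 0)" .
    show "\<forall>\<^sub>F \<delta> in at_right 0. A * q \<le> (1 + \<delta>) * \<zeta> + B * (\<delta>\<^sup>2 + \<delta>)"
      using eventually_at_right_less[of 0]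
    proof eventually_elim
      case (elim \<delta>)
      have eq: "(1 + 1 / \<delta>) * (B * \<delta>\<^sup>2) = B * (\<delta>\<^sup>2 + \<delta>)"
        using elim by (simp add: field_simps power2_eq_square)
      then show ?case
        using main[OF elim] by (simp only: eq)
    qed
  qed simp
  then show "ennreal (A * q) \<le> (\<integral>\<^sup>+j. ennreal ((cmod (z j))\<^sup>2) \<partial>count_space UNIV)"
    unfolding \<zeta>(2) by (rule ennreal_leI)
qed

lemma lin_spanI: "finite J \<Longrightarrow> (\<lambda>x. \<Sum>j\<in>J. c j * \<phi> j x) \<in> lin_span \<phi>"
  by (auto simp: lin_span_def)

lemma lin_span_diff:
  assumes "f \<in> lin_span \<phi>" "g \<in> lin_span \<phi>"
  shows "(\<lambda>x. f x - g x) \<in> lin_span \<phi>"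
proof -
  obtain J c where J: "finite J" "f = (\<lambda>x. \<Sum>j\<in>J. c j * \<phi> j x)"
    using assms(1) by (auto simp: lin_span_def)
  obtain K d where K: "finite K" "g = (\<lambda>x. \<Sum>j\<in>K. d j * \<phi> j x)"
    using assms(2) by (auto simp: lin_span_def)
  define c' where "c' j = (if j \<in> J then c j else 0)" for j
  define d' where "d' j = (if j \<in> K then d j else 0)" for j
  have "f = (\<lambda>x. \<Sum>j\<in>J \<union> K. c' j * \<phi> j x)"
    unfolding J(2) c'_def using J(1) K(1) by (intro ext sum.mono_neutral_cong_left) auto
  moreover have "g = (\<lambda>x. \<Sum>j\<in>J \<union> K. d' j * \<phi> j x)"
    unfolding K(2) d'_def using J(1) K(1) by (intro ext sum.mono_neutral_cong_left) auto
  ultimately have "(\<lambda>x. f x - g x) = (\<lambda>x. \<Sum>j\<in>J \<union> K. (c' j - d' j) * \<phi> j x)"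
    by (simp add: left_diff_distrib sum_subtractf)
  then show ?thesis
    using J(1) K(1) by (simp add: lin_spanI)
qed

lemma lin_span_L2: "(\<And>j. \<phi> j \<in> L2 M) \<Longrightarrow> f \<in> lin_span \<phi> \<Longrightarrow> f \<in> L2 M"
  by (auto simp: lin_span_def intro!: L2_sum L2_cmult)

lemma frame_sequence_iff_lin_span:
  fixes \<phi> :: "'i::countable \<Rightarrow> 'a \<Rightarrow> complex"
  assumes \<phi>: "\<And>j. \<phi> j \<in> L2 M" and AB: "0 < A" "0 < B"
  shows "frame_sequence M \<phi> A B \<longleftrightarrow> (\<forall>h\<in>lin_span \<phi>.
      ennreal (A * (l2_norm M h)\<^sup>2) \<le> (\<integral>\<^sup>+j. ennreal ((cmod (l2_inner M h (\<phi> j)))\<^sup>2) \<partial>count_space UNIV) \<and>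
      (\<integral>\<^sup>+j. ennreal ((cmod (l2_inner M h (\<phi> j)))\<^sup>2) \<partial>count_space UNIV) \<le> ennreal (B * (l2_norm M h)\<^sup>2))"
    (is "_ \<longleftrightarrow> (\<forall>h\<in>lin_span \<phi>. ?P h)")
proof
  assume fs: "frame_sequence M \<phi> A B"
  show "\<forall>h\<in>lin_span \<phi>. ?P h"
  proof
    fix h assume h: "h \<in> lin_span \<phi>"
    then have "h \<in> l2_closure M (lin_span \<phi>)"
      using lin_span_L2[OF \<phi> h] by (auto simp: l2_closure_def l2_norm_def intro!: bexI[of _ h])
    then show "?P h"
      using fs by (simp add: frame_sequence_def infsum_eq_nn_integral_count_space)
  qed
next
  assume P: "\<forall>h\<in>lin_span \<phi>. ?P h"
  have "?P f" if "f \<in> l2_closure M (lin_span \<phi>)" for f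
  proof -
    have f: "f \<in> L2 M" and "\<And>n. \<exists>h\<in>lin_span \<phi>. l2_norm M (\<lambda>x. f x - h x) < 1 / real (Suc n)"
      using that by (auto simp: l2_closure_def)
    then obtain h where h: "\<And>n. h n \<in> lin_span \<phi>" "\<And>n. l2_norm M (\<lambda>x. f x - h n x) < 1 / real (Suc n)"
      by metis
    have hL2: "h n \<in> L2 M" for n
      using lin_span_L2[OF \<phi> h(1)] .
    have lim: "(\<lambda>n. l2_norm M (\<lambda>x. h n x - f x)) \<longlonglongrightarrow> 0"
    proof (rule Lim_null_comparison)
      show "\<forall>\<^sub>F n in sequentially. norm (l2_norm M (\<lambda>x. h n x - f x)) \<le> 1 / real (Suc n)"
        using h(2) by (simp add: l2_norm_minus_commute[of M f] less_imp_le)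
      show "(\<lambda>n. 1 / real (Suc n)) \<longlonglongrightarrow> 0"
        by (rule LIMSEQ_Suc[OF lim_1_over_n])
    qed
    have coeff: "(\<lambda>n. l2_inner M (h n) (\<phi> j)) \<longlonglongrightarrow> l2_inner M f (\<phi> j)" for j
      by (rule tendsto_l2_inner[OF hL2 f lim \<phi> \<phi>]) (simp add: l2_norm_def)
    have norm: "(\<lambda>n. (l2_norm M (h n))\<^sup>2) \<longlonglongrightarrow> (l2_norm M f)\<^sup>2"
      by (intro tendsto_power tendsto_l2_norm[OF hL2 f lim])
    have R: "((\<lambda>(n, m). (l2_norm M (\<lambda>x. h n x - h m x))\<^sup>2) \<longlongrightarrow> 0) (sequentially \<times>\<^sub>F sequentially)"
    proof (rule Lim_null_comparison)
      have "(\<lambda>x. h n x - h m x) = (\<lambda>x. (h n x - f x) + - 1 * (h m x - f x))" for n m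
        by auto
      then have "l2_norm M (\<lambda>x. h n x - h m x) \<le> l2_norm M (\<lambda>x. h n x - f x) + l2_norm M (\<lambda>x. h m x - f x)" for n m
        using l2_norm_triangle[OF L2_diff[OF hL2[of n] f] L2_cmult[OF L2_diff[OF hL2[of m] f], of "-1"]]
          l2_norm_cmult[of M "-1" "\<lambda>x. h m x - f x"] by simp
      then show "\<forall>\<^sub>F p in sequentially \<times>\<^sub>F sequentially. norm (case p of (n, m) \<Rightarrow> (l2_norm M (\<lambda>x. h n x - h m x))\<^sup>2)
          \<le> (l2_norm M (\<lambda>x. h (fst p) x - f x) + l2_norm M (\<lambda>x. h (snd p) x - f x))\<^sup>2"
        by (intro always_eventually) (auto intro!: power_mono)
      show "((\<lambda>p. (l2_norm M (\<lambda>x. h (fst p) x - f x) + l2_norm M (\<lambda>x. h (snd p) x - f x))\<^sup>2) \<longlongrightarrow> 0)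
          (sequentially \<times>\<^sub>F sequentially)"
        using filterlim_compose[OF lim filterlim_fst] filterlim_compose[OF lim filterlim_snd]
        by (auto intro!: tendsto_eq_intros)
    qed
    have lower: "ennreal (A * (l2_norm M (h n))\<^sup>2)
          \<le> (\<integral>\<^sup>+j. ennreal ((cmod (l2_inner M (h n) (\<phi> j)))\<^sup>2) \<partial>count_space UNIV)"
      and upper: "(\<integral>\<^sup>+j. ennreal ((cmod (l2_inner M (h n) (\<phi> j)))\<^sup>2) \<partial>count_space UNIV)
          \<le> ennreal (B * (l2_norm M (h n))\<^sup>2)" for n
      using P h(1) by auto
    have diff: "(\<integral>\<^sup>+j. ennreal ((cmod (l2_inner M (h n) (\<phi> j) - l2_inner M (h m) (\<phi> j)))\<^sup>2) \<partial>count_space UNIV)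
          \<le> ennreal (B * (l2_norm M (\<lambda>x. h n x - h m x))\<^sup>2)" for n m
      using P lin_span_diff[OF h(1) h(1), of n m] by (simp add: l2_inner_diff_left[OF hL2 hL2 \<phi>, symmetric])
    show "?P f"
      using frame_inequalities_limit[OF coeff norm R lower upper diff AB(2)] by simp
  qed
  then show "frame_sequence M \<phi> A B"
    using AB \<phi> by (simp add: frame_sequence_def infsum_eq_nn_integral_count_space)
qed

lemma frame_sequence_reindex:
  fixes \<phi> :: "'i::countable \<Rightarrow> 'a \<Rightarrow> complex" and \<pi> :: "'j::countable \<Rightarrow> 'i"
  assumes "bij \<pi>"
  shows "frame_sequence M (\<lambda>j. \<phi> (\<pi> j)) A B \<longleftrightarrow> frame_sequence M \<phi> A B"
proof -
  have inj: "inj \<pi>" and surj: "surj \<pi>"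
    using assms by (auto simp: bij_def)
  have "lin_span (\<lambda>j. \<phi> (\<pi> j)) = lin_span \<phi>"
  proof (intro equalityI subsetI)
    fix f assume "f \<in> lin_span (\<lambda>j. \<phi> (\<pi> j))"
    then obtain J c where "finite J" "f = (\<lambda>x. \<Sum>j\<in>J. c j * \<phi> (\<pi> j) x)"
      by (auto simp: lin_span_def)
    then have "finite (\<pi> ` J)" "f = (\<lambda>x. \<Sum>i\<in>\<pi> ` J. c (inv \<pi> i) * \<phi> i x)"
      by (auto simp: sum.reindex inj_on_subset[OF inj] inv_f_f[OF inj])
    then show "f \<in> lin_span \<phi>"
      using lin_spanI[of "\<pi> ` J" "\<lambda>i. c (inv \<pi> i)" \<phi>] by simp
  next
    fix f assume "f \<in> lin_span \<phi>"
    then obtain J c where "finite J" "f = (\<lambda>x. \<Sum>i\<in>J. c i * \<phi> i x)"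
      by (auto simp: lin_span_def)
    then have "finite (inv \<pi> ` J)" "f = (\<lambda>x. \<Sum>j\<in>inv \<pi> ` J. c (\<pi> j) * \<phi> (\<pi> j) x)"
      by (auto simp: sum.reindex inj_on_inv_into surj surj_f_inv_f[OF surj])
    then show "f \<in> lin_span (\<lambda>j. \<phi> (\<pi> j))"
      using lin_spanI[of "inv \<pi> ` J" "\<lambda>j. c (\<pi> j)" "\<lambda>j. \<phi> (\<pi> j)"] by simp
  qed
  moreover have "(\<Sum>\<^sub>\<infinity>j. ennreal ((cmod (l2_inner M f (\<phi> (\<pi> j))))\<^sup>2)) = (\<Sum>\<^sub>\<infinity>i. ennreal ((cmod (l2_inner M f (\<phi> i)))\<^sup>2))" for f
    using assms by (rule infsum_reindex_bij_betw)
  moreover have "(\<forall>j. \<phi> (\<pi> j) \<in> L2 M) \<longleftrightarrow> (\<forall>i. \<phi> i \<in> L2 M)"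
    using surj by (metis surj_f_inv_f)
  ultimately show ?thesis
    unfolding frame_sequence_def by simp
qed

section \<open>Fibrewise frame inequalities\<close>

text \<open>If \<open>W p q x\<close> is the inner product of vectors \<open>v\<^sub>p\<close> and \<open>v\<^sub>q\<close> of a Hilbert space attached to \<open>x\<close>, then \<open>fiber_form\<close>
  is the squared norm of \<open>\<Sum>\<^sub>p \<alpha>\<^sub>p v\<^sub>p\<close> and \<open>fiber_coeff\<close> is its inner product with \<open>v\<^sub>q\<close>.\<close>

definition fiber_form :: "('p \<Rightarrow> 'p \<Rightarrow> real \<Rightarrow> complex) \<Rightarrow> 'p set \<Rightarrow> ('p \<Rightarrow> complex) \<Rightarrow> real \<Rightarrow> real" where
  "fiber_form W F \<alpha> x = Re (\<Sum>p\<in>F. \<Sum>q\<in>F. \<alpha> p * cnj (\<alpha> q) * W p q x)"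

definition fiber_coeff :: "('p \<Rightarrow> 'p \<Rightarrow> real \<Rightarrow> complex) \<Rightarrow> 'p set \<Rightarrow> ('p \<Rightarrow> complex) \<Rightarrow> 'p \<Rightarrow> real \<Rightarrow> complex" where
  "fiber_coeff W F \<alpha> q x = (\<Sum>p\<in>F. \<alpha> p * W p q x)"

lemma fiber_form_scale: "fiber_form W F (\<lambda>p. \<alpha> p * c) x = (cmod c)\<^sup>2 * fiber_form W F \<alpha> x"
proof -
  have "(\<Sum>p\<in>F. \<Sum>q\<in>F. \<alpha> p * c * cnj (\<alpha> q * c) * W p q x)
      = complex_of_real ((cmod c)\<^sup>2) * (\<Sum>p\<in>F. \<Sum>q\<in>F. \<alpha> p * cnj (\<alpha> q) * W p q x)"
    unfolding complex_norm_square sum_distrib_left by (intro sum.cong refl) (simp add: mult_ac)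
  moreover have "Re (complex_of_real r * z) = r * Re z" for r z
    by simp
  ultimately show ?thesis
    unfolding fiber_form_def by (simp only:)
qed

lemma fiber_coeff_scale: "fiber_coeff W F (\<lambda>p. \<alpha> p * c) q x = c * fiber_coeff W F \<alpha> q x"
  by (simp add: fiber_coeff_def sum_distrib_left mult_ac)

lemma fiber_coeff_diff:
  "fiber_coeff W F (\<lambda>p. \<alpha> p - \<beta> p) q x = fiber_coeff W F \<alpha> q x - fiber_coeff W F \<beta> q x"
  by (simp add: fiber_coeff_def left_diff_distrib sum_subtractf)

lemma tendsto_fiber_coeff:
  "(\<And>p. ((\<lambda>n. \<alpha> n p) \<longlongrightarrow> \<beta> p) G) \<Longrightarrow> ((\<lambda>n. fiber_coeff W F (\<alpha> n) q x) \<longlongrightarrow> fiber_coeff W F \<beta> q x) G"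
  unfolding fiber_coeff_def by (intro tendsto_intros)

lemma tendsto_fiber_form:
  "(\<And>p. ((\<lambda>n. \<alpha> n p) \<longlongrightarrow> \<beta> p) G) \<Longrightarrow> ((\<lambda>n. fiber_form W F (\<alpha> n) x) \<longlongrightarrow> fiber_form W F \<beta> x) G"
  unfolding fiber_form_def by (intro tendsto_intros)

text \<open>Squared moduli of trigonometric polynomials approximate indicator functions, so they
  detect the sign of an integrable function.\<close>

lemma AE_nonneg_if_trig_poly_integrals_nonneg:
  fixes D :: "real \<Rightarrow> real"
  assumes D: "integrable unit_interval D"
    and nonneg: "\<And>p. trig_poly p \<Longrightarrow> 0 \<le> (\<integral>x. (cmod (p x))\<^sup>2 * D x \<partial>unit_interval)"
  shows "AE x in unit_interval. 0 \<le> D x"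
proof -
  let ?I = unit_interval
  have [measurable]: "D \<in> borel_measurable ?I"
    using D by simp
  define h where "h x = (if D x < 0 then 1 else 0 :: complex)" for x
  have h: "h \<in> borel_measurable ?I"
    unfolding h_def by measurable
  have h_le: "cmod (h x) \<le> 1" for x
    by (simp add: h_def)
  obtain p where p: "\<And>k. trig_poly (p k)" "\<And>k x. x \<in> {0<..1} \<Longrightarrow> cmod (p k x) \<le> 1 + 2"
    "AE x in ?I. (\<lambda>k. p k x) \<longlonglongrightarrow> h x"
    using bounded_measurable_limit_of_trig_polys[OF h h_le] by blast
  have [measurable]: "p k \<in> borel_measurable ?I" for k
    using p(1) by (rule borel_measurable_trig_poly)
  have "(\<lambda>k. \<integral>x. (cmod (p k x))\<^sup>2 * D x \<partial>?I) \<longlonglongrightarrow> (\<integral>x. (cmod (h x))\<^sup>2 * D x \<partial>?I)"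
  proof (rule integral_dominated_convergence)
    show "integrable ?I (\<lambda>x. 9 * \<bar>D x\<bar>)"
      using D by simp
    show "AE x in ?I. (\<lambda>k. (cmod (p k x))\<^sup>2 * D x) \<longlonglongrightarrow> (cmod (h x))\<^sup>2 * D x"
      using p(3) by eventually_elim (intro tendsto_intros)
    show "AE x in ?I. norm ((cmod (p k x))\<^sup>2 * D x) \<le> 9 * \<bar>D x\<bar>" for k
    proof (rule AE_I2)
      fix x assume "x \<in> space ?I"
      then have "(cmod (p k x))\<^sup>2 \<le> 3\<^sup>2"
        using p(2)[of x k] by (intro power_mono) (auto simp: space_restrict_space)
      then show "norm ((cmod (p k x))\<^sup>2 * D x) \<le> 9 * \<bar>D x\<bar>"
        by (simp add: abs_mult mult_right_mono)
    qed
  qed (use h in measurable)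
  then have "0 \<le> (\<integral>x. (cmod (h x))\<^sup>2 * D x \<partial>?I)"
    by (rule LIMSEQ_le_const) (use nonneg p(1) in auto)
  moreover have "(\<integral>x. (cmod (h x))\<^sup>2 * D x \<partial>?I) = - (\<integral>x. max 0 (- D x) \<partial>?I)"
    unfolding Bochner_Integration.integral_minus[symmetric]
    by (intro Bochner_Integration.integral_cong) (auto simp: h_def)
  moreover have "0 \<le> (\<integral>x. max 0 (- D x) \<partial>?I)"
    by (intro integral_nonneg_AE) simp
  ultimately have "(\<integral>x. max 0 (- D x) \<partial>?I) = 0"
    by simp
  moreover have "integrable ?I (\<lambda>x. max 0 (- D x))"
    using D by (intro integrable_max) simp_all
  ultimately have "AE x in ?I. max 0 (- D x) = 0"
    by (subst (asm) integral_nonneg_eq_0_iff_AE) auto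
  then show ?thesis
    by eventually_elim auto
qed

text \<open>A system indexed by \<open>p\<close> and an integer \<open>m\<close> whose Gram matrix depends on the integers through their
  difference only, with the function \<open>W p q\<close> on the unit interval as symbol.\<close>

context
  fixes M :: "'a measure" and \<phi> :: "'p::countable \<times> int \<Rightarrow> 'a \<Rightarrow> complex" and W :: "'p \<Rightarrow> 'p \<Rightarrow> real \<Rightarrow> complex"
  assumes \<phi>: "\<And>j. \<phi> j \<in> L2 M"
    and W: "\<And>p q. integrable unit_interval (W p q)"
    and gram: "\<And>p m q n. l2_inner M (\<phi> (p, m)) (\<phi> (q, n))
      = (\<integral>x. cis (2 * pi * of_int (m - n) * x) * W p q x \<partial>unit_interval)"
    and pos: "AE x in unit_interval. \<forall>F \<alpha>. finite F \<longrightarrow> 0 \<le> fiber_form W F \<alpha> x"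
begin

lemma integrable_cis_mult: "integrable unit_interval (\<lambda>x. cis (2 * pi * of_int m * x) * W p q x)"
  using integrable_mult_bounded[OF W[of p q], of "\<lambda>x. cis (2 * pi * of_int m * x)" 1]
  by (simp add: borel_measurable_unit_interval mult.commute)

lemma
  fixes c :: "'p \<Rightarrow> int \<Rightarrow> complex" and K :: "int set"
  defines "a \<equiv> \<lambda>p x. \<Sum>m\<in>K. c p m * cis (2 * pi * of_int m * x)"
  shows integrable_fiber_coeff: "integrable unit_interval (\<lambda>x. fiber_coeff W F (\<lambda>p. a p x) q x)"
    and l2_inner_combination: "l2_inner M (\<lambda>z. \<Sum>p\<in>F. \<Sum>m\<in>K. c p m * \<phi> (p, m) z) (\<phi> (q, n))
      = fourier_coeff (\<lambda>x. fiber_coeff W F (\<lambda>p. a p x) q x) n"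
    and integrable_fiber_form: "integrable unit_interval (\<lambda>x. fiber_form W F (\<lambda>p. a p x) x)"
    and l2_norm_combination: "(l2_norm M (\<lambda>z. \<Sum>p\<in>F. \<Sum>m\<in>K. c p m * \<phi> (p, m) z))\<^sup>2
      = (\<integral>x. fiber_form W F (\<lambda>p. a p x) x \<partial>unit_interval)"
proof -
  let ?h = "\<lambda>z. \<Sum>p\<in>F. \<Sum>m\<in>K. c p m * \<phi> (p, m) z"
  let ?e = "\<lambda>m x. cis (2 * pi * of_int m * x)"
  have h_eq: "?h = (\<lambda>z. \<Sum>j\<in>F \<times> K. (case j of (p, m) \<Rightarrow> c p m) * \<phi> j z)"
    by (simp add: sum.cartesian_product case_prod_beta')
  have coeff: "fiber_coeff W F (\<lambda>p. a p x) q x = (\<Sum>p\<in>F. \<Sum>m\<in>K. c p m * (?e m x * W p q x))" for q x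
    unfolding fiber_coeff_def a_def by (simp add: sum_distrib_right mult.assoc)
  show "integrable unit_interval (\<lambda>x. fiber_coeff W F (\<lambda>p. a p x) q x)"
    unfolding coeff by (intro Bochner_Integration.integrable_sum integrable_mult_right integrable_cis_mult)
  define V where "V k p q x = ?e k x * W p q x" for k p q x
  have V: "integrable unit_interval (V k p q)" for k p q
    unfolding V_def[abs_def] by (rule integrable_cis_mult)
  have gram': "l2_inner M (\<phi> j) (\<phi> (q, n)) = (\<integral>x. V (snd j - n) (fst j) q x \<partial>unit_interval)" for j q n
    by (cases j) (simp only: gram fst_conv snd_conv V_def)
  have inner: "l2_inner M ?h (\<phi> (q, n)) = (\<Sum>p\<in>F. \<Sum>m\<in>K. c p m * (\<integral>x. V (m - n) p q x \<partial>unit_interval))" for q n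
    unfolding h_eq by (subst l2_inner_sum_left[OF \<phi> \<phi>]) (simp add: gram' sum.cartesian_product case_prod_beta')
  have shift: "fiber_coeff W F (\<lambda>p. a p x) q x * cis (- (2 * pi * of_int n * x))
      = (\<Sum>p\<in>F. \<Sum>m\<in>K. c p m * V (m - n) p q x)" for x q n
    unfolding coeff sum_distrib_right
  proof (intro sum.cong refl)
    fix p m
    have "?e (m - n) x = ?e m x * cis (- (2 * pi * of_int n * x))"
      by (simp add: cis_mult algebra_simps)
    then show "c p m * (?e m x * W p q x) * cis (- (2 * pi * of_int n * x)) = c p m * V (m - n) p q x"
      by (simp add: V_def mult_ac)
  qed
  show "l2_inner M ?h (\<phi> (q, n)) = fourier_coeff (\<lambda>x. fiber_coeff W F (\<lambda>p. a p x) q x) n"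
    unfolding inner fourier_coeff_def shift
    by (simp add: V)
  have form: "(\<Sum>p\<in>F. \<Sum>q\<in>F. a p x * cnj (a q x) * W p q x)
      = (\<Sum>q\<in>F. \<Sum>n\<in>K. cnj (c q n) * (\<Sum>p\<in>F. \<Sum>m\<in>K. c p m * V (m - n) p q x))" for x
  proof -
    have "(\<Sum>p\<in>F. \<Sum>q\<in>F. a p x * cnj (a q x) * W p q x)
        = (\<Sum>q\<in>F. cnj (a q x) * fiber_coeff W F (\<lambda>p. a p x) q x)"
      unfolding fiber_coeff_def sum_distrib_left
      by (subst sum.swap) (simp add: mult_ac)
    also have "\<dots> = (\<Sum>q\<in>F. \<Sum>n\<in>K. cnj (c q n) * (fiber_coeff W F (\<lambda>p. a p x) q x * cis (- (2 * pi * of_int n * x))))"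
      by (subst (1) a_def) (simp add: sum_distrib_left cis_cnj mult_ac)
    finally show ?thesis
      unfolding shift .
  qed
  have int: "integrable unit_interval (\<lambda>x. \<Sum>q\<in>F. \<Sum>n\<in>K. cnj (c q n) * (\<Sum>p\<in>F. \<Sum>m\<in>K. c p m * V (m - n) p q x))"
    by (intro Bochner_Integration.integrable_sum integrable_mult_right V)
  show "integrable unit_interval (\<lambda>x. fiber_form W F (\<lambda>p. a p x) x)"
    unfolding fiber_form_def form by (intro integrable_Re int)
  have "l2_inner M ?h ?h = (\<Sum>q\<in>F. \<Sum>n\<in>K. cnj (c q n) * l2_inner M ?h (\<phi> (q, n)))"
    by (subst (2) h_eq, subst l2_inner_sum_right[OF \<phi>])
      (auto simp: sum.cartesian_product case_prod_beta' intro!: L2_sum L2_cmult \<phi>)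
  also have "\<dots> = (\<integral>x. (\<Sum>q\<in>F. \<Sum>n\<in>K. cnj (c q n) * (\<Sum>p\<in>F. \<Sum>m\<in>K. c p m * V (m - n) p q x)) \<partial>unit_interval)"
    unfolding inner by (simp add: V)
  finally have "complex_of_real ((l2_norm M ?h)\<^sup>2)
      = (\<integral>x. (\<Sum>q\<in>F. \<Sum>n\<in>K. cnj (c q n) * (\<Sum>p\<in>F. \<Sum>m\<in>K. c p m * V (m - n) p q x)) \<partial>unit_interval)"
    unfolding l2_inner_self .
  then have "(l2_norm M ?h)\<^sup>2
      = Re (\<integral>x. (\<Sum>q\<in>F. \<Sum>n\<in>K. cnj (c q n) * (\<Sum>p\<in>F. \<Sum>m\<in>K. c p m * V (m - n) p q x)) \<partial>unit_interval)"
    by (metis Re_complex_of_real)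
  then show "(l2_norm M ?h)\<^sup>2 = (\<integral>x. fiber_form W F (\<lambda>p. a p x) x \<partial>unit_interval)"
    unfolding fiber_form_def form by (simp only: integral_Re[OF int])
qed

text \<open>Parseval's identity for each \<open>q\<close> separately, summed over \<open>q\<close>.\<close>

lemma nn_integral_fiber_coeff:
  fixes c :: "'p \<Rightarrow> int \<Rightarrow> complex" and K :: "int set"
  shows "(\<integral>\<^sup>+j. ennreal ((cmod (l2_inner M (\<lambda>z. \<Sum>p\<in>F. \<Sum>m\<in>K. c p m * \<phi> (p, m) z) (\<phi> j)))\<^sup>2) \<partial>count_space UNIV)
    = (\<integral>\<^sup>+x. (\<integral>\<^sup>+q. ennreal ((cmod (fiber_coeff W F (\<lambda>p. \<Sum>m\<in>K. c p m * cis (2 * pi * of_int m * x)) q x))\<^sup>2)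
        \<partial>count_space UNIV) \<partial>unit_interval)"
proof -
  let ?P = "\<lambda>q x. fiber_coeff W F (\<lambda>p. \<Sum>m\<in>K. c p m * cis (2 * pi * of_int m * x)) q x"
  have [measurable]: "?P q \<in> borel_measurable unit_interval" for q
    by (rule borel_measurable_integrable[OF integrable_fiber_coeff])
  have "(\<integral>\<^sup>+j. ennreal ((cmod (l2_inner M (\<lambda>z. \<Sum>p\<in>F. \<Sum>m\<in>K. c p m * \<phi> (p, m) z) (\<phi> j)))\<^sup>2) \<partial>count_space UNIV)
      = (\<integral>\<^sup>+q. (\<integral>\<^sup>+n. ennreal ((cmod (fourier_coeff (?P q) n))\<^sup>2) \<partial>count_space UNIV) \<partial>count_space UNIV)"
    by (subst nn_integral_fst_count_space[symmetric]) (simp add: l2_inner_combination)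
  also have "\<dots> = (\<integral>\<^sup>+q. (\<integral>\<^sup>+x. ennreal ((cmod (?P q x))\<^sup>2) \<partial>unit_interval) \<partial>count_space UNIV)"
    by (intro nn_integral_cong Parseval_unit_interval integrable_fiber_coeff)
  also have "\<dots> = (\<integral>\<^sup>+x. (\<integral>\<^sup>+q. ennreal ((cmod (?P q x))\<^sup>2) \<partial>count_space UNIV) \<partial>unit_interval)"
    by (intro nn_integral_count_space_nn_integral[symmetric]) measurable
  finally show ?thesis .
qed

text \<open>Testing the frame inequalities on \<open>\<alpha>\<close> times a trigonometric polynomial \<open>t\<close> integrates the fibre
  inequalities for \<open>\<alpha>\<close> against the weight \<open>\<bar>t\<bar>\<^sup>2\<close>. With \<open>t = 1\<close> the upper bound makes the sum of
  squared coefficients integrable.\<close>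

lemma fiber_inequalities_if_frame_inequalities:
  assumes AB: "0 < A" "0 < B" and fs: "frame_sequence M \<phi> A B" and F: "finite F"
  shows "AE x in unit_interval. ennreal (A * fiber_form W F \<alpha> x)
        \<le> (\<integral>\<^sup>+q. ennreal ((cmod (fiber_coeff W F \<alpha> q x))\<^sup>2) \<partial>count_space UNIV) \<and>
      (\<integral>\<^sup>+q. ennreal ((cmod (fiber_coeff W F \<alpha> q x))\<^sup>2) \<partial>count_space UNIV) \<le> ennreal (B * fiber_form W F \<alpha> x)"
proof -
  let ?I = unit_interval
  define N where "N x = (\<integral>\<^sup>+q. ennreal ((cmod (fiber_coeff W F \<alpha> q x))\<^sup>2) \<partial>count_space UNIV)" for x
  define Q where "Q x = fiber_form W F \<alpha> x" for x
  have fs': "\<And>h. h \<in> lin_span \<phi> \<Longrightarrow>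
      ennreal (A * (l2_norm M h)\<^sup>2) \<le> (\<integral>\<^sup>+j. ennreal ((cmod (l2_inner M h (\<phi> j)))\<^sup>2) \<partial>count_space UNIV) \<and>
      (\<integral>\<^sup>+j. ennreal ((cmod (l2_inner M h (\<phi> j)))\<^sup>2) \<partial>count_space UNIV) \<le> ennreal (B * (l2_norm M h)\<^sup>2)"
    using fs frame_sequence_iff_lin_span[of \<phi> M, OF \<phi> AB] by blast
  have weighted: "integrable ?I (\<lambda>x. (cmod (t x))\<^sup>2 * Q x) \<and>
      ennreal (A * (\<integral>x. (cmod (t x))\<^sup>2 * Q x \<partial>?I)) \<le> (\<integral>\<^sup>+x. ennreal ((cmod (t x))\<^sup>2) * N x \<partial>?I) \<and>
      (\<integral>\<^sup>+x. ennreal ((cmod (t x))\<^sup>2) * N x \<partial>?I) \<le> ennreal (B * (\<integral>x. (cmod (t x))\<^sup>2 * Q x \<partial>?I))"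
    if t_poly: "trig_poly t" for t
  proof -
    obtain K d where K: "finite K" and t: "t = (\<lambda>x. \<Sum>m\<in>K. d m * cis (2 * pi * of_int m * x))"
      using t_poly by (rule trig_polyE)
    let ?c = "\<lambda>p m. \<alpha> p * d m"
    let ?h = "\<lambda>z. \<Sum>p\<in>F. \<Sum>m\<in>K. ?c p m * \<phi> (p, m) z"
    have a: "(\<Sum>m\<in>K. ?c p m * cis (2 * pi * of_int m * x)) = \<alpha> p * t x" for p x
      by (simp add: t sum_distrib_left mult.assoc)
    have "?h = (\<lambda>z. \<Sum>j\<in>F \<times> K. (case j of (p, m) \<Rightarrow> ?c p m) * \<phi> j z)"
      by (simp add: sum.cartesian_product case_prod_beta')
    then have "?h \<in> lin_span \<phi>"
      using F K lin_spanI[of "F \<times> K" "\<lambda>(p, m). ?c p m" \<phi>] by simp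
    note ineq = fs'[OF this]
    have norm: "(l2_norm M ?h)\<^sup>2 = (\<integral>x. (cmod (t x))\<^sup>2 * Q x \<partial>?I)"
      unfolding l2_norm_combination a fiber_form_scale Q_def ..
    have coeff: "(\<integral>\<^sup>+j. ennreal ((cmod (l2_inner M ?h (\<phi> j)))\<^sup>2) \<partial>count_space UNIV) = (\<integral>\<^sup>+x. ennreal ((cmod (t x))\<^sup>2) * N x \<partial>?I)"
      unfolding nn_integral_fiber_coeff a fiber_coeff_scale N_def
      by (simp add: norm_mult power_mult_distrib ennreal_mult nn_integral_cmult)
    have "integrable ?I (\<lambda>x. (cmod (t x))\<^sup>2 * Q x)"
      using integrable_fiber_form[where F = F and K = K and c = ?c] unfolding a fiber_form_scale Q_def .
    then show ?thesis
      using ineq unfolding norm coeff by blast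
  qed
  have [measurable]: "fiber_coeff W F \<alpha> q \<in> borel_measurable ?I" for q
    unfolding fiber_coeff_def[abs_def] using W by measurable
  have N_meas [measurable]: "N \<in> borel_measurable ?I"
    unfolding N_def nn_integral_count_space_eq_SUP by (intro borel_measurable_SUP countable_Collect_finite) measurable
  have Q_int: "integrable ?I Q"
    using weighted[OF trig_poly_const[of 1]] by simp
  have N_fin: "(\<integral>\<^sup>+x. N x \<partial>?I) < \<infinity>"
    using weighted[OF trig_poly_const[of 1]] by (auto intro: le_less_trans)
  define n where "n x = enn2real (N x)" for x
  have [measurable]: "n \<in> borel_measurable ?I"
    unfolding n_def by measurable
  have N_eq: "AE x in ?I. N x = ennreal (n x)"
    using nn_integral_PInf_AE[OF N_meas] N_fin by (auto simp: n_def less_top)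
  have n_int: "integrable ?I n"
  proof (rule integrableI_nonneg)
    have "(\<integral>\<^sup>+x. ennreal (n x) \<partial>?I) = (\<integral>\<^sup>+x. N x \<partial>?I)"
      using N_eq by (intro nn_integral_cong_AE) auto
    then show "(\<integral>\<^sup>+x. ennreal (n x) \<partial>?I) < \<infinity>"
      using N_fin by simp
  qed (auto simp: n_def)
  have real_weighted: "A * (\<integral>x. (cmod (t x))\<^sup>2 * Q x \<partial>?I) \<le> (\<integral>x. (cmod (t x))\<^sup>2 * n x \<partial>?I)"
    "(\<integral>x. (cmod (t x))\<^sup>2 * n x \<partial>?I) \<le> B * (\<integral>x. (cmod (t x))\<^sup>2 * Q x \<partial>?I)"
    "integrable ?I (\<lambda>x. (cmod (t x))\<^sup>2 * n x)" if t: "trig_poly t" for t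
  proof -
    have [measurable]: "t \<in> borel_measurable ?I"
      using t by (rule borel_measurable_trig_poly)
    have eq: "(\<integral>\<^sup>+x. ennreal ((cmod (t x))\<^sup>2) * N x \<partial>?I) = (\<integral>\<^sup>+x. ennreal ((cmod (t x))\<^sup>2 * n x) \<partial>?I)"
      using N_eq by (intro nn_integral_cong_AE) (auto simp: ennreal_mult n_def)
    show int: "integrable ?I (\<lambda>x. (cmod (t x))\<^sup>2 * n x)"
    proof (rule integrableI_nonneg)
      show "(\<integral>\<^sup>+x. ennreal ((cmod (t x))\<^sup>2 * n x) \<partial>?I) < \<infinity>"
        using weighted[OF t] unfolding eq by (auto intro: le_less_trans)
    qed (auto simp: n_def)
    have "(\<integral>\<^sup>+x. ennreal ((cmod (t x))\<^sup>2 * n x) \<partial>?I) = ennreal (\<integral>x. (cmod (t x))\<^sup>2 * n x \<partial>?I)"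
      using int by (intro nn_integral_eq_integral) (auto simp: n_def)
    moreover have "0 \<le> (\<integral>x. (cmod (t x))\<^sup>2 * n x \<partial>?I)"
      by (intro integral_nonneg_AE) (auto simp: n_def)
    moreover have "0 \<le> (\<integral>x. (cmod (t x))\<^sup>2 * Q x \<partial>?I)"
      using pos F by (intro integral_nonneg_AE) (auto simp: Q_def)
    ultimately show "A * (\<integral>x. (cmod (t x))\<^sup>2 * Q x \<partial>?I) \<le> (\<integral>x. (cmod (t x))\<^sup>2 * n x \<partial>?I)"
      "(\<integral>x. (cmod (t x))\<^sup>2 * n x \<partial>?I) \<le> B * (\<integral>x. (cmod (t x))\<^sup>2 * Q x \<partial>?I)"
      using weighted[OF t] AB unfolding eq by (auto simp: ennreal_le_iff)
  qed
  have "AE x in ?I. 0 \<le> n x - A * Q x"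
  proof (rule AE_nonneg_if_trig_poly_integrals_nonneg)
    fix t assume t: "trig_poly t"
    have "(\<integral>x. (cmod (t x))\<^sup>2 * (n x - A * Q x) \<partial>?I) = (\<integral>x. (cmod (t x))\<^sup>2 * n x - A * ((cmod (t x))\<^sup>2 * Q x) \<partial>?I)"
      by (simp add: algebra_simps)
    also have "\<dots> = (\<integral>x. (cmod (t x))\<^sup>2 * n x \<partial>?I) - A * (\<integral>x. (cmod (t x))\<^sup>2 * Q x \<partial>?I)"
      using real_weighted(3)[OF t] weighted[OF t] by simp
    finally show "0 \<le> (\<integral>x. (cmod (t x))\<^sup>2 * (n x - A * Q x) \<partial>?I)"
      using real_weighted(1)[OF t] by simp
  qed (use n_int Q_int in simp)
  moreover have "AE x in ?I. 0 \<le> B * Q x - n x"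
  proof (rule AE_nonneg_if_trig_poly_integrals_nonneg)
    fix t assume t: "trig_poly t"
    have "(\<integral>x. (cmod (t x))\<^sup>2 * (B * Q x - n x) \<partial>?I) = (\<integral>x. B * ((cmod (t x))\<^sup>2 * Q x) - (cmod (t x))\<^sup>2 * n x \<partial>?I)"
      by (simp add: algebra_simps)
    also have "\<dots> = B * (\<integral>x. (cmod (t x))\<^sup>2 * Q x \<partial>?I) - (\<integral>x. (cmod (t x))\<^sup>2 * n x \<partial>?I)"
      using real_weighted(3)[OF t] weighted[OF t] by simp
    finally show "0 \<le> (\<integral>x. (cmod (t x))\<^sup>2 * (B * Q x - n x) \<partial>?I)"
      using real_weighted(2)[OF t] by simp
  qed (use n_int Q_int in simp)
  ultimately show ?thesis
    using N_eq
  proof eventually_elim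
    case (elim x)
    then show ?case
      unfolding N_def[symmetric] Q_def[symmetric] by (simp add: ennreal_leI)
  qed
qed

text \<open>Here the coefficients of the test vector depend on the frequency \<open>x\<close>. The
  inequalities hold off one null set for the countably many values at rational points, and for
  their differences; these approximate the values at \<open>x\<close>.\<close>

lemma frame_inequalities_if_fiber_inequalities:
  assumes AB: "0 < A" "0 < B"
    and ineq: "\<And>F \<alpha>. finite F \<Longrightarrow> AE x in unit_interval. ennreal (A * fiber_form W F \<alpha> x)
        \<le> (\<integral>\<^sup>+q. ennreal ((cmod (fiber_coeff W F \<alpha> q x))\<^sup>2) \<partial>count_space UNIV) \<and>
      (\<integral>\<^sup>+q. ennreal ((cmod (fiber_coeff W F \<alpha> q x))\<^sup>2) \<partial>count_space UNIV) \<le> ennreal (B * fiber_form W F \<alpha> x)"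
  shows "frame_sequence M \<phi> A B"
  unfolding frame_sequence_iff_lin_span[OF \<phi> AB]
proof
  let ?I = unit_interval
  fix h assume "h \<in> lin_span \<phi>"
  then obtain J b where J: "finite J" and h: "h = (\<lambda>z. \<Sum>j\<in>J. b j * \<phi> j z)"
    by (auto simp: lin_span_def)
  define F where "F = fst ` J"
  define K where "K = snd ` J"
  define c where "c p m = (if (p, m) \<in> J then b (p, m) else 0)" for p m
  have F: "finite F"
    using J by (simp add: F_def)
  have h_eq: "h = (\<lambda>z. \<Sum>p\<in>F. \<Sum>m\<in>K. c p m * \<phi> (p, m) z)"
  proof
    fix z
    have "J \<subseteq> F \<times> K"
      by (force simp: F_def K_def)
    then have "(\<Sum>j\<in>J. b j * \<phi> j z) = (\<Sum>j\<in>F \<times> K. c (fst j) (snd j) * \<phi> j z)"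
      using J by (intro sum.mono_neutral_cong_left) (auto simp: c_def F_def K_def)
    then show "h z = (\<Sum>p\<in>F. \<Sum>m\<in>K. c p m * \<phi> (p, m) z)"
      by (simp add: h sum.cartesian_product case_prod_beta')
  qed
  define a where "a x p = (\<Sum>m\<in>K. c p m * cis (2 * pi * of_int m * x))" for x p
  let ?N = "\<lambda>\<alpha> x. \<integral>\<^sup>+q. ennreal ((cmod (fiber_coeff W F \<alpha> q x))\<^sup>2) \<partial>count_space UNIV"
  have rational: "AE x in ?I. \<forall>r\<in>\<rat>. \<forall>s\<in>\<rat>.
      (ennreal (A * fiber_form W F (a r) x) \<le> ?N (a r) x \<and> ?N (a r) x \<le> ennreal (B * fiber_form W F (a r) x)) \<and>
      ?N (\<lambda>p. a r p - a s p) x \<le> ennreal (B * fiber_form W F (\<lambda>p. a r p - a s p) x)"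
    using ineq[OF F] by (intro AE_ball_countable' AE_conjI countable_rat) auto
  have fiber: "AE x in ?I. ennreal (A * fiber_form W F (a x) x) \<le> ?N (a x) x \<and> ?N (a x) x \<le> ennreal (B * fiber_form W F (a x) x)"
    using rational
  proof eventually_elim
    case (elim x)
    have "x \<in> closure \<rat>"
      by (simp add: Rats_closure_real)
    then obtain r where r: "\<And>n. r n \<in> \<rat>" "r \<longlonglongrightarrow> x"
      unfolding closure_sequential by blast
    have lim: "(\<lambda>n. a (r n) p) \<longlonglongrightarrow> a x p" for p
      unfolding a_def by (intro tendsto_intros r)
    have "((\<lambda>nm. a (r (fst nm)) p - a (r (snd nm)) p) \<longlongrightarrow> a x p - a x p) (sequentially \<times>\<^sub>F sequentially)" for p
      by (intro tendsto_diff filterlim_compose[OF lim filterlim_fst] filterlim_compose[OF lim filterlim_snd])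
    then have "((\<lambda>nm. fiber_form W F (\<lambda>p. a (r (fst nm)) p - a (r (snd nm)) p) x) \<longlongrightarrow> fiber_form W F (\<lambda>p. 0) x)
        (sequentially \<times>\<^sub>F sequentially)"
      by (intro tendsto_fiber_form) simp
    then have diff: "((\<lambda>(n, m). fiber_form W F (\<lambda>p. a (r n) p - a (r m) p) x) \<longlongrightarrow> 0) (sequentially \<times>\<^sub>F sequentially)"
      by (simp add: case_prod_beta' fiber_form_def)
    have form: "(\<lambda>n. fiber_form W F (a (r n)) x) \<longlonglongrightarrow> fiber_form W F (a x) x"
      by (intro tendsto_fiber_form lim)
    have coeff: "(\<lambda>n. fiber_coeff W F (a (r n)) q x) \<longlonglongrightarrow> fiber_coeff W F (a x) q x" for q
      by (intro tendsto_fiber_coeff lim)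
    have lower: "ennreal (A * fiber_form W F (a (r n)) x) \<le> ?N (a (r n)) x"
      and upper: "?N (a (r n)) x \<le> ennreal (B * fiber_form W F (a (r n)) x)"
      and difference: "(\<integral>\<^sup>+q. ennreal ((cmod (fiber_coeff W F (a (r n)) q x - fiber_coeff W F (a (r m)) q x))\<^sup>2) \<partial>count_space UNIV)
        \<le> ennreal (B * fiber_form W F (\<lambda>p. a (r n) p - a (r m) p) x)" for n m
      using elim r(1) unfolding fiber_coeff_diff by blast+
    show ?case
      using frame_inequalities_limit[OF coeff form diff lower upper difference AB(2)] by (rule conjI)
  qed
  have form_nonneg: "AE x in ?I. 0 \<le> fiber_form W F (a x) x"
    using pos by eventually_elim (use F in auto)
  have form_int: "integrable ?I (\<lambda>x. fiber_form W F (a x) x)"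
    unfolding a_def by (rule integrable_fiber_form)
  have norm: "ennreal (C * (l2_norm M h)\<^sup>2) = (\<integral>\<^sup>+x. ennreal (C * fiber_form W F (a x) x) \<partial>?I)" if "0 < C" for C
  proof -
    have "(l2_norm M h)\<^sup>2 = (\<integral>x. fiber_form W F (a x) x \<partial>?I)"
      unfolding h_eq a_def by (rule l2_norm_combination)
    then show ?thesis
      using form_int form_nonneg that by (subst nn_integral_eq_integral) (auto elim: eventually_mono)
  qed
  have coeff: "(\<integral>\<^sup>+j. ennreal ((cmod (l2_inner M h (\<phi> j)))\<^sup>2) \<partial>count_space UNIV) = (\<integral>\<^sup>+x. ?N (a x) x \<partial>?I)"
    unfolding h_eq a_def by (rule nn_integral_fiber_coeff)
  show "ennreal (A * (l2_norm M h)\<^sup>2) \<le> (\<integral>\<^sup>+j. ennreal ((cmod (l2_inner M h (\<phi> j)))\<^sup>2) \<partial>count_space UNIV) \<and>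
      (\<integral>\<^sup>+j. ennreal ((cmod (l2_inner M h (\<phi> j)))\<^sup>2) \<partial>count_space UNIV) \<le> ennreal (B * (l2_norm M h)\<^sup>2)"
    unfolding norm[OF AB(1)] norm[OF AB(2)] coeff
    using fiber by (intro conjI nn_integral_mono_AE) auto
qed

theorem frame_sequence_iff_fiber_inequalities:
  assumes "0 < A" "0 < B"
  shows "frame_sequence M \<phi> A B \<longleftrightarrow> (\<forall>F \<alpha>. finite F \<longrightarrow>
    (AE x in unit_interval. ennreal (A * fiber_form W F \<alpha> x)
        \<le> (\<integral>\<^sup>+q. ennreal ((cmod (fiber_coeff W F \<alpha> q x))\<^sup>2) \<partial>count_space UNIV) \<and>
      (\<integral>\<^sup>+q. ennreal ((cmod (fiber_coeff W F \<alpha> q x))\<^sup>2) \<partial>count_space UNIV) \<le> ennreal (B * fiber_form W F \<alpha> x)))"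
  using fiber_inequalities_if_frame_inequalities[OF assms] frame_inequalities_if_fiber_inequalities[OF assms]
  by blast

end

section \<open>The system of lattice translates\<close>

lemma has_sum_finite_Times:
  fixes f :: "'p \<Rightarrow> 'r \<Rightarrow> complex"
  assumes "finite F" "\<And>p. p \<in> F \<Longrightarrow> (f p has_sum s p) UNIV"
  shows "((\<lambda>(p, r). f p r) has_sum (\<Sum>p\<in>F. s p)) (F \<times> UNIV)"
  using assms
proof (induction F rule: finite_induct)
  case (insert p F)
  have "((\<lambda>(p, r). f p r) has_sum s p) (Pair p ` UNIV)"
    using insert.prems[of p] by (subst has_sum_reindex) (auto simp: inj_on_def o_def)
  then have "((\<lambda>(p, r). f p r) has_sum (s p + (\<Sum>p\<in>F. s p))) (Pair p ` UNIV \<union> F \<times> UNIV)"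
    using insert by (intro has_sum_Un_disjoint) auto
  moreover have "Pair p ` UNIV \<union> F \<times> UNIV = insert p F \<times> (UNIV :: 'r set)"
    by auto
  ultimately show ?case
    using insert.hyps by simp
qed simp

lemma has_sum_finite_sum:
  fixes f :: "'p \<Rightarrow> 'r \<Rightarrow> complex"
  assumes "\<And>p. p \<in> F \<Longrightarrow> (f p has_sum s p) A"
  shows "((\<lambda>r. \<Sum>p\<in>F. f p r) has_sum (\<Sum>p\<in>F. s p)) A"
  using assms by (induction F rule: infinite_finite_induct) (auto intro: has_sum_add)

lemma infsum_ennreal_eq_of_has_sum:
  fixes f :: "'a \<Rightarrow> real"
  assumes "(f has_sum s) UNIV" "\<And>x. 0 \<le> f x"
  shows "(\<Sum>\<^sub>\<infinity>x. ennreal (f x)) = ennreal s"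
proof -
  have "ennreal (infsum f UNIV) = (SUP K\<in>{K. finite K \<and> K \<subseteq> UNIV}. ennreal (sum f K))"
    using assms by (intro infsum_nonneg_is_SUPREMUM_ennreal) (auto simp: summable_on_def)
  also have "\<dots> = (\<Sum>\<^sub>\<infinity>x. ennreal (f x))"
    using assms(2) by (subst nonneg_infsum_complete) (simp_all add: sum_ennreal)
  finally show ?thesis
    using infsumI[OF assms(1)] by simp
qed

lemma L2_twisted_translate:
  assumes F: "F \<in> L2 lborel"
  shows "twisted_translate w a F \<in> L2 lborel"
proof -
  obtain u v where a: "a = (u, v)" by (cases a)
  have [measurable]: "F \<in> borel_measurable borel"
    using F by (simp add: L2_def)
  have "(\<lambda>z::real \<times> real. cis (pi * w * (v * fst z - u * snd z))) \<in> borel_measurable (borel \<Otimes>\<^sub>M borel)"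
    by measurable
  then have m: "(\<lambda>z::real \<times> real. cis (pi * w * (v * fst z - u * snd z))) \<in> borel_measurable lborel"
    by (simp add: borel_prod)
  have "(\<integral>\<^sup>+z. ennreal ((cmod (F (z - (u, v))))\<^sup>2) \<partial>lborel) = (\<integral>\<^sup>+z. ennreal ((cmod (F z))\<^sup>2) \<partial>lborel)"
    by (rule nn_integral_lborel_shift) measurable
  then have "(\<lambda>z. F (z - (u, v))) \<in> L2 lborel"
    using F by (simp add: L2_iff_nn_integral)
  then have "(\<lambda>z. cis (pi * w * (v * fst z - u * snd z)) * F (z - (u, v))) \<in> L2 lborel"
    using m by (rule L2_bounded_mult) simp
  also have "(\<lambda>z. cis (pi * w * (v * fst z - u * snd z)) * F (z - (u, v))) = twisted_translate w a F"
    by (auto simp: a twisted_translate_def)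
  finally show ?thesis .
qed

text \<open>Substituting \<open>z + (u', v')\<close> for \<open>z\<close> removes the second translation at the cost of the phase
  by which a product of twisted translations differs from the twisted translation by the sum.\<close>

lemma l2_inner_twisted_translate:
  assumes [measurable]: "F \<in> borel_measurable borel"
  shows "l2_inner lborel (twisted_translate w (u, v) F) (twisted_translate w (u', v') F)
    = cis (pi * w * (v * u' - u * v')) * l2_inner lborel (twisted_translate w (u - u', v - v') F) F"
proof -
  have eq: "twisted_translate w (u, v) F z * cnj (twisted_translate w (u', v') F z)
      = cis (pi * w * (v * u' - u * v')) * (twisted_translate w (u - u', v - v') F (z - (u', v')) * cnj (F (z - (u', v'))))" for z
  proof (cases z)
    case (Pair x y)
    have "cis (pi * w * (v * x - u * y)) * cis (- (pi * w * (v' * x - u' * y)))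
        = cis (pi * w * (v * u' - u * v')) * cis (pi * w * ((v - v') * (x - u') - (u - u') * (y - v')))"
      unfolding cis_mult by (rule arg_cong[of _ _ cis]) (simp add: algebra_simps)
    then show ?thesis
      by (simp add: Pair twisted_translate_def cis_cnj mult_ac)
  qed
  have m: "(\<lambda>z. twisted_translate w (u - u', v - v') F z * cnj (F z)) \<in> borel_measurable borel"
  proof -
    have "(\<lambda>z::real \<times> real. cis (pi * w * ((v - v') * fst z - (u - u') * snd z))) \<in> borel_measurable (borel \<Otimes>\<^sub>M borel)"
      by measurable
    then have [measurable]: "(\<lambda>z::real \<times> real. cis (pi * w * ((v - v') * fst z - (u - u') * snd z))) \<in> borel_measurable borel"
      by (simp add: borel_prod)
    have "(\<lambda>z. cis (pi * w * ((v - v') * fst z - (u - u') * snd z)) * F (z - (u - u', v - v')) * cnj (F z)) \<in> borel_measurable borel"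
      by measurable
    then show ?thesis
      by (simp add: twisted_translate_def case_prod_beta' minus_prod_def)
  qed
  show ?thesis
    unfolding l2_inner_def eq
    using integral_lborel_shift[OF m, of "(u', v')"] by simp
qed

definition twisted_system :: "(heis \<Rightarrow> complex) \<Rightarrow> int \<times> int \<Rightarrow> real \<Rightarrow> real \<times> real \<Rightarrow> complex" where
  "twisted_system g p w = twisted_translate w (2 * of_int (fst p), of_int (snd p)) (inv_fourier_t g w)"

definition twisted_gram :: "(heis \<Rightarrow> complex) \<Rightarrow> int \<times> int \<Rightarrow> int \<times> int \<Rightarrow> real \<Rightarrow> complex" where
  "twisted_gram g p q w = l2_inner lborel (twisted_system g p w) (twisted_system g q w)"

definition periodised_gram :: "(heis \<Rightarrow> complex) \<Rightarrow> int \<times> int \<Rightarrow> int \<times> int \<Rightarrow> real \<Rightarrow> complex" where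
  "periodised_gram g p q x = (\<Sum>\<^sub>\<infinity>r::int. twisted_gram g p q (x - of_int r))"

lemma inv_fourier_t_L2:
  assumes "g \<in> L2 lborel"
  shows "(\<lambda>(x, y, w). inv_fourier_t g w (x, y)) \<in> L2 lborel"
  using is_inv_fourier_t_inv_fourier_t[OF assms] by (simp add: is_inv_fourier_t_def)

lemma borel_measurable_inv_fourier_t_slice:
  assumes "g \<in> L2 lborel"
  shows "inv_fourier_t g w \<in> borel_measurable borel"
proof -
  let ?G = "\<lambda>(x, y, w). inv_fourier_t g w (x, y)"
  have "?G \<in> borel_measurable (borel \<Otimes>\<^sub>M borel \<Otimes>\<^sub>M borel)"
    using inv_fourier_t_L2[OF assms] by (simp add: L2_def borel_prod)
  then have "(\<lambda>z. ?G (fst z, snd z, w)) \<in> borel_measurable (borel \<Otimes>\<^sub>M borel)"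
    by measurable
  then show ?thesis
    by (simp add: borel_prod)
qed

lemma AE_inv_fourier_t_slice_L2:
  assumes g: "g \<in> L2 lborel"
  shows "AE w in lborel. inv_fourier_t g w \<in> L2 lborel"
proof -
  let ?G = "\<lambda>(x, y, w). inv_fourier_t g w (x, y)"
  have "integrable lborel (\<lambda>p. ?G p * cnj (?G p))"
    by (intro integrable_mult_cnj inv_fourier_t_L2 g)
  from AE_integrable_frequency_slice[OF this]
  show ?thesis
  proof eventually_elim
    case (elim w)
    then have "integrable lborel (\<lambda>z. norm (inv_fourier_t g w z * cnj (inv_fourier_t g w z)))"
      by (intro integrable_norm) simp
    then show ?case
      using borel_measurable_inv_fourier_t_slice[OF g, of w] by (simp add: L2_def norm_mult power2_eq_square)
  qed
qed

lemma
  assumes g: "g \<in> L2 lborel"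
  shows integrable_twisted_gram: "integrable lborel (twisted_gram g p q)"
    and l2_inner_lattice_translates:
      "l2_inner lborel (heis_translate (2 * of_int (fst p), of_int (snd p), of_int m) g)
          (heis_translate (2 * of_int (fst q), of_int (snd q), of_int n) g)
        = (\<integral>w. cis (2 * pi * of_int (m - n) * w) * twisted_gram g p q w \<partial>lborel)"
proof -
  let ?G = "\<lambda>(x, y, w). inv_fourier_t g w (x, y)"
  let ?a = "\<lambda>p m. (2 * real_of_int (fst p), real_of_int (snd p), real_of_int m)"
  have slice: "fourier_translate (?a p m) ?G (fst z, snd z, w) = cis (2 * pi * w * of_int m) * twisted_system g p w z" for p m z w
    by (simp add: fourier_translate_def twisted_system_def)
  have prod: "fourier_translate (?a p m) ?G (fst z, snd z, w) * cnj (fourier_translate (?a q n) ?G (fst z, snd z, w))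
      = cis (2 * pi * of_int (m - n) * w) * (twisted_system g p w z * cnj (twisted_system g q w z))" for z w m n
  proof -
    have "cis (2 * pi * of_int (m - n) * w) = cis (2 * pi * w * of_int m) * cis (- (2 * pi * w * of_int n))"
      by (simp add: cis_mult algebra_simps)
    then show ?thesis
      unfolding slice by (simp add: cis_cnj mult_ac)
  qed
  have int: "integrable lborel (\<lambda>z. fourier_translate (?a p m) ?G z * cnj (fourier_translate (?a q n) ?G z))" for m n
    by (intro integrable_mult_cnj L2_fourier_translate inv_fourier_t_L2 g)
  show "integrable lborel (twisted_gram g p q)"
    using integrable_frequency_slices[OF int[of 0 0]] unfolding prod
    by (simp add: twisted_gram_def[abs_def] l2_inner_def)
  have "l2_inner lborel (heis_translate (?a p m) g) (heis_translate (?a q n) g)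
      = l2_inner lborel (fourier_translate (?a p m) ?G) (fourier_translate (?a q n) ?G)"
    by (rule l2_inner_heis_translate[OF g])
  also have "\<dots> = (\<integral>w. (\<integral>z. fourier_translate (?a p m) ?G (fst z, snd z, w) * cnj (fourier_translate (?a q n) ?G (fst z, snd z, w)) \<partial>lborel) \<partial>lborel)"
    unfolding l2_inner_def by (rule integral_frequency_slices[OF int, symmetric])
  finally show "l2_inner lborel (heis_translate (?a p m) g) (heis_translate (?a q n) g)
      = (\<integral>w. cis (2 * pi * of_int (m - n) * w) * twisted_gram g p q w \<partial>lborel)"
    unfolding prod by (simp add: twisted_gram_def l2_inner_def)
qed

lemma integrable_periodised_gram:
  "g \<in> L2 lborel \<Longrightarrow> integrable unit_interval (periodised_gram g p q)"
  unfolding periodised_gram_def[abs_def] by (intro integrable_periodisation integrable_twisted_gram)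

text \<open>The exponential has period one in \<open>w\<close>, so it can be taken out of the periodisation.\<close>

lemma gram_lattice_translates:
  assumes g: "g \<in> L2 lborel"
  shows "l2_inner lborel (heis_translate (2 * of_int (fst p), of_int (snd p), of_int m) g)
      (heis_translate (2 * of_int (fst q), of_int (snd q), of_int n) g)
    = (\<integral>x. cis (2 * pi * of_int (m - n) * x) * periodised_gram g p q x \<partial>unit_interval)"
proof -
  let ?e = "\<lambda>x. cis (2 * pi * of_int (m - n) * x)"
  have "integrable lborel (\<lambda>w. twisted_gram g p q w * ?e w)"
    by (rule integrable_mult_bounded[OF integrable_twisted_gram[OF g], of _ 1]) auto
  then have int: "integrable lborel (\<lambda>w. ?e w * twisted_gram g p q w)"
    by (simp add: mult.commute)
  have periodic: "?e (x - of_int r) = ?e x" for x r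
  proof -
    have "2 * pi * of_int (m - n) * (x - of_int r) = 2 * pi * of_int (m - n) * x + 2 * pi * of_int ((n - m) * r)"
      by (simp add: algebra_simps)
    then have "?e (x - of_int r) = ?e x * cis (2 * pi * of_int ((n - m) * r))"
      by (simp only: cis_mult)
    also have "cis (2 * pi * of_int ((n - m) * r)) = 1"
      by (rule cis_multiple_2pi) simp
    finally show ?thesis by simp
  qed
  show ?thesis
    unfolding l2_inner_lattice_translates[OF g] integral_periodisation[OF int, symmetric] periodic
    by (simp only: infsum_cmult_right' periodised_gram_def)
qed

lemma AE_unit_interval_shifts:
  assumes "AE w in lborel. P w"
  shows "AE x in unit_interval. \<forall>r::int. P (x - of_int r)"
proof -
  have "AE x in lborel. P (x - of_int r)" for r :: int
  proof -
    have "AE w in distr lborel borel ((+) (- of_int r :: real)). P w"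
      using assms by (subst lborel_distr_plus)
    then have "AE x in lborel. P (- of_int r + x)"
      by (rule AE_distrD[rotated]) simp
    then show ?thesis by simp
  qed
  then have "AE x in lborel. \<forall>r::int. P (x - of_int r)"
    by (simp add: AE_all_countable)
  then show ?thesis
    by (subst AE_restrict_space_iff) (auto elim: eventually_mono)
qed

text \<open>The exceptional null set of frequencies must serve all \<open>F\<close> and \<open>\<alpha>\<close> at once. It consists of those \<open>x\<close> for which some
  slice at \<open>x - r\<close> is not square integrable or one of the countably many periodisations diverges. For
  all other \<open>x\<close> the sums rearrange into the form and the coefficients of the fibre.\<close>

lemma AE_fiber_sums:
  assumes g: "g \<in> L2 lborel"
  shows "AE x in unit_interval. \<forall>F \<alpha>. finite F \<longrightarrow>
    0 \<le> fiber_form (periodised_gram g) F \<alpha> x \<and>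
    synthesis_sum g F \<alpha> x = ennreal (fiber_form (periodised_gram g) F \<alpha> x) \<and>
    analysis_sum g F \<alpha> x
      = (\<integral>\<^sup>+q. ennreal ((cmod (fiber_coeff (periodised_gram g) F \<alpha> q x))\<^sup>2) \<partial>count_space UNIV)"
proof -
  let ?W = "periodised_gram g"
  have "AE x in unit_interval. \<forall>p q. (\<lambda>r::int. twisted_gram g p q (x - of_int r)) summable_on UNIV"
    by (simp add: AE_all_countable AE_summable_periodisation integrable_twisted_gram[OF g])
  moreover have "AE x in unit_interval. \<forall>r::int. inv_fourier_t g (x - of_int r) \<in> L2 lborel"
    by (rule AE_unit_interval_shifts[OF AE_inv_fourier_t_slice_L2[OF g]])
  ultimately show ?thesis
  proof (eventually_elim, intro allI impI conjI)
    fix x :: real and F :: "(int \<times> int) set" and \<alpha> :: "int \<times> int \<Rightarrow> complex"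
    assume summable: "\<forall>p q. (\<lambda>r::int. twisted_gram g p q (x - of_int r)) summable_on UNIV"
      and slices: "\<forall>r::int. inv_fourier_t g (x - of_int r) \<in> L2 lborel" and F: "finite F"
    have has_sum: "((\<lambda>r::int. twisted_gram g p q (x - of_int r)) has_sum ?W p q x) UNIV" for p q
      unfolding periodised_gram_def using summable by (intro has_sum_infsum) blast
    have L2: "twisted_system g p (x - of_int r) \<in> L2 lborel" for p and r :: int
      unfolding twisted_system_def using slices by (intro L2_twisted_translate) blast
    let ?n = "\<lambda>r::int. (l2_norm lborel (\<lambda>z. \<Sum>p\<in>F. \<alpha> p * twisted_system g p (x - of_int r) z))\<^sup>2"
    have norm: "?n r = Re (\<Sum>p\<in>F. \<Sum>q\<in>F. \<alpha> p * cnj (\<alpha> q) * twisted_gram g p q (x - of_int r))" for r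
    proof -
      let ?h = "\<lambda>z. \<Sum>p\<in>F. \<alpha> p * twisted_system g p (x - of_int r) z"
      have h: "?h \<in> L2 lborel"
        by (intro L2_sum L2_cmult L2)
      have "complex_of_real (?n r) = (\<Sum>p\<in>F. \<alpha> p * l2_inner lborel (twisted_system g p (x - of_int r)) ?h)"
        unfolding l2_inner_self[symmetric] by (rule l2_inner_sum_left[OF L2 h])
      also have "\<dots> = (\<Sum>p\<in>F. \<Sum>q\<in>F. \<alpha> p * cnj (\<alpha> q) * twisted_gram g p q (x - of_int r))"
        by (simp add: l2_inner_sum_right[OF L2 L2] sum_distrib_left twisted_gram_def mult.assoc)
      finally show ?thesis
        by (metis Re_complex_of_real)
    qed
    have "((\<lambda>r. \<Sum>p\<in>F. \<Sum>q\<in>F. \<alpha> p * cnj (\<alpha> q) * twisted_gram g p q (x - of_int r))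
        has_sum (\<Sum>p\<in>F. \<Sum>q\<in>F. \<alpha> p * cnj (\<alpha> q) * ?W p q x)) UNIV"
      by (intro has_sum_finite_sum has_sum_cmult_right has_sum)
    then have sum_norm: "(?n has_sum fiber_form ?W F \<alpha> x) UNIV"
      unfolding norm fiber_form_def by (rule has_sum_Re)
    show "0 \<le> fiber_form ?W F \<alpha> x"
      using sum_norm by (rule has_sum_nonneg) simp
    have "synthesis_sum g F \<alpha> x = (\<Sum>\<^sub>\<infinity>r. ennreal (?n r))"
      unfolding synthesis_sum_def twisted_system_def by (simp add: case_prod_beta')
    then show "synthesis_sum g F \<alpha> x = ennreal (fiber_form ?W F \<alpha> x)"
      using infsum_ennreal_eq_of_has_sum[OF sum_norm] by simp
    have coeff: "(\<Sum>\<^sub>\<infinity>((k', l'), r)\<in>F \<times> (UNIV :: int set).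
           \<alpha> (k', l') * cis (2 * pi * (x - of_int r) * of_int (k * l' - l * k')) *
           l2_inner lborel
             (twisted_translate (x - of_int r) (2 * of_int (k' - k), of_int (l' - l)) (inv_fourier_t g (x - of_int r)))
             (inv_fourier_t g (x - of_int r)))
        = fiber_coeff ?W F \<alpha> (k, l) x" for k l
    proof -
      have summand: "\<alpha> p * cis (2 * pi * (x - of_int r) * of_int (k * snd p - l * fst p)) *
           l2_inner lborel
             (twisted_translate (x - of_int r) (2 * of_int (fst p - k), of_int (snd p - l)) (inv_fourier_t g (x - of_int r)))
             (inv_fourier_t g (x - of_int r))
          = \<alpha> p * twisted_gram g p (k, l) (x - of_int r)" for p and r :: int
      proof -
        have "pi * (x - of_int r) * (of_int (snd p) * (2 * of_int k) - 2 * of_int (fst p) * of_int l)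
            = 2 * pi * (x - of_int r) * of_int (k * snd p - l * fst p)"
          by (simp add: algebra_simps)
        then show ?thesis
          using l2_inner_twisted_translate[OF borel_measurable_inv_fourier_t_slice[OF g], of "x - of_int r"
              "2 * of_int (fst p)" "of_int (snd p)" "x - of_int r" "2 * of_int k" "of_int l"]
          by (simp add: twisted_gram_def twisted_system_def right_diff_distrib mult.assoc)
      qed
      have "((\<lambda>(p, r). \<alpha> p * twisted_gram g p (k, l) (x - of_int r)) has_sum (\<Sum>p\<in>F. \<alpha> p * ?W p (k, l) x)) (F \<times> (UNIV :: int set))"
        using F by (intro has_sum_finite_Times has_sum_cmult_right has_sum)
      then show ?thesis
        unfolding fiber_coeff_def summand[symmetric] by (simp add: case_prod_beta' infsumI)
    qed
    show "analysis_sum g F \<alpha> x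
        = (\<integral>\<^sup>+q. ennreal ((cmod (fiber_coeff ?W F \<alpha> q x))\<^sup>2) \<partial>count_space UNIV)"
      unfolding analysis_sum_def coeff infsum_eq_nn_integral_count_space by (simp add: case_prod_beta')
  qed
qed

theorem theorem3p1:
  fixes g :: "real \<times> real \<times> real \<Rightarrow> complex" and A B :: real
  assumes "g \<in> L2 lborel" and "0 < A" and "0 < B"
  shows "frame_sequence lborel
           (\<lambda>(k :: int, l :: int, m :: int). heis_translate (2 * real_of_int k, real_of_int l, real_of_int m) g) A B
     \<longleftrightarrow> (\<forall>(F :: (int \<times> int) set) (\<alpha> :: int \<times> int \<Rightarrow> complex). finite F \<longrightarrow>
           (AE w in lborel. w \<in> {0<..1} \<longrightarrow>
              ennreal A * synthesis_sum g F \<alpha> w \<le> analysis_sum g F \<alpha> w \<and>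
              analysis_sum g F \<alpha> w \<le> ennreal B * synthesis_sum g F \<alpha> w))"
proof -
  define \<phi> where "\<phi> = (\<lambda>(p, m). heis_translate (2 * real_of_int (fst p), real_of_int (snd p), real_of_int m) g)"
  let ?W = "periodised_gram g"
  have \<phi>: "\<phi> j \<in> L2 lborel" for j
    by (simp add: \<phi>_def case_prod_beta' L2_heis_translate assms(1))
  have W: "integrable unit_interval (?W p q)" for p q
    using assms(1) by (rule integrable_periodised_gram)
  have gram: "l2_inner lborel (\<phi> (p, m)) (\<phi> (q, n)) = (\<integral>x. cis (2 * pi * of_int (m - n) * x) * ?W p q x \<partial>unit_interval)" for p m q n
    unfolding \<phi>_def using gram_lattice_translates[OF assms(1)] by simp
  have pos: "AE x in unit_interval. \<forall>F \<alpha>. finite F \<longrightarrow> 0 \<le> fiber_form ?W F \<alpha> x"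
    using AE_fiber_sums[OF assms(1)] by eventually_elim blast
  let ?N = "\<lambda>F \<alpha> x. \<integral>\<^sup>+q. ennreal ((cmod (fiber_coeff ?W F \<alpha> q x))\<^sup>2) \<partial>count_space UNIV"
  define fiber where "fiber F \<alpha> \<longleftrightarrow> (AE x in unit_interval. ennreal (A * fiber_form ?W F \<alpha> x) \<le> ?N F \<alpha> x \<and>
      ?N F \<alpha> x \<le> ennreal (B * fiber_form ?W F \<alpha> x))" for F \<alpha>
  have "bij (\<lambda>(k, l, m). ((k, l), m) :: (int \<times> int) \<times> int)"
    by (rule o_bij[of "\<lambda>((k, l), m). (k, l, m)"]) auto
  from frame_sequence_reindex[OF this, of lborel \<phi> A B]
  have "frame_sequence lborel
      (\<lambda>(k :: int, l :: int, m :: int). heis_translate (2 * real_of_int k, real_of_int l, real_of_int m) g) A B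
      \<longleftrightarrow> frame_sequence lborel \<phi> A B"
    by (simp add: \<phi>_def case_prod_beta')
  also have "\<dots> \<longleftrightarrow> (\<forall>F \<alpha>. finite F \<longrightarrow> fiber F \<alpha>)"
    unfolding fiber_def
    by (rule frame_sequence_iff_fiber_inequalities[OF \<phi> W gram pos assms(2,3)])
  also have "\<dots> \<longleftrightarrow> (\<forall>(F :: (int \<times> int) set) (\<alpha> :: int \<times> int \<Rightarrow> complex). finite F \<longrightarrow>
      (AE w in lborel. w \<in> {0<..1} \<longrightarrow>
        ennreal A * synthesis_sum g F \<alpha> w \<le> analysis_sum g F \<alpha> w \<and>
        analysis_sum g F \<alpha> w \<le> ennreal B * synthesis_sum g F \<alpha> w))"
  proof (intro all_cong1 imp_cong refl)
    fix F :: "(int \<times> int) set" and \<alpha> :: "int \<times> int \<Rightarrow> complex"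
    assume F: "finite F"
    have "AE x in unit_interval.
        (ennreal (A * fiber_form ?W F \<alpha> x) \<le> ?N F \<alpha> x \<and> ?N F \<alpha> x \<le> ennreal (B * fiber_form ?W F \<alpha> x)) \<longleftrightarrow>
        (ennreal A * synthesis_sum g F \<alpha> x \<le> analysis_sum g F \<alpha> x \<and> analysis_sum g F \<alpha> x \<le> ennreal B * synthesis_sum g F \<alpha> x)"
      using AE_fiber_sums[OF assms(1)]
      by eventually_elim (use F assms(2,3) in \<open>simp add: ennreal_mult\<close>)
    then have "fiber F \<alpha> \<longleftrightarrow> (AE x in unit_interval.
        ennreal A * synthesis_sum g F \<alpha> x \<le> analysis_sum g F \<alpha> x \<and> analysis_sum g F \<alpha> x \<le> ennreal B * synthesis_sum g F \<alpha> x)"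
      unfolding fiber_def by (auto elim: eventually_elim2)
    also have "\<dots> \<longleftrightarrow> (AE w in lborel. w \<in> {0<..1} \<longrightarrow>
        ennreal A * synthesis_sum g F \<alpha> w \<le> analysis_sum g F \<alpha> w \<and>
        analysis_sum g F \<alpha> w \<le> ennreal B * synthesis_sum g F \<alpha> w)"
      by (rule AE_restrict_space_iff) simp
    finally show "fiber F \<alpha> \<longleftrightarrow> (AE w in lborel. w \<in> {0<..1} \<longrightarrow>
        ennreal A * synthesis_sum g F \<alpha> w \<le> analysis_sum g F \<alpha> w \<and>
        analysis_sum g F \<alpha> w \<le> ennreal B * synthesis_sum g F \<alpha> w)" .
  qed
  finally show ?thesis .
qed

end
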